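(* There exists a 7-manifold $M$ with an ERP closed $\mathrm{G}_2$-structure $\varphi$ (with torsion 2-form not identically zero) whose induced metric $g_\varphi$ is complete and which is not homogeneous, i.e. the group of diffeomorphisms of $M$ preserving $\varphi$ does not act transitively on $M$.
   Context: A $\mathrm{G}_2$-structure on a 7-manifold $M$ is a 3-form $\varphi$ which at each point is linearly equivalent to $\phi=e^{123}+e^{145}+e^{167}+e^{246}-e^{257}-e^{347}-e^{356}$ on $\mathbb{R}^7$. It determines a metric $g_\varphi$, an orientation and a Hodge star $*_\varphi$ (coframes taking $\varphi$ to $\phi$ are declared oriented orthonormal). $\varphi$ is closed if $d\varphi=0$; then its torsion 2-form $\tau$ is the unique 2-form with $d{*_\varphi}\varphi=\tau\wedge\varphi$. A closed $\varphi$ is ERP (extremally Ricci-pinched, i.e. $1/6$-quadratic) if $d\tau=\frac17|\tau|^2\varphi+\frac16\left(\frac17|\tau|^2\varphi+*_\varphi(\tau\wedge\tau)\right)$. *)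

theory Defs
  imports "HOL-Analysis.Analysis"
begin

section \<open>Exterior algebra of \<open>\<real>\<^sup>7\<close>\<close>

type_synonym vec7 = "real ^ 7"

text \<open>A \<open>k\<close>-covector is a function of argument lists that vanishes on lists of length other
  than \<open>k\<close>. The index type \<^typ>\<open>7\<close> is the integers modulo 7, so its elements are
  \<open>1, \<dots>, 6, 7 = 0\<close>.\<close>

type_synonym covector = "vec7 list \<Rightarrow> real"

definition alternating_form :: "nat \<Rightarrow> covector \<Rightarrow> bool" where
  "alternating_form k \<alpha> \<longleftrightarrow>
     (\<forall>vs. length vs \<noteq> k \<longrightarrow> \<alpha> vs = 0) \<and>
     (\<forall>vs i. length vs = k \<and> i < k \<longrightarrow> linear (\<lambda>v. \<alpha> (vs[i := v]))) \<and>
     (\<forall>vs i j. length vs = k \<and> i < j \<and> j < k \<and> vs ! i = vs ! j \<longrightarrow> \<alpha> vs = 0)"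

text \<open>\<open>e\<^bsup>i\<^sub>1\<dots>i\<^sub>k\<^esup>(v\<^sub>1,\<dots>,v\<^sub>k) = det (e\<^bsup>i\<^sub>b\<^esup>(v\<^sub>a))\<close>, normalised so that
  \<open>e\<^bsup>i\<^sub>1\<dots>i\<^sub>k\<^esup>\<close> takes the value 1 on \<open>(e\<^bsub>i\<^sub>1\<^esub>,\<dots>,e\<^bsub>i\<^sub>k\<^esub>)\<close>.\<close>

definition basis_form :: "7 list \<Rightarrow> covector" where
  "basis_form is vs =
     (if length vs = length is
      then \<Sum>p | p permutes {..<length is}.
             of_int (sign p) * (\<Prod>b<length is. (vs ! p b) $ (is ! b))
      else 0)"

definition wedge :: "nat \<Rightarrow> nat \<Rightarrow> covector \<Rightarrow> covector \<Rightarrow> covector" where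
  "wedge k l \<alpha> \<beta> vs =
     (if length vs = k + l
      then (\<Sum>p | p permutes {..<k + l}.
              of_int (sign p) * \<alpha> (map (\<lambda>a. vs ! p a) [0..<k])
                              * \<beta> (map (\<lambda>a. vs ! p a) [k..<k + l])) / (fact k * fact l)
      else 0)"

definition pullback :: "(vec7 \<Rightarrow> vec7) \<Rightarrow> covector \<Rightarrow> covector" where
  "pullback L \<alpha> = (\<lambda>vs. \<alpha> (map L vs))"

definition phi0 :: covector where
  "phi0 vs = basis_form [1,2,3] vs + basis_form [1,4,5] vs + basis_form [1,6,7] vs
           + basis_form [2,4,6] vs - basis_form [2,5,7] vs - basis_form [3,4,7] vs
           - basis_form [3,5,6] vs"

subsection \<open>Linear algebra determined by a \<open>G\<^sub>2\<close> 3-covector\<close>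

definition adapted_coframe :: "covector \<Rightarrow> (vec7 \<Rightarrow> vec7) \<Rightarrow> bool" where
  "adapted_coframe \<phi> A \<longleftrightarrow> linear A \<and> bij A \<and> \<phi> = pullback A phi0"

text \<open>Adapted coframes are unique up to the stabiliser \<open>G\<^sub>2\<close> of \<^const>\<open>phi0\<close>, which lies in
  \<open>SO(7)\<close>. The metric, norm, volume form and Hodge star below therefore do not depend on which
  one is chosen.\<close>

definition coframe :: "covector \<Rightarrow> vec7 \<Rightarrow> vec7" where
  "coframe \<phi> = (SOME A. adapted_coframe \<phi> A)"

definition dual_frame :: "covector \<Rightarrow> 7 \<Rightarrow> vec7" where
  "dual_frame \<phi> i = inv (coframe \<phi>) (axis i 1)"

definition metric :: "covector \<Rightarrow> vec7 \<Rightarrow> vec7 \<Rightarrow> real" where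
  "metric \<phi> u v = coframe \<phi> u \<bullet> coframe \<phi> v"

definition volume_form :: "covector \<Rightarrow> covector" where
  "volume_form \<phi> = pullback (coframe \<phi>) (basis_form [1,2,3,4,5,6,7])"

text \<open>The norm on \<open>k\<close>-covectors for which the \<open>e\<^bsup>i\<^sub>1\<dots>i\<^sub>k\<^esup>\<close> with \<open>i\<^sub>1 < \<dots> < i\<^sub>k\<close> are
  orthonormal; the factor \<open>1/k!\<close> accounts for summing over all index tuples, and likewise in the
  Hodge star. The star is characterised by \<open>\<alpha> \<and> *\<beta> = \<langle>\<alpha>,\<beta>\<rangle> vol\<close>.\<close>

definition norm_sq :: "nat \<Rightarrow> covector \<Rightarrow> covector \<Rightarrow> real" where
  "norm_sq k \<phi> \<alpha> = (\<Sum>is | length is = k. (\<alpha> (map (dual_frame \<phi>) is))\<^sup>2) / fact k"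

definition hodge_star :: "nat \<Rightarrow> covector \<Rightarrow> covector \<Rightarrow> covector" where
  "hodge_star k \<phi> \<alpha> ws =
     (\<Sum>is | length is = k.
        \<alpha> (map (dual_frame \<phi>) is) * volume_form \<phi> (map (dual_frame \<phi>) is @ ws)) / fact k"


section \<open>Smooth manifolds of dimension 7\<close>

text \<open>A manifold is a topology together with an atlas. Its points may be taken from any fixed type
  \<open>'p\<close> with continuum many elements: a connected second countable manifold has at most that many
  points, so this loses no manifold.\<close>

text \<open>\<open>C\<^sup>k\<close> and smooth maps on an open set \<open>S\<close>.\<close>

primrec Ck_on :: "nat \<Rightarrow> vec7 set \<Rightarrow> (vec7 \<Rightarrow> 'b::real_normed_vector) \<Rightarrow> bool" where
  "Ck_on 0 S f \<longleftrightarrow> continuous_on S f"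
| "Ck_on (Suc k) S f \<longleftrightarrow>
     (\<forall>x\<in>S. f differentiable at x) \<and> (\<forall>v. Ck_on k S (\<lambda>x. frechet_derivative f (at x) v))"

definition smooth_on :: "vec7 set \<Rightarrow> (vec7 \<Rightarrow> 'b::real_normed_vector) \<Rightarrow> bool" where
  "smooth_on S f \<longleftrightarrow> (\<forall>k. Ck_on k S f)"

text \<open>A chart is its domain together with its coordinate map; only the values of that map on the
  domain matter.\<close>

type_synonym 'p chart = "'p set \<times> ('p \<Rightarrow> vec7)"

abbreviation cdom :: "'p chart \<Rightarrow> 'p set" where "cdom c \<equiv> fst c"
abbreviation cmap :: "'p chart \<Rightarrow> 'p \<Rightarrow> vec7" where "cmap c \<equiv> snd c"
abbreviation cimg :: "'p chart \<Rightarrow> vec7 set" where "cimg c \<equiv> cmap c ` cdom c"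

definition is_chart :: "'p topology \<Rightarrow> 'p chart \<Rightarrow> bool" where
  "is_chart X c \<longleftrightarrow> openin X (cdom c) \<and> open (cimg c) \<and>
     homeomorphic_map (subtopology X (cdom c)) (top_of_set (cimg c)) (cmap c)"

text \<open>The expression of a map \<open>h\<close> in the charts \<open>c\<close> (source) and \<open>d\<close> (target), and the set of
  coordinates where it is defined; for \<open>h = id\<close> this is the transition map.\<close>

definition local_rep :: "'p chart \<Rightarrow> 'p chart \<Rightarrow> ('p \<Rightarrow> 'p) \<Rightarrow> vec7 \<Rightarrow> vec7" where
  "local_rep c d h = cmap d \<circ> h \<circ> inv_into (cdom c) (cmap c)"

definition local_dom :: "'p chart \<Rightarrow> 'p chart \<Rightarrow> ('p \<Rightarrow> 'p) \<Rightarrow> vec7 set" where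
  "local_dom c d h = cmap c ` {p \<in> cdom c. h p \<in> cdom d}"

definition smooth_manifold :: "'p topology \<Rightarrow> 'p chart set \<Rightarrow> bool" where
  "smooth_manifold X \<A> \<longleftrightarrow>
     Hausdorff_space X \<and> second_countable X \<and>
     (\<forall>c\<in>\<A>. is_chart X c) \<and> (\<Union>c\<in>\<A>. cdom c) = topspace X \<and>
     (\<forall>c\<in>\<A>. \<forall>d\<in>\<A>. smooth_on (local_dom c d id) (local_rep c d id))"

definition smooth_map :: "'p topology \<Rightarrow> 'p chart set \<Rightarrow> ('p \<Rightarrow> 'p) \<Rightarrow> bool" where
  "smooth_map X \<A> h \<longleftrightarrow> continuous_map X X h \<and>
     (\<forall>c\<in>\<A>. \<forall>d\<in>\<A>. smooth_on (local_dom c d h) (local_rep c d h))"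

definition diffeomorphism :: "'p topology \<Rightarrow> 'p chart set \<Rightarrow> ('p \<Rightarrow> 'p) \<Rightarrow> bool" where
  "diffeomorphism X \<A> h \<longleftrightarrow> bij_betw h (topspace X) (topspace X) \<and>
     smooth_map X \<A> h \<and> smooth_map X \<A> (inv_into (topspace X) h)"


section \<open>Differential forms\<close>

text \<open>A differential form on a manifold is given by its coordinate expression \<open>\<omega> c\<close> in each
  chart \<open>c\<close> of the atlas; only values at points of \<open>cimg c\<close> matter. The condition
  \<open>preserves\<close>, for \<open>h = id\<close>, is the transformation law between charts, and in general it says
  \<open>h\<^sup>*\<omega> = \<omega>\<close>.\<close>

type_synonym 'p form_field = "'p chart \<Rightarrow> vec7 \<Rightarrow> covector"

definition preserves :: "'p chart set \<Rightarrow> 'p form_field \<Rightarrow> ('p \<Rightarrow> 'p) \<Rightarrow> bool" where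
  "preserves \<A> \<omega> h \<longleftrightarrow>
     (\<forall>c\<in>\<A>. \<forall>d\<in>\<A>. \<forall>x\<in>local_dom c d h.
        \<omega> c x = pullback (frechet_derivative (local_rep c d h) (at x))
                         (\<omega> d (local_rep c d h x)))"

definition differential_form :: "'p chart set \<Rightarrow> nat \<Rightarrow> 'p form_field \<Rightarrow> bool" where
  "differential_form \<A> k \<omega> \<longleftrightarrow>
     (\<forall>c\<in>\<A>. \<forall>x\<in>cimg c. alternating_form k (\<omega> c x)) \<and>
     (\<forall>c\<in>\<A>. \<forall>vs. smooth_on (cimg c) (\<lambda>x. \<omega> c x vs)) \<and>
     preserves \<A> \<omega> id"

text \<open>\<open>(d\<omega>)(v\<^sub>0,\<dots>,v\<^sub>k) = \<Sum>\<^sub>i (-1)\<^sup>i v\<^sub>i(\<omega>(\<dots>,v\<^sub>i omitted,\<dots>))\<close> for constant vector fields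
  on an open subset of \<open>\<real>\<^sup>7\<close>.\<close>

definition ext_deriv :: "(vec7 \<Rightarrow> covector) \<Rightarrow> vec7 \<Rightarrow> covector" where
  "ext_deriv \<omega> x vs =
     (\<Sum>i<length vs. (-1) ^ i *
        frechet_derivative (\<lambda>y. \<omega> y (take i vs @ drop (Suc i) vs)) (at x) (vs ! i))"


section \<open>\<open>G\<^sub>2\<close>-structures\<close>

definition G2_structure :: "'p chart set \<Rightarrow> 'p form_field \<Rightarrow> bool" where
  "G2_structure \<A> \<phi> \<longleftrightarrow> differential_form \<A> 3 \<phi> \<and>
     (\<forall>c\<in>\<A>. \<forall>x\<in>cimg c. \<exists>A. adapted_coframe (\<phi> c x) A)"

definition closed_form :: "'p chart set \<Rightarrow> 'p form_field \<Rightarrow> bool" where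
  "closed_form \<A> \<omega> \<longleftrightarrow> (\<forall>c\<in>\<A>. \<forall>x\<in>cimg c. \<forall>vs. ext_deriv (\<omega> c) x vs = 0)"

text \<open>For closed \<open>\<phi>\<close> there is exactly one such \<open>\<tau>\<close> (up to values outside the chart images).\<close>

definition torsion_form :: "'p chart set \<Rightarrow> 'p form_field \<Rightarrow> 'p form_field \<Rightarrow> bool" where
  "torsion_form \<A> \<phi> \<tau> \<longleftrightarrow> differential_form \<A> 2 \<tau> \<and>
     (\<forall>c\<in>\<A>. \<forall>x\<in>cimg c.
        ext_deriv (\<lambda>y. hodge_star 3 (\<phi> c y) (\<phi> c y)) x = wedge 2 3 (\<tau> c x) (\<phi> c x))"

definition ERP :: "'p chart set \<Rightarrow> 'p form_field \<Rightarrow> 'p form_field \<Rightarrow> bool" where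
  "ERP \<A> \<phi> \<tau> \<longleftrightarrow>
     (\<forall>c\<in>\<A>. \<forall>x\<in>cimg c. \<forall>vs.
        ext_deriv (\<tau> c) x vs =
          1 / 7 * norm_sq 2 (\<phi> c x) (\<tau> c x) * \<phi> c x vs
          + 1 / 6 * (1 / 7 * norm_sq 2 (\<phi> c x) (\<tau> c x) * \<phi> c x vs
                     + hodge_star 4 (\<phi> c x) (wedge 2 2 (\<tau> c x) (\<tau> c x)) vs))"

definition not_identically_zero :: "'p chart set \<Rightarrow> 'p form_field \<Rightarrow> bool" where
  "not_identically_zero \<A> \<omega> \<longleftrightarrow> (\<exists>c\<in>\<A>. \<exists>x\<in>cimg c. \<exists>vs. \<omega> c x vs \<noteq> 0)"

definition homogeneous :: "'p topology \<Rightarrow> 'p chart set \<Rightarrow> 'p form_field \<Rightarrow> bool" where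
  "homogeneous X \<A> \<phi> \<longleftrightarrow>
     (\<forall>p\<in>topspace X. \<forall>q\<in>topspace X.
        \<exists>h. diffeomorphism X \<A> h \<and> preserves \<A> \<phi> h \<and> h p = q)"


section \<open>Completeness of the induced metric\<close>

definition C1_curve_on ::
  "'p topology \<Rightarrow> 'p chart set \<Rightarrow> real \<Rightarrow> real \<Rightarrow> (real \<Rightarrow> 'p) \<Rightarrow> bool" where
  "C1_curve_on X \<A> a b \<gamma> \<longleftrightarrow> continuous_map (top_of_set {a..b}) X \<gamma> \<and>
     (\<forall>c\<in>\<A>. \<exists>D. continuous_on {t\<in>{a..b}. \<gamma> t \<in> cdom c} D \<and>
        (\<forall>t\<in>{a..b}. \<gamma> t \<in> cdom c \<longrightarrow>
           ((cmap c \<circ> \<gamma>) has_vector_derivative D t) (at t within {a..b})))"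

definition piecewise_C1_curve :: "'p topology \<Rightarrow> 'p chart set \<Rightarrow> (real \<Rightarrow> 'p) \<Rightarrow> bool" where
  "piecewise_C1_curve X \<A> \<gamma> \<longleftrightarrow>
     (\<exists>n t. t 0 = 0 \<and> t n = 1 \<and>
        (\<forall>i<n. t i < t (Suc i) \<and> C1_curve_on X \<A> (t i) (t (Suc i)) \<gamma>))"

text \<open>The speed does not depend on the chart chosen around \<open>\<gamma> t\<close>. It is meaningless at the finitely
  many break points, which do not affect the length.\<close>

definition speed :: "'p chart set \<Rightarrow> 'p form_field \<Rightarrow> (real \<Rightarrow> 'p) \<Rightarrow> real \<Rightarrow> real" where
  "speed \<A> \<phi> \<gamma> t =
     (let c = (SOME c. c \<in> \<A> \<and> \<gamma> t \<in> cdom c);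
          v = vector_derivative (cmap c \<circ> \<gamma>) (at t)
      in sqrt (metric (\<phi> c (cmap c (\<gamma> t))) v v))"

definition curve_length :: "'p chart set \<Rightarrow> 'p form_field \<Rightarrow> (real \<Rightarrow> 'p) \<Rightarrow> real" where
  "curve_length \<A> \<phi> \<gamma> = integral {0..1} (speed \<A> \<phi> \<gamma>)"

definition riem_dist ::
  "'p topology \<Rightarrow> 'p chart set \<Rightarrow> 'p form_field \<Rightarrow> 'p \<Rightarrow> 'p \<Rightarrow> real" where
  "riem_dist X \<A> \<phi> p q =
     Inf {curve_length \<A> \<phi> \<gamma> | \<gamma>. piecewise_C1_curve X \<A> \<gamma> \<and> \<gamma> 0 = p \<and> \<gamma> 1 = q}"

text \<open>Every Cauchy sequence for the Riemannian distance converges. This is meant for connected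
  manifolds, where any two points are joined by a curve.\<close>

definition complete_metric :: "'p topology \<Rightarrow> 'p chart set \<Rightarrow> 'p form_field \<Rightarrow> bool" where
  "complete_metric X \<A> \<phi> \<longleftrightarrow>
     (\<forall>\<sigma> :: nat \<Rightarrow> 'p.
        range \<sigma> \<subseteq> topspace X \<and>
        (\<forall>\<epsilon>>0. \<exists>N. \<forall>m\<ge>N. \<forall>n\<ge>N. riem_dist X \<A> \<phi> (\<sigma> m) (\<sigma> n) < \<epsilon>) \<longrightarrow>
        (\<exists>p\<in>topspace X. (\<lambda>n. riem_dist X \<A> \<phi> (\<sigma> n) p) \<longlonglongrightarrow> 0))"

end

theory Submission
  imports Defs "Jordan_Normal_Form.Determinant"
begin

text \<open>The wedge product makes \<open>\<Lambda>\<^sup>2(\<real>\<^sup>4)\<^sup>*\<close> a quadratic space of signature \<open>(3,3)\<close>. If \<open>F\<close> parametrizes a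
  spacelike maximal 3-fold \<open>B\<close> in its hyperquadric of vectors of norm \<open>-1\<close>, then
  \<open>\<phi> = vol\<^sub>B + dF\<close> is a closed \<open>G\<^sub>2\<close>-structure on \<open>B \<times> \<real>\<^sup>4\<close> with torsion \<open>3F\<close>, because maximality
  means \<open>\<Delta>F = 3F\<close> and so \<open>d*\<phi> = 3 vol\<^sub>B \<and> F\<close>; it is ERP because \<open>d\<tau> = 3(\<phi> - vol\<^sub>B)\<close>. We take
  \<open>F = cosh t (e\<^bsup>p+q\<^esup> e\<^bsup>46\<^esup> + e\<^bsup>p-q\<^esup> e\<^bsup>47\<^esup> + e\<^bsup>-p-q\<^esup> e\<^bsup>57\<^esup> - e\<^bsup>q-p\<^esup> e\<^bsup>56\<^esup>) + sinh t (e\<^bsup>45\<^esup> + 2 e\<^bsup>67\<^esup>)\<close>,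
  the warped product of a line with the flat maximal surface in anti-de Sitter 3-space. Its metric
  \<open>dt\<^sup>2 + cosh\<^sup>2 t (dp\<^sup>2 + dq\<^sup>2)\<close> dominates the Euclidean one, which gives completeness.

  An automorphism of \<open>\<phi>\<close> preserves \<open>d*\<phi> = 3 vol\<^sub>B \<and> F\<close> and the metric, hence the fibration
  over \<open>B\<close> and its orthogonal complement. So it acts on the values of \<open>F\<close> by one fixed linear map
  of \<open>\<real>\<^sup>4\<close>, and such a map must preserve the totally geodesic surface \<open>t = 0\<close>.\<close>

text \<open>An automorphism is an arbitrary diffeomorphism, so every constraint on it must come from
  objects that \<open>phi\<close> determines. The 5-form \<open>d*phi\<close> is used in preference
  to \<open>tau\<close>: its invariance follows from that of \<open>*phi\<close> and from d
  commuting with pullback, and \<open>tau\<close> on a fibre is recovered by dividing out vol_B,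
  which is \<open>phi\<close> on horizontal vectors. Since F is nondegenerate on fibres, the 1-forms
  killed by vol_B \<and> F are exactly those from the base; this gives the vertical distribution,
  and the metric gives the horizontal one. Both are constant in the coordinates, so the automorphism
  is a product map, and the derivative of its fibre factor at one fibre point serves all base
  points. The coefficient 2 in e^45 + 2 e^67 balances wedge squares: the exponential part has square
  -4 e^4567, the other part has square 4 e^4567, and their product is 0, so F \<and> F = -4 e^4567
  for all t. Equal coefficients would bring in a square root of 2. The price is that the fibre
  volume form is 2 e^4567.\<close>

no_notation Matrix.vec_index (infixl \<open>$\<close> 100)
no_notation Matrix.scalar_prod (infix \<open>\<bullet>\<close> 70)

section \<open>Exterior calculus in coordinates\<close>

lemma basis_form_conv_det:
  assumes "length vs = length is"
  shows "basis_form is vs =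
    Determinant.det (Matrix.mat (length is) (length is) (\<lambda>(b, a). vs ! a $ is ! b))"
proof -
  let ?n = "length is"
  let ?A = "Matrix.mat ?n ?n (\<lambda>(b, a). vs ! a $ is ! b)"
  have "Determinant.det ?A = (\<Sum>p | p permutes {0..<?n}.
      of_int (sign p) * (\<Prod>i = 0..<?n. ?A $$ (i, p i)))"
    by (rule det_def') auto
  also have "\<dots> = basis_form is vs"
    unfolding basis_form_def using assms
    by (auto simp: lessThan_atLeast0 intro!: sum.cong prod.cong)
  finally show ?thesis by simp
qed

text \<open>Peeling off the first index has the shape of the formula for \<open>ext_deriv\<close>;
  this is what later identifies d(f e^I) with df \<and> e^I.\<close>

lemma basis_form_row:
  assumes len: "length vs = Suc (length is)"
  shows "basis_form (a # is) vs =
    (\<Sum>i<length vs. (-1) ^ i * vs ! i $ a * basis_form is (take i vs @ drop (Suc i) vs))"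
proof -
  let ?n = "length is"
  let ?A = "Matrix.mat (Suc ?n) (Suc ?n) (\<lambda>(b, i). vs ! i $ (a # is) ! b)"
  have "basis_form (a # is) vs = Determinant.det ?A"
    using basis_form_conv_det[of vs "a # is"] len by simp
  also have "\<dots> = (\<Sum>j<Suc ?n. ?A $$ (0, j) * cofactor ?A 0 j)"
    by (rule laplace_expansion_row) auto
  also have "\<dots> = (\<Sum>i<length vs. (-1) ^ i * vs ! i $ a *
      basis_form is (take i vs @ drop (Suc i) vs))"
    unfolding len
  proof (rule sum.cong[OF refl])
    fix j assume j: "j \<in> {..<Suc ?n}"
    have "mat_delete ?A 0 j =
        Matrix.mat ?n ?n (\<lambda>(b, i). (take j vs @ drop (Suc j) vs) ! i $ is ! b)"
      unfolding mat_delete_def using j len by (auto simp: nth_append min_def intro!: eq_matI)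
    then show "?A $$ (0, j) * cofactor ?A 0 j =
        (-1) ^ j * vs ! j $ a * basis_form is (take j vs @ drop (Suc j) vs)"
      using j len by (subst basis_form_conv_det) (auto simp: cofactor_def)
  qed
  finally show ?thesis .
qed

lemma basis_form_column:
  assumes len: "length is = Suc (length vs)"
  shows "basis_form is (v # vs) =
    (\<Sum>j<length is. (-1) ^ j * v $ is ! j * basis_form (take j is @ drop (Suc j) is) vs)"
proof -
  let ?n = "length vs"
  let ?A = "Matrix.mat (Suc ?n) (Suc ?n) (\<lambda>(b, i). (v # vs) ! i $ is ! b)"
  have "basis_form is (v # vs) = Determinant.det ?A"
    using basis_form_conv_det[of "v # vs" "is"] len by simp
  also have "\<dots> = (\<Sum>j<Suc ?n. ?A $$ (j, 0) * cofactor ?A j 0)"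
    by (rule laplace_expansion_column) auto
  also have "\<dots> = (\<Sum>j<length is. (-1) ^ j * v $ is ! j *
      basis_form (take j is @ drop (Suc j) is) vs)"
    unfolding len
  proof (rule sum.cong[OF refl])
    fix j assume j: "j \<in> {..<Suc ?n}"
    have "mat_delete ?A j 0 =
        Matrix.mat ?n ?n (\<lambda>(b, i). vs ! i $ (take j is @ drop (Suc j) is) ! b)"
      unfolding mat_delete_def using j len by (auto simp: nth_append min_def intro!: eq_matI)
    then show "?A $$ (j, 0) * cofactor ?A j 0 =
        (-1) ^ j * v $ is ! j * basis_form (take j is @ drop (Suc j) is) vs"
      using j len by (subst basis_form_conv_det) (auto simp: cofactor_def)
  qed
  finally show ?thesis .
qed

lemma basis_form_identical:
  assumes "i < j" "j < length vs" "vs ! i = vs ! j"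
  shows "basis_form is vs = 0"
proof (cases "length vs = length is")
  case True
  show ?thesis unfolding basis_form_conv_det[OF True]
    by (rule det_identical_columns[of _ "length is" i j])
       (use assms True in \<open>auto intro!: eq_vecI\<close>)
qed (simp add: basis_form_def)

lemma basis_form_permute_index:
  assumes "q permutes {..<length is}"
  shows "basis_form (map (\<lambda>b. is ! q b) [0..<length is]) vs = of_int (sign q) * basis_form is vs"
proof (cases "length vs = length is")
  case True
  let ?n = "length is"
  let ?f = "\<lambda>p. of_int (sign p) * (\<Prod>b<?n. vs ! p b $ is ! q b)"
  have pq: "permutation q" using assms by (meson finite_lessThan permutation_permutes)
  have "basis_form (map (\<lambda>b. is ! q b) [0..<?n]) vs = (\<Sum>p | p permutes {..<?n}. ?f p)"
    using True by (simp add: basis_form_def)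
  also have "\<dots> = (\<Sum>p | p permutes {..<?n}. ?f (p \<circ> q))"
    by (rule sum_permutations_compose_right[OF assms])
  also have "\<dots> = (\<Sum>p | p permutes {..<?n}.
      of_int (sign q) * (of_int (sign p) * (\<Prod>b<?n. vs ! p b $ is ! b)))"
  proof (rule sum.cong[OF refl])
    fix p assume "p \<in> {p. p permutes {..<?n}}"
    then have "permutation p" by (metis finite_lessThan mem_Collect_eq permutation_permutes)
    moreover have "(\<Prod>b<?n. vs ! p (q b) $ is ! q b) = (\<Prod>b<?n. vs ! p b $ is ! b)"
      using prod.permute[OF assms, of "\<lambda>b. vs ! p b $ is ! b"] by (simp add: o_def)
    ultimately show "?f (p \<circ> q) = of_int (sign q) * (of_int (sign p) * (\<Prod>b<?n. vs ! p b $ is ! b))"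
      using pq by (simp add: sign_compose)
  qed
  also have "\<dots> = of_int (sign q) * basis_form is vs"
    using True by (simp add: basis_form_def sum_distrib_left)
  finally show ?thesis .
qed (simp add: basis_form_def)

lemma swap_conv_nth_transpose:
  "xs @ a # b # ys = map (\<lambda>i. (xs @ b # a # ys) ! Transposition.transpose (length xs) (Suc (length xs)) i)
     [0..<length (xs @ b # a # ys)]"
  (is "?zs = map (\<lambda>i. ?is ! ?q i) _")
proof (rule nth_equalityI)
  let ?k = "length xs"
  fix i assume i: "i < length ?zs"
  consider "i < ?k" | "i = ?k" | "i = Suc ?k" | m where "i = Suc (Suc (?k + m))"
    by (metis Suc_lessI less_iff_Suc_add not_less_iff_gr_or_eq add_Suc)
  then show "?zs ! i = map (\<lambda>i. ?is ! ?q i) [0..<length ?is] ! i"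
    using i by cases (auto simp: nth_append Transposition.transpose_def simp del: upt_Suc)
qed simp

lemma basis_form_swap_index: "basis_form (xs @ a # b # ys) vs = - basis_form (xs @ b # a # ys) vs"
proof -
  let ?is = "xs @ b # a # ys" and ?k = "length xs"
  let ?q = "Transposition.transpose ?k (Suc ?k)"
  have q: "?q permutes {..<length ?is}" by (rule permutes_swap_id) auto
  note eq = swap_conv_nth_transpose[of xs a b ys]
  show ?thesis
    unfolding eq basis_form_permute_index[OF q] by (simp add: sign_swap_id)
qed

text \<open>Shifting carries transpositions to transpositions, so induction over a factorisation
  into transpositions preserves the sign.\<close>

lemma sign_shift:
  fixes k l :: nat
  assumes "r permutes {..<l}"
  defines "shift \<equiv> \<lambda>r x. if x < k then x else k + r (x - k)"
  shows "shift r permutes {..<k + l}" "sign (shift r) = sign r"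
proof -
  have tr: "shift (Transposition.transpose a b \<circ> p) = Transposition.transpose (k + a) (k + b) \<circ> shift p" for a b p
    by (auto simp: shift_def Transposition.transpose_def fun_eq_iff)
  have "shift r permutes {..<k + l} \<and> permutation r \<and> permutation (shift r) \<and> sign (shift r) = sign r"
    using assms(1) finite_lessThan
  proof (induction rule: permutes_induct)
    case id
    have "shift id = id" by (auto simp: shift_def fun_eq_iff)
    then show ?case by (simp only:) (intro conjI permutes_id permutation_id refl)
  next
    case (swap a b p)
    have t: "Transposition.transpose (k + a) (k + b) permutes {..<k + l}"
      using swap by (intro permutes_swap_id) auto
    show ?case unfolding tr
    proof (intro conjI)
      have ih: "shift p permutes {..<k + l}" "permutation p" "permutation (shift p)"
        "sign (shift p) = sign p" using swap by auto
      show "Transposition.transpose (k + a) (k + b) \<circ> shift p permutes {..<k + l}"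
        using ih t by (rule_tac permutes_compose)
      show "permutation (Transposition.transpose a b \<circ> p)"
        by (rule permutation_compose[OF permutation_swap_id ih(2)])
      show "permutation (Transposition.transpose (k + a) (k + b) \<circ> shift p)"
        by (rule permutation_compose[OF permutation_swap_id ih(3)])
      show "sign (Transposition.transpose (k + a) (k + b) \<circ> shift p) =
          sign (Transposition.transpose a b \<circ> p)"
        unfolding sign_compose[OF permutation_swap_id ih(2)] sign_compose[OF permutation_swap_id ih(3)]
        using ih(4) by (simp add: sign_swap_id)
    qed
  qed
  then show "shift r permutes {..<k + l}" "sign (shift r) = sign r" by auto
qed

text \<open>The two factors expand over permutations \<open>q\<close> and \<open>r\<close> of the
  two blocks of positions. Together these form one permutation of all positions, and composing the
  outer permutation with it absorbs both signs. So each of the k! l! pairs contributes the same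
  value, which cancels the normalisation of \<open>wedge\<close>.\<close>

lemma wedge_basis_form:
  "wedge (length is) (length js) (basis_form is) (basis_form js) = basis_form (is @ js)"
proof (rule ext)
  fix vs
  let ?k = "length is" and ?l = "length js"
  let ?P = "\<lambda>n::nat. {p. p permutes {..<n}}"
  show "wedge ?k ?l (basis_form is) (basis_form js) vs = basis_form (is @ js) vs"
  proof (cases "length vs = ?k + ?l")
    case True
    define f where "f p = of_int (sign p) * (\<Prod>b<?k + ?l. vs ! p b $ (is @ js) ! b)" for p
    define g where "g p q r = of_int (sign p) * (of_int (sign q) * (\<Prod>b<?k. vs ! p (q b) $ is ! b))
       * (of_int (sign r) * (\<Prod>b<?l. vs ! p (?k + r b) $ js ! b))" for p q r
    have inner: "(\<Sum>p\<in>?P (?k + ?l). g p q r) = basis_form (is @ js) vs"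
      if q: "q \<in> ?P ?k" and r: "r \<in> ?P ?l" for q r
    proof -
      let ?r = "\<lambda>x. if x < ?k then x else ?k + r (x - ?k)"
      have r': "?r permutes {..<?k + ?l}" "sign ?r = sign r"
        using sign_shift[of r ?l ?k] r by auto
      have q': "q permutes {..<?k + ?l}"
        using q by (auto intro: permutes_subset)
      let ?s = "?r \<circ> q"
      have s: "?s permutes {..<?k + ?l}" using q' r' by (auto intro: permutes_compose)
      have perm: "permutation q" "permutation ?r" "permutation ?s"
        using q' r'(1) s by (meson finite_lessThan permutation_permutes)+
      have sq: "?s b = q b" if "b < ?k" for b
      proof -
        have "q b < ?k" using that q by (metis lessThan_iff mem_Collect_eq permutes_in_image)
        then show ?thesis by simp
      qed
      have sr: "?s (?k + b) = ?k + r b" for b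
        using q by (simp add: permutes_def)
      have "g p q r = f (p \<circ> ?s)" if "p \<in> ?P (?k + ?l)" for p
      proof -
        have "permutation p" using that by (metis finite_lessThan mem_Collect_eq permutation_permutes)
        then have "of_int (sign (p \<circ> ?s)) = (of_int (sign p) * of_int (sign q) * of_int (sign r) :: real)"
          using perm r'(2) by (simp add: sign_compose)
        moreover have "(\<Prod>b<?k + ?l. vs ! p (?s b) $ (is @ js) ! b) =
           (\<Prod>b<?k. vs ! p (q b) $ is ! b) * (\<Prod>b<?l. vs ! p (?k + r b) $ js ! b)"
        proof -
          have "{..<?k + ?l} = {..<?k} \<union> (+) ?k ` {..<?l}"
            unfolding lessThan_atLeast0 image_add_atLeastLessThan by auto
          then have "(\<Prod>b<?k + ?l. vs ! p (?s b) $ (is @ js) ! b) =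
            (\<Prod>b<?k. vs ! p (?s b) $ (is @ js) ! b) * (\<Prod>b\<in>(+) ?k ` {..<?l}. vs ! p (?s b) $ (is @ js) ! b)"
            by (simp only:, subst prod.union_disjoint) auto
          also have "(\<Prod>b\<in>(+) ?k ` {..<?l}. vs ! p (?s b) $ (is @ js) ! b) =
             (\<Prod>b<?l. vs ! p (?s (?k + b)) $ (is @ js) ! (?k + b))"
            by (subst prod.reindex) (auto simp: o_def)
          also have "\<dots> = (\<Prod>b<?l. vs ! p (?k + r b) $ js ! b)"
            unfolding sr by simp
          also have "(\<Prod>b<?k. vs ! p (?s b) $ (is @ js) ! b) = (\<Prod>b<?k. vs ! p (q b) $ is ! b)"
            using sq by (intro prod.cong) (simp_all add: nth_append)
          finally show ?thesis .
        qed
        ultimately show ?thesis by (simp add: f_def g_def)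
      qed
      then have "(\<Sum>p\<in>?P (?k + ?l). g p q r) = (\<Sum>p\<in>?P (?k + ?l). f (p \<circ> ?s))"
        by (rule sum.cong[OF refl])
      also have "\<dots> = (\<Sum>p\<in>?P (?k + ?l). f p)"
        by (rule sum_permutations_compose_right[OF s, symmetric])
      finally show ?thesis using True by (simp add: basis_form_def f_def)
    qed
    have nth: "map (\<lambda>a. vs ! p a) [0..<?k] ! q b = vs ! p (q b)" if "q \<in> ?P ?k" "b < ?k" for p q b
    proof -
      have "q b < ?k" using that by (metis lessThan_iff mem_Collect_eq permutes_in_image)
      then show ?thesis by simp
    qed
    have nth': "map (\<lambda>a. vs ! p a) [?k..<?k + ?l] ! r b = vs ! p (?k + r b)" if "r \<in> ?P ?l" "b < ?l" for p r b
    proof -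
      have "r b < ?l" using that by (metis lessThan_iff mem_Collect_eq permutes_in_image)
      then show ?thesis by simp
    qed
    have "(\<Sum>p\<in>?P (?k + ?l). of_int (sign p) * basis_form is (map (\<lambda>a. vs ! p a) [0..<?k])
        * basis_form js (map (\<lambda>a. vs ! p a) [?k..<?k + ?l])) =
      (\<Sum>p\<in>?P (?k + ?l). \<Sum>q\<in>?P ?k. \<Sum>r\<in>?P ?l. g p q r)"
    proof (rule sum.cong[OF refl])
      fix p
      have a: "basis_form is (map (\<lambda>a. vs ! p a) [0..<?k]) =
          (\<Sum>q\<in>?P ?k. of_int (sign q) * (\<Prod>b<?k. vs ! p (q b) $ is ! b))"
        unfolding basis_form_def by (auto intro!: sum.cong prod.cong simp: nth)
      have b: "basis_form js (map (\<lambda>a. vs ! p a) [?k..<?k + ?l]) =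
          (\<Sum>r\<in>?P ?l. of_int (sign r) * (\<Prod>b<?l. vs ! p (?k + r b) $ js ! b))"
        unfolding basis_form_def by (auto intro!: sum.cong prod.cong simp: nth')
      show "of_int (sign p) * basis_form is (map (\<lambda>a. vs ! p a) [0..<?k])
          * basis_form js (map (\<lambda>a. vs ! p a) [?k..<?k + ?l]) = (\<Sum>q\<in>?P ?k. \<Sum>r\<in>?P ?l. g p q r)"
        unfolding a b g_def sum_distrib_left[of "of_int (sign p)"] sum_product by (simp add: mult.assoc)
    qed
    also have "\<dots> = (\<Sum>q\<in>?P ?k. \<Sum>r\<in>?P ?l. \<Sum>p\<in>?P (?k + ?l). g p q r)"
      by (subst sum.swap, rule sum.cong[OF refl], rule sum.swap)
    also have "\<dots> = fact ?k * fact ?l * basis_form (is @ js) vs"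
      using card_permutations[of "{..<?k}" ?k] card_permutations[of "{..<?l}" ?l]
      by (subst sum.cong[OF refl sum.cong[OF refl inner]]) auto
    finally show ?thesis using True by (simp add: wedge_def)
  qed (simp add: wedge_def basis_form_def)
qed


text \<open>Labels are natural numbers instead of elements of the type \<open>7\<close>, so that the
  simplifier can compare and sort them as numerals.\<close>

definition eform :: "nat list \<Rightarrow> covector" where
  "eform is = basis_form (map of_nat is)"

lemma eform_eq_0: "length vs \<noteq> length is \<Longrightarrow> eform is vs = 0"
  by (simp add: eform_def basis_form_def)

lemma eform_Nil: "eform [] [] = 1"
  by (simp add: eform_def basis_form_def)

lemma eform_row:
  assumes "length vs = Suc (length is)"
  shows "eform (a # is) vs =
    (\<Sum>i<length vs. (-1) ^ i * vs ! i $ of_nat a * eform is (take i vs @ drop (Suc i) vs))"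
  unfolding eform_def list.map by (rule basis_form_row) (use assms in simp)

lemma eform_column:
  assumes "length is = Suc (length vs)"
  shows "eform is (v # vs) =
    (\<Sum>j<length is. (-1) ^ j * v $ of_nat (is ! j) * eform (take j is @ drop (Suc j) is) vs)"
  unfolding eform_def
  by (subst basis_form_column) (use assms in \<open>auto simp: take_map drop_map\<close>)

lemma eform_swap: "eform (xs @ a # b # ys) vs = - eform (xs @ b # a # ys) vs"
  unfolding eform_def map_append list.map by (rule basis_form_swap_index)

lemma eform_repeat: "eform (xs @ a # a # ys) vs = 0"
  using eform_swap[of xs a a ys vs] by simp

lemma wedge_eform:
  "length is = k \<Longrightarrow> length js = l \<Longrightarrow> wedge k l (eform is) (eform js) = eform (is @ js)"
  using wedge_basis_form[of "map of_nat is" "map of_nat js"] by (simp add: eform_def)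

text \<open>Formal linear combinations of coordinate forms. By \<open>lc_eqI\<close> below, an identity between forms
  reduces to the vanishing of the coefficients of a list that the simplifier can compute.\<close>

definition lc :: "(real \<times> nat list) list \<Rightarrow> covector" where
  "lc xs vs = (\<Sum>(c, is)\<leftarrow>xs. c * eform is vs)"

lemma lc_Nil [simp]: "lc [] vs = 0" by (simp add: lc_def)

lemma lc_Cons: "lc ((c, is) # xs) vs = c * eform is vs + lc xs vs"
  by (simp add: lc_def)

lemma lc_append: "lc (xs @ ys) vs = lc xs vs + lc ys vs"
  by (simp add: lc_def)

definition homog :: "nat \<Rightarrow> (real \<times> nat list) list \<Rightarrow> bool" where
  "homog k xs \<longleftrightarrow> (\<forall>(c, is)\<in>set xs. length is = k)"

lemma homog_simps [simp]: "homog k []" "homog k ((c, is) # xs) \<longleftrightarrow> length is = k \<and> homog k xs"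
  by (auto simp: homog_def)

definition lc_wedge :: "(real \<times> nat list) list \<Rightarrow> (real \<times> nat list) list \<Rightarrow> (real \<times> nat list) list" where
  "lc_wedge xs ys = concat (map (\<lambda>(c, is). map (\<lambda>(d, js). (c * d, is @ js)) ys) xs)"

lemma lc_wedge_simps:
  "lc_wedge [] ys = []"
  "lc_wedge ((c, is) # xs) ys = map (\<lambda>(d, js). (c * d, is @ js)) ys @ lc_wedge xs ys"
  by (simp_all add: lc_wedge_def)

lemma wedge_add_left: "wedge k l (\<lambda>vs. c * \<alpha> vs + \<beta> vs) \<gamma> vs = c * wedge k l \<alpha> \<gamma> vs + wedge k l \<beta> \<gamma> vs"
  by (simp add: wedge_def algebra_simps sum.distrib sum_distrib_left add_divide_distrib)

lemma wedge_add_right: "wedge k l \<alpha> (\<lambda>vs. c * \<beta> vs + \<gamma> vs) vs = c * wedge k l \<alpha> \<beta> vs + wedge k l \<alpha> \<gamma> vs"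
  by (simp add: wedge_def algebra_simps sum.distrib sum_distrib_left add_divide_distrib)

lemma wedge_0: "wedge k l (\<lambda>vs. 0) \<gamma> vs = 0" "wedge k l \<gamma> (\<lambda>vs. 0) vs = 0"
  by (simp_all add: wedge_def)

lemma wedge_lc:
  assumes "homog k xs" "homog l ys"
  shows "wedge k l (lc xs) (lc ys) = lc (lc_wedge xs ys)"
proof (rule ext)
  fix vs
  have 1: "wedge k l (eform is) (lc ys) vs = lc (map (\<lambda>(d, js). (d, is @ js)) ys) vs"
    if "length is = k" for "is" using assms(2)
  proof (induction ys)
    case Nil
    then show ?case by (simp add: lc_def wedge_0)
  next
    case (Cons y ys)
    obtain d js where y: "y = (d, js)" by (cases y)
    have "lc (y # ys) = (\<lambda>vs. d * eform js vs + lc ys vs)" by (rule ext) (simp add: y lc_Cons)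
    then show ?case using Cons y that by (simp add: wedge_add_right wedge_eform lc_Cons)
  qed
  have 2: "lc (map (\<lambda>(d, js). (c * d, is @ js)) ys) vs = c * lc (map (\<lambda>(d, js). (d, is @ js)) ys) vs" for c "is"
    by (induction ys) (auto simp: lc_Cons algebra_simps)
  show "wedge k l (lc xs) (lc ys) vs = lc (lc_wedge xs ys) vs" using assms(1)
  proof (induction xs)
    case Nil
    then show ?case by (simp add: lc_def wedge_0 lc_wedge_simps)
  next
    case (Cons x xs)
    obtain c "is" where x: "x = (c, is)" by (cases x)
    have "lc (x # xs) = (\<lambda>vs. c * eform is vs + lc xs vs)" by (rule ext) (simp add: x lc_Cons)
    then show ?case using Cons x by (simp add: wedge_add_left 1 2 lc_append lc_wedge_simps)
  qed
qed

lemma pullback_wedge: "pullback L (wedge k l \<alpha> \<beta>) = wedge k l (pullback L \<alpha>) (pullback L \<beta>)"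
proof (rule ext)
  fix vs
  have nth: "map L vs ! p a = L (vs ! p a)"
    if "length vs = k + l" "p permutes {..<k + l}" "a < k + l" for p a
    using that permutes_in_image[of p "{..<k + l}" a] by simp
  have eq: "map (\<lambda>a. map L vs ! p a) [0..<k] = map L (map (\<lambda>a. vs ! p a) [0..<k])"
    "map (\<lambda>a. map L vs ! p a) [k..<k + l] = map L (map (\<lambda>a. vs ! p a) [k..<k + l])"
    if "length vs = k + l" "p permutes {..<k + l}" for p
    by (simp_all add: nth[OF that])
  show "pullback L (wedge k l \<alpha> \<beta>) vs = wedge k l (pullback L \<alpha>) (pullback L \<beta>) vs"
  proof (cases "length vs = k + l")
    case True
    then show ?thesis
      unfolding pullback_def wedge_def using eq[OF True] by (auto intro!: sum.cong simp del: map_map)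
  qed (simp add: pullback_def wedge_def)
qed

text \<open>The first component is the sign of the moves made; it is 0 when the label is repeated,
  and then the returned list is only a placeholder.\<close>

fun sort_insert :: "nat \<Rightarrow> nat list \<Rightarrow> real \<times> nat list" where
  "sort_insert a [] = (1, [a])"
| "sort_insert a (b # bs) = (if a < b then (1, a # b # bs) else if a = b then (0, [])
     else case sort_insert a bs of (s, cs) \<Rightarrow> (- s, b # cs))"

fun sign_sort :: "nat list \<Rightarrow> real \<times> nat list" where
  "sign_sort [] = (1, [])"
| "sign_sort (a # as) = (case sign_sort as of (s, bs) \<Rightarrow> case sort_insert a bs of (t, cs) \<Rightarrow> (s * t, cs))"

fun lc_insert :: "real \<Rightarrow> nat list \<Rightarrow> (real \<times> nat list) list \<Rightarrow> (real \<times> nat list) list" where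
  "lc_insert c is [] = [(c, is)]"
| "lc_insert c is ((d, js) # xs) = (if is = js then (c + d, js) # xs else (d, js) # lc_insert c is xs)"

fun lc_normal :: "(real \<times> nat list) list \<Rightarrow> (real \<times> nat list) list" where
  "lc_normal [] = []"
| "lc_normal ((c, is) # xs) = (case sign_sort is of (s, js) \<Rightarrow>
     if s = 0 then lc_normal xs else lc_insert (s * c) js (lc_normal xs))"

lemma eform_sort_insert:
  "sort_insert a bs = (s, cs) \<Longrightarrow> eform (xs @ a # bs) vs = s * eform (xs @ cs) vs"
proof (induction bs arbitrary: xs s cs)
  case (Cons b bs)
  show ?case
  proof (cases "b < a")
    case True
    obtain t ds where t: "sort_insert a bs = (t, ds)" by fastforce
    have "eform (xs @ a # b # bs) vs = - eform ((xs @ [b]) @ a # bs) vs"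
      using eform_swap[of xs a b bs vs] by simp
    then show ?thesis using Cons.IH[OF t, of "xs @ [b]"] Cons.prems t True by auto
  next
    case False
    then show ?thesis using Cons.prems by (auto simp: eform_repeat split: if_splits)
  qed
qed auto

lemma eform_sign_sort: "sign_sort is = (s, js) \<Longrightarrow> eform (xs @ is) vs = s * eform (xs @ js) vs"
proof (induction "is" arbitrary: xs s js)
  case (Cons a as)
  obtain t bs where t: "sign_sort as = (t, bs)" by fastforce
  obtain u cs where u: "sort_insert a bs = (u, cs)" by fastforce
  show ?case using Cons.IH[OF t, of "xs @ [a]"] eform_sort_insert[OF u, of xs vs] Cons.prems t u by auto
qed auto

lemma lc_insert: "lc (lc_insert c is xs) vs = c * eform is vs + lc xs vs"
  by (induction c "is" xs rule: lc_insert.induct) (auto simp: lc_Cons algebra_simps)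

lemma lc_normal: "lc (lc_normal xs) vs = lc xs vs"
proof (induction xs rule: lc_normal.induct)
  case (2 c "is" xs)
  obtain s js where s: "sign_sort is = (s, js)" by fastforce
  show ?case using eform_sign_sort[OF s, of "[]" vs] 2 s by (auto simp: lc_Cons lc_insert)
qed auto

lemma lc_eqI:
  assumes "\<forall>(c, is)\<in>set (lc_normal (xs @ map (\<lambda>(c, is). (- c, is)) ys)). c = 0"
  shows "lc xs = lc ys"
proof
  fix vs
  have "lc zs vs = 0" if "\<forall>(c, is)\<in>set zs. c = 0" for zs
    using that by (induction zs) (auto simp: lc_Cons)
  then have "lc (xs @ map (\<lambda>(c, is). (- c, is)) ys) vs = 0"
    using assms lc_normal by metis
  moreover have "lc (map (\<lambda>(c, is). (- c, is)) ys) vs = - lc ys vs"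
    by (induction ys) (auto simp: lc_Cons)
  ultimately show "lc xs vs = lc ys vs" by (simp add: lc_append)
qed

section \<open>The model 3-form and its contractions\<close>

lemma forall_7: "(\<forall>i::7. P i) \<longleftrightarrow> P 1 \<and> P 2 \<and> P 3 \<and> P 4 \<and> P 5 \<and> P 6 \<and> P 7"
proof -
  have "i \<in> {1, 2, 3, 4, 5, 6, 7}" for i :: 7
  proof -
    obtain z where z: "i = of_int z" "0 \<le> z" "z < int CARD(7)" by (cases i) auto
    then have "z \<in> {0, 1, 2, 3, 4, 5, 6}" by auto
    then show ?thesis using z by auto
  qed
  then show ?thesis by (metis empty_iff insert_iff)
qed

lemma sum_7: "sum f (UNIV :: 7 set) = f 1 + f 2 + f 3 + f 4 + f 5 + f 6 + f 7"
  for f :: "7 \<Rightarrow> 'a::comm_monoid_add"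
proof -
  have eq: "UNIV = {1, 2, 3, 4, 5, 6, 7 :: 7}"
    using forall_7[of "\<lambda>i. i \<in> {1, 2, 3, 4, 5, 6, 7}"] by auto
  show ?thesis unfolding eq by (simp add: add.assoc)
qed

lemma inner_7: "u \<bullet> v = u$1 * v$1 + u$2 * v$2 + u$3 * v$3 + u$4 * v$4 + u$5 * v$5 + u$6 * v$6 + u$7 * v$7"
  for u v :: vec7
  by (simp add: inner_vec_def sum_7)

lemma phi0_lc: "phi0 = lc [(1,[1,2,3]), (1,[1,4,5]), (1,[1,6,7]), (1,[2,4,6]), (-1,[2,5,7]), (-1,[3,4,7]), (-1,[3,5,6])]"
  by (rule ext) (simp add: phi0_def lc_Cons eform_def)

lemma sum_lessThan_numeral:
  fixes f :: "nat \<Rightarrow> real"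
  shows "sum f {..<numeral k} = sum f {..<pred_numeral k} + f (pred_numeral k)"
    "sum f {..<Suc n} = sum f {..<n} + f n"
  by (simp_all add: lessThan_nat_numeral)

lemma eform_column3:
  "eform [a,b,c] (v # vs) = v$of_nat a * eform [b,c] vs - v$of_nat b * eform [a,c] vs + v$of_nat c * eform [a,b] vs"
proof (cases "length vs = 2")
  case True
  then show ?thesis by (subst eform_column) (simp_all add: sum_lessThan_numeral)
qed (simp add: eform_eq_0)

text \<open>This is the interior product of \<open>v\<close> with the model 3-form.\<close>

definition iphi :: "vec7 \<Rightarrow> (real \<times> nat list) list" where
  "iphi v = [(v$1,[2,3]), (-v$2,[1,3]), (v$3,[1,2]), (v$1,[4,5]), (-v$4,[1,5]), (v$5,[1,4]),
    (v$1,[6,7]), (-v$6,[1,7]), (v$7,[1,6]), (v$2,[4,6]), (-v$4,[2,6]), (v$6,[2,4]),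
    (-v$2,[5,7]), (v$5,[2,7]), (-v$7,[2,5]), (-v$3,[4,7]), (v$4,[3,7]), (-v$7,[3,4]),
    (-v$3,[5,6]), (v$5,[3,6]), (-v$6,[3,5])]"

lemma phi0_Cons: "phi0 (v # vs) = lc (iphi v) vs"
  unfolding phi0_lc iphi_def by (simp add: lc_Cons eform_column3 algebra_simps)

text \<open>Contractions of the 3-form are eigenvectors, with eigenvalue 2, of the map taking a
  2-form to the star of its product with \<open>phi0\<close>; the right-hand side is twice the star
  of the contraction. Collecting its 21 terms first keeps the triple product in Bryant's formula
  small.\<close>

lemma wedge_iphi_phi0:
  "wedge 2 3 (lc (iphi v)) phi0 = lc [
      (2 * v$1, [1,2,3,4,5]), (2 * v$2, [1,2,3,4,6]), (-2 * v$3, [1,2,3,4,7]),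
      (-2 * v$3, [1,2,3,5,6]), (-2 * v$2, [1,2,3,5,7]), (2 * v$1, [1,2,3,6,7]),
      (-2 * v$4, [1,2,4,5,6]), (2 * v$5, [1,2,4,5,7]), (2 * v$6, [1,2,4,6,7]),
      (-2 * v$7, [1,2,5,6,7]), (2 * v$5, [1,3,4,5,6]), (2 * v$4, [1,3,4,5,7]),
      (-2 * v$7, [1,3,4,6,7]), (-2 * v$6, [1,3,5,6,7]), (2 * v$1, [1,4,5,6,7]),
      (2 * v$6, [2,3,4,5,6]), (2 * v$7, [2,3,4,5,7]), (2 * v$4, [2,3,4,6,7]),
      (2 * v$5, [2,3,5,6,7]), (2 * v$2, [2,4,5,6,7]), (2 * v$3, [3,4,5,6,7])]"
  unfolding phi0_lc iphi_def
  by (subst wedge_lc, simp, simp, rule lc_eqI) (simp add: lc_wedge_simps)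

lemma eform_column7:
  "eform [a,b,c,d,e,f,g] (v # vs) = v$of_nat a * eform [b,c,d,e,f,g] vs - v$of_nat b * eform [a,c,d,e,f,g] vs
    + v$of_nat c * eform [a,b,d,e,f,g] vs - v$of_nat d * eform [a,b,c,e,f,g] vs + v$of_nat e * eform [a,b,c,d,f,g] vs
    - v$of_nat f * eform [a,b,c,d,e,g] vs + v$of_nat g * eform [a,b,c,d,e,f] vs"
proof (cases "length vs = 6")
  case True
  then show ?thesis by (subst eform_column) (simp_all add: sum_lessThan_numeral)
qed (simp add: eform_eq_0)

lemma eform_column6:
  "eform [a,b,c,d,e,f] (v # vs) = v$of_nat a * eform [b,c,d,e,f] vs - v$of_nat b * eform [a,c,d,e,f] vs
    + v$of_nat c * eform [a,b,d,e,f] vs - v$of_nat d * eform [a,b,c,e,f] vs + v$of_nat e * eform [a,b,c,d,f] vs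
    - v$of_nat f * eform [a,b,c,d,e] vs"
proof (cases "length vs = 5")
  case True
  then show ?thesis by (subst eform_column) (simp_all add: sum_lessThan_numeral)
qed (simp add: eform_eq_0)

lemma eform_column5:
  "eform [a,b,c,d,e] (v # vs) = v$of_nat a * eform [b,c,d,e] vs - v$of_nat b * eform [a,c,d,e] vs
    + v$of_nat c * eform [a,b,d,e] vs - v$of_nat d * eform [a,b,c,e] vs + v$of_nat e * eform [a,b,c,d] vs"
proof (cases "length vs = 4")
  case True
  then show ?thesis by (subst eform_column) (simp_all add: sum_lessThan_numeral)
qed (simp add: eform_eq_0)

lemma eform_column4:
  "eform [a,b,c,d] (v # vs) = v$of_nat a * eform [b,c,d] vs - v$of_nat b * eform [a,c,d] vs
    + v$of_nat c * eform [a,b,d] vs - v$of_nat d * eform [a,b,c] vs"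
proof (cases "length vs = 3")
  case True
  then show ?thesis by (subst eform_column) (simp_all add: sum_lessThan_numeral)
qed (simp add: eform_eq_0)

lemma eform_column2:
  "eform [a,b] (v # vs) = v$of_nat a * eform [b] vs - v$of_nat b * eform [a] vs"
proof (cases "length vs = 1")
  case True
  then show ?thesis by (subst eform_column) (simp_all add: sum_lessThan_numeral)
qed (simp add: eform_eq_0)

lemma eform_column1: "eform [a] (v # vs) = v$of_nat a * eform [] vs"
proof (cases "vs = []")
  case True
  then show ?thesis by (subst eform_column) (simp_all add: sum_lessThan_numeral)
qed (simp add: eform_eq_0)

lemmas eform_columns = eform_column1 eform_column2 eform_column3 eform_column4 eform_column5
  eform_column6 eform_column7

section \<open>Multilinear functions and change of orthonormal frame\<close>

lemma basis_form_linear: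
  assumes "length vs = length is" "i < length is"
  shows "linear (\<lambda>v. basis_form is (vs[i := v]))"
proof -
  let ?n = "length is"
  have "\<exists>c a. \<forall>v. (\<Prod>b<?n. vs[i := v] ! p b $ is ! b) = v $ a * c" if p: "p permutes {..<?n}" for p
  proof -
    obtain b0 where b0: "b0 < ?n" "p b0 = i"
      using p assms(2) by (metis lessThan_iff permutes_def permutes_in_image)
    have "(\<Prod>b<?n. vs[i := v] ! p b $ is ! b) = v $ (is ! b0) * (\<Prod>b\<in>{..<?n} - {b0}. vs ! p b $ is ! b)" for v
    proof -
      have "(\<Prod>b<?n. vs[i := v] ! p b $ is ! b) =
          vs[i := v] ! p b0 $ is ! b0 * (\<Prod>b\<in>{..<?n} - {b0}. vs[i := v] ! p b $ is ! b)"
        using b0 by (intro prod.remove) auto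
      moreover have "i \<noteq> p b" if "b \<noteq> b0" for b
        using that b0 p by (metis permutes_def)
      then have "(\<Prod>b\<in>{..<?n} - {b0}. vs[i := v] ! p b $ is ! b) = (\<Prod>b\<in>{..<?n} - {b0}. vs ! p b $ is ! b)"
        by (intro prod.cong) auto
      ultimately show ?thesis using b0 assms by simp
    qed
    then show ?thesis by blast
  qed
  then obtain c a where ca: "(\<Prod>b<?n. vs[i := v] ! p b $ is ! b) = v $ a p * c p" if "p permutes {..<?n}" for p v
    by metis
  have "basis_form is (vs[i := v]) = (\<Sum>p | p permutes {..<?n}. of_int (sign p) * (v $ a p * c p))" for v
    using assms ca by (auto simp: basis_form_def intro!: sum.cong)
  then show ?thesis
    by (auto intro!: linearI simp: algebra_simps sum.distrib sum_distrib_left)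
qed

text \<open>Unlike \<open>alternating_form\<close>, this condition survives fixing the first
  argument or appending further arguments, which the frame-change argument requires.\<close>

definition multilinear :: "nat \<Rightarrow> covector \<Rightarrow> bool" where
  "multilinear k \<alpha> \<longleftrightarrow> (\<forall>vs i. length vs = k \<and> i < k \<longrightarrow> linear (\<lambda>v. \<alpha> (vs[i := v])))"

lemma multilinear_Cons:
  assumes "multilinear (Suc k) \<alpha>"
  shows "length vs = k \<Longrightarrow> linear (\<lambda>v. \<alpha> (v # vs))" "multilinear k (\<lambda>vs. \<alpha> (v # vs))"
proof -
  show "linear (\<lambda>v. \<alpha> (v # vs))" if "length vs = k"
    using assms[unfolded multilinear_def, rule_format, of "0 # vs" 0] that by simp
  show "multilinear k (\<lambda>vs. \<alpha> (v # vs))"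
    unfolding multilinear_def
  proof (intro allI impI)
    fix vs :: "vec7 list" and i assume "length vs = k \<and> i < k"
    then have "linear (\<lambda>w. \<alpha> ((v # vs)[Suc i := w]))"
      using assms[unfolded multilinear_def, rule_format, of "v # vs" "Suc i"] by simp
    then show "linear (\<lambda>w. \<alpha> (v # vs[i := w]))" by simp
  qed
qed

lemma length_Suc_image: "{is :: 'a list. length is = Suc k} = (\<lambda>(i, is). i # is) ` (UNIV \<times> {is. length is = k})"
  by (auto simp: length_Suc_conv image_iff)

lemma sum_length_Suc:
  "(\<Sum>is :: 7 list | length is = Suc k. f is) = (\<Sum>i\<in>UNIV. \<Sum>is | length is = k. f (i # is))"
  unfolding length_Suc_image sum.cartesian_product
  by (subst sum.reindex) (auto simp: inj_on_def case_prod_beta)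

text \<open>Writing the representing vectors as \<open>L \<alpha>\<close> and
  \<open>L \<beta>\<close> turns values on the rotated frame into coordinates of \<alpha> and
  \<beta>; both sides are then the inner product of the two representing vectors.\<close>

lemma sum_orthonormal_frame:
  fixes L :: "vec7 \<Rightarrow> vec7" and a b :: "vec7 \<Rightarrow> real"
  assumes L: "orthogonal_transformation L" and "linear a" "linear b"
  shows "(\<Sum>i\<in>UNIV. a (L (axis i 1)) * b (L (axis i 1))) = (\<Sum>i\<in>UNIV. a (axis i 1) * b (axis i 1))"
proof -
  have rep: "\<exists>\<alpha>. \<forall>v. f v = v \<bullet> L \<alpha>" if "linear f" for f :: "vec7 \<Rightarrow> real"
  proof -
    have f: "f v = v \<bullet> adjoint f 1" for v using adjoint_works[OF that, of v 1] by simp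
    have "surj L" by (rule orthogonal_transformation_surj[OF L])
    then obtain \<alpha> where \<alpha>: "adjoint f 1 = L \<alpha>" by (rule surjE)
    show ?thesis using f unfolding \<alpha> by blast
  qed
  obtain \<alpha> \<beta> where ab: "a v = v \<bullet> L \<alpha>" "b v = v \<bullet> L \<beta>" for v
    using rep[OF assms(2)] rep[OF assms(3)] by metis
  have "(\<Sum>i\<in>UNIV. a (L (axis i 1)) * b (L (axis i 1))) = (\<Sum>i\<in>UNIV. \<alpha> $ i * \<beta> $ i)"
    using L unfolding ab orthogonal_transformation_def by (simp add: inner_axis')
  also have "\<dots> = L \<alpha> \<bullet> L \<beta>"
    using L unfolding orthogonal_transformation_def by (simp add: inner_vec_def)
  also have "\<dots> = (\<Sum>i\<in>UNIV. a (axis i 1) * b (axis i 1))"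
    unfolding ab by (simp add: inner_axis') (simp add: inner_vec_def)
  finally show ?thesis .
qed

abbreviation ax :: "7 \<Rightarrow> vec7" where "ax i \<equiv> axis i 1"

text \<open>One slot is exchanged at a time: the induction hypothesis handles the remaining slots
  with the first vector frozen, then the single-slot case handles the first.\<close>

lemma sum_orthonormal_frames:
  assumes L: "orthogonal_transformation L"
  shows "multilinear k \<alpha> \<Longrightarrow> multilinear k \<beta> \<Longrightarrow>
    (\<Sum>is | length is = k. \<alpha> (map (\<lambda>i. L (ax i)) is) * \<beta> (map (\<lambda>i. L (ax i)) is)) =
    (\<Sum>is | length is = k. \<alpha> (map ax is) * \<beta> (map ax is))"
proof (induction k arbitrary: \<alpha> \<beta>)
  case (Suc k)
  let ?S = "{is :: 7 list. length is = k}"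
  have "(\<Sum>is | length is = Suc k. \<alpha> (map (\<lambda>i. L (ax i)) is) * \<beta> (map (\<lambda>i. L (ax i)) is)) =
    (\<Sum>i\<in>UNIV. \<Sum>is\<in>?S. \<alpha> (L (ax i) # map ax is) * \<beta> (L (ax i) # map ax is))"
    unfolding sum_length_Suc list.map
    by (intro sum.cong refl Suc.IH multilinear_Cons(2) Suc.prems)
  also have "\<dots> = (\<Sum>is\<in>?S. \<Sum>i\<in>UNIV. \<alpha> (L (ax i) # map ax is) * \<beta> (L (ax i) # map ax is))"
    by (rule sum.swap)
  also have "\<dots> = (\<Sum>is\<in>?S. \<Sum>i\<in>UNIV. \<alpha> (ax i # map ax is) * \<beta> (ax i # map ax is))"
    by (intro sum.cong refl sum_orthonormal_frame[OF L] multilinear_Cons(1)[OF Suc.prems(1)]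
        multilinear_Cons(1)[OF Suc.prems(2)]) auto
  also have "\<dots> = (\<Sum>is | length is = Suc k. \<alpha> (map ax is) * \<beta> (map ax is))"
    unfolding sum_length_Suc list.map by (rule sum.swap)
  finally show ?case .
qed simp

text \<open>These congruence rules keep the simplifier out of the coefficients and out of the unprocessed
  tail of the list, which it would otherwise traverse again at each of the several hundred steps.\<close>

lemma pair_cong: "(a, b) = (a, b)" ..

lemma lc_normal_cong: "lc_normal xs = lc_normal xs" ..

lemmas lc_list_simps = lc_wedge_simps list.map prod.case append.simps

text \<open>Bryant's formula: \<open>6 \<langle>v,v\<rangle> vol = \<iota>\<^sub>v\<phi> \<and> \<iota>\<^sub>v\<phi> \<and> \<phi>\<close>; it shows that \<open>\<phi>\<close>
  determines the metric and the orientation.\<close>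

lemma wedge_iphi_iphi_phi0:
  "wedge 2 5 (lc (iphi v)) (wedge 2 3 (lc (iphi v)) phi0) = lc [(6 * (v \<bullet> v), [1,2,3,4,5,6,7])]"
  unfolding wedge_iphi_phi0 unfolding iphi_def
  apply (subst wedge_lc, simp, simp)
  apply (rule lc_eqI)
  apply (simp only: lc_list_simps)
  apply (simp cong: pair_cong lc_normal_cong)
  apply (simp add: inner_7)
  done

abbreviation eform7 :: covector where "eform7 \<equiv> eform [1,2,3,4,5,6,7]"

abbreviation frame7 :: "vec7 list" where "frame7 \<equiv> [ax 1, ax 2, ax 3, ax 4, ax 5, ax 6, ax 7]"

lemma axis_nth: "axis i x $ j = (if j = i then x else 0)"
  by (simp add: axis_def)

lemma eform7_frame7: "eform7 frame7 = 1"
  by (simp add: eform_columns axis_nth eform_Nil)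

lemma less_7: "(i::nat) < 7 \<Longrightarrow> i = 0 \<or> i = 1 \<or> i = 2 \<or> i = 3 \<or> i = 4 \<or> i = 5 \<or> i = 6"
  by auto

text \<open>By Bryant's formula, invariance of \<open>phi0\<close> gives |v|^2 vol = |Lv|^2 L^*vol.
  So D = det L is positive and L scales inner products by 1/D. The determinant of the Gram matrix is
  then both D^2 and D^-7, whence D^9 = 1 and D = 1.\<close>

lemma stabilizer_phi0:
  assumes L: "linear L" and phi: "pullback L phi0 = phi0"
  shows "orthogonal_transformation L" "pullback L eform7 = eform7"
proof -
  define D where "D = eform7 (map L frame7)"
  have iphi: "pullback L (lc (iphi (L v))) = lc (iphi v)" for v
  proof
    fix ws
    show "pullback L (lc (iphi (L v))) ws = lc (iphi v) ws"
      using fun_cong[OF phi, of "v # ws"] by (simp add: pullback_def phi0_Cons)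
  qed
  have eq: "(v \<bullet> v) * eform7 vs = (L v \<bullet> L v) * eform7 (map L vs)" for v vs
  proof -
    have "wedge 2 5 (lc (iphi v)) (wedge 2 3 (lc (iphi v)) phi0) =
        pullback L (wedge 2 5 (lc (iphi (L v))) (wedge 2 3 (lc (iphi (L v))) phi0))"
      unfolding pullback_wedge iphi phi ..
    from fun_cong[OF this, of vs] show ?thesis
      unfolding wedge_iphi_iphi_phi0 by (simp add: pullback_def lc_Cons)
  qed
  have norm: "v \<bullet> v = (L v \<bullet> L v) * D" for v
    using eq[of v frame7] unfolding eform7_frame7 D_def by simp
  have D_pos: "D > 0"
    using norm[of "ax 1"] zero_less_mult_iff[of "L (ax 1) \<bullet> L (ax 1)" D] inner_ge_zero[of "L (ax 1)"]
    by (auto simp: inner_axis_axis)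
  have inner: "(L u \<bullet> L v) * D = u \<bullet> v" for u v
    using norm[of "u + v"] norm[of u] norm[of v]
    by (simp add: linear_add[OF L] inner_add_left inner_add_right inner_commute algebra_simps)
  let ?is = "[1,2,3,4,5,6,7 :: 7]"
  define N where "N = Matrix.mat 7 7 (\<lambda>(b, a). map L frame7 ! a $ ?is ! b)"
  have N: "N \<in> carrier_mat 7 7" by (simp add: N_def)
  have detN: "Determinant.det N = D"
    unfolding D_def eform_def N_def by (subst basis_form_conv_det) (simp_all add: eval_nat_numeral)
  have "N\<^sup>T * N = (1 / D) \<cdot>\<^sub>m 1\<^sub>m 7"
  proof (rule eq_matI)
    fix i j assume "i < dim_row ((1 / D) \<cdot>\<^sub>m 1\<^sub>m 7 :: real mat)" "j < dim_col ((1 / D) \<cdot>\<^sub>m 1\<^sub>m 7 :: real mat)"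
    then have ij: "i < 7" "j < 7" by auto
    have "(N\<^sup>T * N) $$ (i, j) = (\<Sum>b<7. map L frame7 ! i $ ?is ! b * map L frame7 ! j $ ?is ! b)"
      using ij by (simp add: N_def Matrix.scalar_prod_def lessThan_atLeast0)
    also have "\<dots> = map L frame7 ! i \<bullet> map L frame7 ! j"
      by (simp add: sum_lessThan_numeral inner_7)
    also have "\<dots> = L (frame7 ! i) \<bullet> L (frame7 ! j)"
      by (subst (1 2) nth_map) (use ij in simp_all)
    also have "\<dots> = frame7 ! i \<bullet> frame7 ! j / D"
      using inner[of "frame7 ! i" "frame7 ! j"] D_pos by (simp add: field_simps)
    also have "\<dots> = ((1 / D) \<cdot>\<^sub>m 1\<^sub>m 7) $$ (i, j)"
      using less_7[OF ij(1)] less_7[OF ij(2)] by (elim disjE) (simp_all add: inner_axis_axis)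
    finally show "(N\<^sup>T * N) $$ (i, j) = ((1 / D) \<cdot>\<^sub>m 1\<^sub>m 7) $$ (i, j)" .
  qed (auto simp: N_def)
  then have "Determinant.det (N\<^sup>T * N) = (1 / D) ^ 7" by simp
  moreover have "Determinant.det (N\<^sup>T * N) = D * D"
    using N by (subst Determinant.det_mult[of _ 7]) (simp_all add: Determinant.det_transpose detN)
  ultimately have "D ^ 9 = 1"
    using D_pos by (simp add: field_simps power_divide eval_nat_numeral)
  then have D: "D = 1" using D_pos power_eq_iff_eq_base[of 9 D 1] by simp
  show "orthogonal_transformation L"
    unfolding orthogonal_transformation_def using L inner D by simp
  show "pullback L eform7 = eform7"
  proof
    fix vs
    show "pullback L eform7 vs = eform7 vs"
      using eq[of "ax 1" vs] norm[of "ax 1"] D by (simp add: pullback_def inner_axis_axis)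
  qed
qed

text \<open>\<^const>\<open>coframe\<close> is a choice; since two adapted coframes differ by an element of the stabilizer of
  \<^const>\<open>phi0\<close>, everything defined from it can be computed from any adapted coframe \<open>A\<close>.\<close>

locale adapted =
  fixes \<phi> A
  assumes adapted: "adapted_coframe \<phi> A"
begin

lemma linear_A: "linear A" and bij_A: "bij A" and phi: "\<phi> = pullback A phi0"
  using adapted by (auto simp: adapted_coframe_def)

definition "change = A \<circ> inv_into UNIV (coframe \<phi>)"

lemma coframe: "linear (coframe \<phi>)" "bij (coframe \<phi>)" "\<phi> = pullback (coframe \<phi>) phi0"
  using someI[of "adapted_coframe \<phi>", OF adapted] unfolding coframe_def adapted_coframe_def by auto

lemma linear_change: "linear change"
  unfolding change_def
  by (intro linear_compose linear_A inj_linear_imp_inv_linear coframe bij_is_inj)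

lemma change_coframe: "change (coframe \<phi> v) = A v"
  using coframe(2) by (simp add: change_def bij_is_inj)

lemma change_dual_frame: "A (dual_frame \<phi> i) = change (ax i)"
  by (simp add: dual_frame_def change_def)

lemma pullback_change: "pullback change phi0 = phi0"
proof
  fix vs
  let ?ws = "map (inv_into UNIV (coframe \<phi>)) vs"
  have vs: "map (coframe \<phi>) ?ws = vs"
    using coframe(2) by (simp add: bij_is_surj surj_f_inv_f o_def)
  have "pullback change phi0 vs = pullback A phi0 ?ws" by (simp add: pullback_def change_def)
  also have "\<dots> = pullback (coframe \<phi>) phi0 ?ws" using phi coframe(3) by simp
  also have "\<dots> = phi0 vs" unfolding pullback_def vs ..
  finally show "pullback change phi0 vs = phi0 vs" .
qed

lemmas orthogonal_change = stabilizer_phi0(1)[OF linear_change pullback_change]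
  and eform7_change = stabilizer_phi0(2)[OF linear_change pullback_change]

lemma metric: "metric \<phi> u v = A u \<bullet> A v"
  using orthogonal_change unfolding metric_def orthogonal_transformation_def
  by (metis change_coframe)

lemma norm_sq:
  assumes "multilinear k \<beta>"
  shows "norm_sq k \<phi> (pullback A \<beta>) = (\<Sum>is | length is = k. (\<beta> (map ax is))\<^sup>2) / fact k"
  unfolding norm_sq_def pullback_def power2_eq_square
  using sum_orthonormal_frames[OF orthogonal_change assms assms]
  by (simp add: o_def change_dual_frame)

lemma hodge_star:
  assumes "multilinear k \<beta>"
  shows "hodge_star k \<phi> (pullback A \<beta>) ws =
    (\<Sum>is | length is = k. \<beta> (map ax is) * eform7 (map ax is @ map A ws)) / fact k"
proof -
  have vol: "volume_form \<phi> (map (dual_frame \<phi>) is @ ws) =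
      eform7 (map (\<lambda>i. change (ax i)) is @ map A ws)" for "is"
  proof -
    have "volume_form \<phi> (map (dual_frame \<phi>) is @ ws) = eform7 (map (coframe \<phi>) (map (dual_frame \<phi>) is @ ws))"
      by (simp add: volume_form_def pullback_def eform_def)
    also have "\<dots> = eform7 (map change (map (coframe \<phi>) (map (dual_frame \<phi>) is @ ws)))"
      using fun_cong[OF eform7_change, of "map (coframe \<phi>) (map (dual_frame \<phi>) is @ ws)"]
      by (simp only: pullback_def)
    also have "map change (map (coframe \<phi>) (map (dual_frame \<phi>) is @ ws)) =
        map (\<lambda>i. change (ax i)) is @ map A ws"
      by (simp add: change_coframe change_dual_frame o_def)
    finally show ?thesis .
  qed
  have "multilinear k (\<lambda>us. eform7 (us @ map A ws))"
    unfolding multilinear_def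
  proof (intro allI impI)
    fix vs :: "vec7 list" and i assume i: "length vs = k \<and> i < k"
    have *: "vs[i := v] @ map A ws = (vs @ map A ws)[i := v]" for v
      using i by (simp add: list_update_append)
    show "linear (\<lambda>v. eform7 (vs[i := v] @ map A ws))"
    proof (cases "k + length ws = 7")
      case True
      then show ?thesis unfolding * eform_def by (intro basis_form_linear) (use i in auto)
    next
      case False
      then have "eform7 (vs[i := v] @ map A ws) = 0" for v
        using i by (intro eform_eq_0) auto
      then show ?thesis by (simp add: module_hom_zero linear_def)
    qed
  qed
  from sum_orthonormal_frames[OF orthogonal_change assms this] show ?thesis
    unfolding hodge_star_def vol by (simp add: pullback_def o_def change_dual_frame)
qed

end

section \<open>The Hodge star on coordinate forms\<close>

lemma eform_permute:
  assumes "q permutes {..<length vs}"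
  shows "eform is (map (\<lambda>b. vs ! q b) [0..<length vs]) = of_int (sign q) * eform is vs"
proof (cases "length vs = length is")
  case True
  let ?n = "length is" and ?is = "map of_nat is :: 7 list"
  have q: "q permutes {..<?n}" using assms True by simp
  have pq: "permutation q" using q by (meson finite_lessThan permutation_permutes)
  let ?f = "\<lambda>p. of_int (sign p) * (\<Prod>b<?n. vs ! p b $ ?is ! b)"
  have "eform is (map (\<lambda>b. vs ! q b) [0..<length vs]) =
      (\<Sum>p | p permutes {..<?n}. of_int (sign p) * (\<Prod>b<?n. vs ! q (p b) $ ?is ! b))"
    using True unfolding eform_def basis_form_def
    by (auto intro!: sum.cong prod.cong) (metis add_0 lessThan_iff nth_map_upt minus_nat.diff_0 permutes_in_image)
  also have "\<dots> = (\<Sum>p | p permutes {..<?n}. of_int (sign q) * ?f (q \<circ> p))"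
  proof (rule sum.cong[OF refl])
    fix p assume "p \<in> {p. p permutes {..<?n}}"
    then have "permutation p" by (metis finite_lessThan mem_Collect_eq permutation_permutes)
    then show "of_int (sign p) * (\<Prod>b<?n. vs ! q (p b) $ ?is ! b) = of_int (sign q) * ?f (q \<circ> p)"
      using pq by (simp add: sign_compose mult.assoc[symmetric] flip: of_int_mult)
  qed
  also have "\<dots> = of_int (sign q) * (\<Sum>p | p permutes {..<?n}. ?f (q \<circ> p))"
    by (simp only: sum_distrib_left)
  also have "\<dots> = of_int (sign q) * (\<Sum>p | p permutes {..<?n}. ?f p)"
    by (subst setum_permutations_compose_left[OF q]) simp
  also have "\<dots> = of_int (sign q) * eform is vs"
    using True by (simp add: eform_def basis_form_def)
  finally show ?thesis .
qed (simp add: eform_eq_0)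


abbreviation axn :: "nat \<Rightarrow> vec7" where "axn i \<equiv> ax (of_nat i)"

text \<open>The term of a permutation \<open>p\<close> in \<open>eform js\<close> is nonzero on a
  single index tuple \<open>J p\<close>, a rearrangement of \<open>js\<close>. There
  \<open>eform7\<close> produces the sign of \<open>p\<close> a second time, so all k! terms agree
  and cancel the factorial: the star amounts to inserting basis vectors into the volume
  form.\<close>

lemma sum_eform_frames:
  "(\<Sum>is | length is = length js. eform js (map ax is) * eform7 (map ax is @ ws)) / fact (length js) =
    eform7 (map axn js @ ws)"
proof -
  let ?k = "length js" and ?P = "{p. p permutes {..<length js}}"
  define J where "J p = map (\<lambda>a. of_nat (js ! inv_into UNIV p a) :: 7) [0..<?k]" for p
  have J: "(\<Prod>b<?k. map ax is ! p b $ map of_nat js ! b) = (if is = J p then 1 else 0)"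
    if len: "length is = ?k" and p: "p \<in> ?P" for p "is"
  proof -
    have p': "p permutes {..<?k}" using p by simp
    have lt: "p b < ?k" if "b < ?k" for b using that permutes_in_image[OF p', of b] by simp
    have lt': "inv_into UNIV p b < ?k" if "b < ?k" for b
      using that permutes_in_image[OF permutes_inv[OF p'], of b] by simp
    have "(\<Prod>b<?k. map ax is ! p b $ map of_nat js ! b) = (\<Prod>b<?k. if of_nat (js ! b) = is ! p b then 1 else 0)"
      using len lt by (intro prod.cong) (auto simp: axis_nth)
    also have "\<dots> = (if \<forall>b<?k. of_nat (js ! b) = is ! p b then 1 else 0)"
      by (auto simp: prod_zero_iff)
    also have "(\<forall>b<?k. of_nat (js ! b) = is ! p b) \<longleftrightarrow> is = J p"
    proof
      assume a: "\<forall>b<?k. of_nat (js ! b) = is ! p b"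
      show "is = J p"
      proof (rule nth_equalityI)
        fix a assume "a < length is"
        then show "is ! a = J p ! a"
          using a[rule_format, OF lt'[of a]] len permutes_inverses(1)[OF p'] by (simp add: J_def)
      qed (simp add: J_def len)
    next
      assume "is = J p"
      then show "\<forall>b<?k. of_nat (js ! b) = is ! p b"
        using lt permutes_inverses(2)[OF p'] by (simp add: J_def)
    qed
    finally show ?thesis .
  qed
  have perm: "eform7 (map ax (J p) @ ws) = of_int (sign p) * eform7 (map axn js @ ws)" if p: "p \<in> ?P" for p
  proof -
    have p': "p permutes {..<?k}" using p by simp
    let ?q = "inv_into UNIV p" and ?vs = "map axn js @ ws"
    have q: "?q permutes {..<?k}" by (rule permutes_inv[OF p'])
    then have q': "?q permutes {..<length ?vs}" by (rule permutes_subset) auto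
    have "map ax (J p) @ ws = map (\<lambda>b. ?vs ! ?q b) [0..<length ?vs]"
    proof (rule nth_equalityI)
      fix a assume a: "a < length (map ax (J p) @ ws)"
      show "(map ax (J p) @ ws) ! a = map (\<lambda>b. ?vs ! ?q b) [0..<length ?vs] ! a"
      proof (cases "a < ?k")
        case True
        then have "?q a < ?k" using permutes_in_image[OF q, of a] by simp
        then show ?thesis using True a by (simp add: J_def nth_append)
      next
        case False
        then have "?q a = a" using q by (simp add: permutes_def)
        then show ?thesis using False a by (simp add: J_def nth_append)
      qed
    qed (simp add: J_def)
    moreover have "sign ?q = sign p"
      using p' by (meson finite_lessThan permutation_permutes sign_inverse)
    ultimately show ?thesis using eform_permute[OF q', of "[1,2,3,4,5,6,7]"] by simp
  qed
  have fin: "finite {is :: 7 list. length is = ?k}"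
    using finite_lists_length_eq[of "UNIV :: 7 set" ?k] by simp
  have "(\<Sum>is | length is = ?k. eform js (map ax is) * eform7 (map ax is @ ws)) =
      (\<Sum>is | length is = ?k. \<Sum>p\<in>?P. of_int (sign p) * (if is = J p then eform7 (map ax is @ ws) else 0))"
  proof (rule sum.cong[OF refl])
    fix "is" :: "7 list" assume "is \<in> {is. length is = ?k}"
    then have len: "length is = ?k" by simp
    have "eform js (map ax is) = (\<Sum>p\<in>?P. of_int (sign p) * (\<Prod>b<?k. map ax is ! p b $ map of_nat js ! b))"
      by (simp add: eform_def basis_form_def len)
    also have "\<dots> = (\<Sum>p\<in>?P. of_int (sign p) * (if is = J p then 1 else 0))"
      by (rule sum.cong[OF refl], subst J[OF len], assumption, rule refl)
    finally show "eform js (map ax is) * eform7 (map ax is @ ws) =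
        (\<Sum>p\<in>?P. of_int (sign p) * (if is = J p then eform7 (map ax is @ ws) else 0))"
      by (simp only: sum_distrib_right) (rule sum.cong, auto)
  qed
  also have "\<dots> = (\<Sum>p\<in>?P. \<Sum>is | length is = ?k. of_int (sign p) * (if is = J p then eform7 (map ax is @ ws) else 0))"
    by (rule sum.swap)
  also have "\<dots> = (\<Sum>p\<in>?P. of_int (sign p) * eform7 (map ax (J p) @ ws))"
    by (intro sum.cong refl) (simp add: sum_distrib_left[symmetric] sum.delta[OF fin] J_def)
  also have "\<dots> = (\<Sum>p\<in>?P. eform7 (map axn js @ ws))"
    by (intro sum.cong refl, subst perm, assumption) (simp flip: mult.assoc of_int_mult)
  also have "\<dots> = fact ?k * eform7 (map axn js @ ws)"
    using card_permutations[of "{..<?k}" ?k] by simp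
  finally show ?thesis by simp
qed

lemma multilinear_lc: 
  assumes "homog k xs"
  shows "multilinear k (lc xs)"
  unfolding multilinear_def
proof (intro allI impI)
  fix vs :: "vec7 list" and i assume i: "length vs = k \<and> i < k"
  show "linear (\<lambda>v. lc xs (vs[i := v]))" using assms
  proof (induction xs)
    case Nil
    then show ?case by (simp add: module_hom_zero linear_def)
  next
    case (Cons x xs)
    obtain c "is" where x: "x = (c, is)" by (cases x)
    have "linear (\<lambda>v. eform is (vs[i := v]))"
      unfolding eform_def by (rule basis_form_linear) (use Cons.prems i x in auto)
    then have "linear (\<lambda>v. c *\<^sub>R eform is (vs[i := v]))"
      by (rule linear_compose_scale_right)
    then show ?case using Cons x by (auto simp: lc_Cons intro!: linear_compose_add)
  qed
qed

lemma sum_length_0: "(\<Sum>is | length is = 0. f is) = f []"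
proof -
  have "{is. length is = 0} = {[]}" by auto
  then show ?thesis by simp
qed

context adapted
begin

lemma hodge_star_lc:
  assumes "homog k xs"
  shows "hodge_star k \<phi> (pullback A (lc xs)) ws = (\<Sum>(c, is)\<leftarrow>xs. c * eform7 (map axn is @ map A ws))"
proof -
  have "(\<Sum>is | length is = k. lc xs (map ax is) * eform7 (map ax is @ map A ws)) / fact k =
      (\<Sum>(c, is)\<leftarrow>xs. c * eform7 (map axn is @ map A ws))" using assms
  proof (induction xs)
    case (Cons x xs)
    obtain c js where x: "x = (c, js)" by (cases x)
    have "(\<Sum>is | length is = k. lc (x # xs) (map ax is) * eform7 (map ax is @ map A ws)) / fact k =
       c * ((\<Sum>is | length is = length js. eform js (map ax is) * eform7 (map ax is @ map A ws)) / fact (length js))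
       + (\<Sum>is | length is = k. lc xs (map ax is) * eform7 (map ax is @ map A ws)) / fact k"
      using Cons.prems by (simp add: x lc_Cons distrib_right sum.distrib sum_distrib_left mult.assoc add_divide_distrib)
    then show ?case using Cons x unfolding sum_eform_frames by simp
  qed simp
  then show ?thesis using hodge_star[OF multilinear_lc[OF assms]] by simp
qed

end

text \<open>The Hodge dual 4-form of \<open>phi0\<close>.\<close>

definition psi0 :: covector where
  "psi0 = lc [(1,[4,5,6,7]), (1,[2,3,4,5]), (1,[2,3,6,7]), (-1,[1,3,4,6]), (1,[1,3,5,7]), (-1,[1,2,4,7]), (-1,[1,2,5,6])]"

text \<open>The torsion 3F in a coframe in which F = e^46 + e^57.\<close>

definition tau0 :: covector where "tau0 = lc [(3,[4,6]), (3,[5,7])]"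

context adapted
begin

lemma hodge_star_phi: "hodge_star 3 \<phi> \<phi> = pullback A psi0"
proof
  fix ws
  have "hodge_star 3 \<phi> \<phi> ws = hodge_star 3 \<phi> (pullback A phi0) ws" using phi by simp
  also have "\<dots> = pullback A psi0 ws"
    unfolding phi0_lc by (subst hodge_star_lc) (simp_all add: eform_columns axis_nth psi0_def pullback_def lc_Cons)
  finally show "hodge_star 3 \<phi> \<phi> ws = pullback A psi0 ws" .
qed

lemma norm_sq_tau: "norm_sq 2 \<phi> (pullback A tau0) = 18"
proof -
  have "norm_sq 2 \<phi> (pullback A tau0) = (\<Sum>is | length is = Suc (Suc 0). (tau0 (map ax is))\<^sup>2) / 2"
    using norm_sq[of 2 tau0] multilinear_lc[of 2 "[(3,[4,6]), (3,[5,7])]"]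
    by (simp add: tau0_def numeral_2_eq_2)
  also have "\<dots> = 18"
    unfolding sum_length_Suc sum_length_0 sum_7 tau0_def
    by (simp add: lc_Cons eform_columns axis_nth eform_Nil)
  finally show ?thesis .
qed

lemma hodge_star_tau_tau:
  "hodge_star 4 \<phi> (wedge 2 2 (pullback A tau0) (pullback A tau0)) = pullback A (lc [(-18,[1,2,3])])"
proof
  fix ws
  have "wedge 2 2 tau0 tau0 = lc (lc_wedge [(3,[4,6]), (3,[5,7])] [(3,[4,6]), (3,[5,7])])"
    unfolding tau0_def by (rule wedge_lc) simp_all
  also have "\<dots> = lc [(-18,[4,5,6,7])]"
    by (rule lc_eqI) (simp add: lc_wedge_simps)
  finally have "hodge_star 4 \<phi> (wedge 2 2 (pullback A tau0) (pullback A tau0)) ws =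
      hodge_star 4 \<phi> (pullback A (lc [(-18,[4,5,6,7])])) ws"
    by (simp flip: pullback_wedge)
  also have "\<dots> = pullback A (lc [(-18,[1,2,3])]) ws"
    by (subst hodge_star_lc) (simp_all add: eform_columns axis_nth pullback_def lc_Cons)
  finally show "hodge_star 4 \<phi> (wedge 2 2 (pullback A tau0) (pullback A tau0)) ws = pullback A (lc [(-18,[1,2,3])]) ws" .
qed

end

section \<open>Pullback of formal combinations by a linear map\<close>

type_synonym lcomb = "(real \<times> nat list) list"

definition lc_scale :: "real \<Rightarrow> lcomb \<Rightarrow> lcomb" where
  "lc_scale c xs = map (\<lambda>(d, is). (c * d, is)) xs"

lemma lc_scale: "lc (lc_scale c xs) vs = c * lc xs vs"
  by (induction xs) (auto simp: lc_scale_def lc_Cons algebra_simps)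

text \<open>\<open>R a\<close> stands for the pullback of the coordinate 1-form with label
  \<open>a\<close>; since pullback is multiplicative, this is the pullback of a monomial.\<close>

primrec row_wedge :: "(nat \<Rightarrow> lcomb) \<Rightarrow> nat list \<Rightarrow> lcomb" where
  "row_wedge R [] = [(1, [])]"
| "row_wedge R (a # as) = lc_wedge (R a) (row_wedge R as)"

primrec lc_pull :: "(nat \<Rightarrow> lcomb) \<Rightarrow> lcomb \<Rightarrow> lcomb" where
  "lc_pull R [] = []"
| "lc_pull R (x # xs) = lc_scale (fst x) (row_wedge R (snd x)) @ lc_pull R xs"

lemma homog_lc_wedge: "homog k xs \<Longrightarrow> homog l ys \<Longrightarrow> homog (k + l) (lc_wedge xs ys)"
  by (fastforce simp: homog_def lc_wedge_def)

lemma pullback_lc: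
  assumes R: "\<And>a. a \<in> {1..7} \<Longrightarrow> homog 1 (R a) \<and> pullback L (eform [a]) = lc (R a)"
    and xs: "\<forall>(c, is)\<in>set xs. set is \<subseteq> {1..7}"
  shows "pullback L (lc xs) = lc (lc_pull R xs)"
proof -
  have E: "homog (length is) (row_wedge R is) \<and> pullback L (eform is) = lc (row_wedge R is)"
    if "set is \<subseteq> {1..7}" for "is" using that
  proof (induction "is")
    case Nil
    have "pullback L (eform []) vs = lc [(1, [])] vs" for vs
      by (cases vs) (simp_all add: pullback_def lc_Cons eform_eq_0)
    then show ?case by auto
  next
    case (Cons a "is")
    have "pullback L (eform (a # is)) = pullback L (wedge 1 (length is) (eform [a]) (eform is))"
      by (subst wedge_eform) simp_all
    also have "\<dots> = wedge 1 (length is) (lc (R a)) (lc (row_wedge R is))"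
      unfolding pullback_wedge using Cons R[of a] by simp
    also have "\<dots> = lc (row_wedge R (a # is))"
      using Cons R[of a] by (subst wedge_lc) simp_all
    finally show ?case using Cons R[of a] homog_lc_wedge[of 1 "R a" "length is"] by simp
  qed
  show ?thesis
  proof
    fix vs
    show "pullback L (lc xs) vs = lc (lc_pull R xs) vs" using xs
    proof (induction xs)
      case (Cons x xs)
      then show ?case using fun_cong[OF conjunct2[OF E[of "snd x"]], of vs]
        by (cases x) (auto simp: pullback_def lc_Cons lc_append lc_scale)
    qed (simp add: pullback_def)
  qed
qed

section \<open>The explicit structure\<close>

text \<open>At the point with coordinates \<open>(t, p, q, y\<^sub>4, \<dots>, y\<^sub>7)\<close> the parameters are \<open>T = cosh t\<close>,
  \<open>S = sinh t\<close>, \<open>P, P' = e\<^bsup>\<plusminus>p\<^esup>\<close> and \<open>Q, Q' = e\<^bsup>\<plusminus>q\<^esup>\<close>. In the notation of the introduction,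
  \<open>tau_list\<close> is \<open>3F\<close>, \<open>phi_list\<close> is \<open>T\<^sup>2 e\<^bsup>123\<^esup> + dF\<close> and
  \<open>psi_list\<close> is \<open>2 e\<^bsup>4567\<^esup> + T\<^sup>2 e\<^bsup>23\<^esup> \<and> F\<^sub>t + e\<^bsup>31\<^esup> \<and> F\<^sub>p + e\<^bsup>12\<^esup> \<and> F\<^sub>q\<close>.\<close>

definition phi_list :: "real \<Rightarrow> real \<Rightarrow> real \<Rightarrow> real \<Rightarrow> real \<Rightarrow> real \<Rightarrow> lcomb" where
  "phi_list T S P P' Q Q' = [(T * T, [1,2,3]),
    (S * P * Q, [1,4,6]), (S * P' * Q', [1,5,7]), (S * P * Q', [1,4,7]), (- S * P' * Q, [1,5,6]),
    (T, [1,4,5]), (2 * T, [1,6,7]),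
    (T * P * Q, [2,4,6]), (- T * P' * Q', [2,5,7]), (T * P * Q', [2,4,7]), (T * P' * Q, [2,5,6]),
    (T * P * Q, [3,4,6]), (- T * P' * Q', [3,5,7]), (- T * P * Q', [3,4,7]), (- T * P' * Q, [3,5,6])]"

definition psi_list :: "real \<Rightarrow> real \<Rightarrow> real \<Rightarrow> real \<Rightarrow> real \<Rightarrow> real \<Rightarrow> lcomb" where
  "psi_list T S P P' Q Q' = [(2, [4,5,6,7]),
    (T * T * S * P * Q, [2,3,4,6]), (T * T * S * P' * Q', [2,3,5,7]), (T * T * S * P * Q', [2,3,4,7]),
    (- T * T * S * P' * Q, [2,3,5,6]), (T * T * T, [2,3,4,5]), (2 * T * T * T, [2,3,6,7]),
    (- T * P * Q, [1,3,4,6]), (T * P' * Q', [1,3,5,7]), (- T * P * Q', [1,3,4,7]), (- T * P' * Q, [1,3,5,6]),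
    (T * P * Q, [1,2,4,6]), (- T * P' * Q', [1,2,5,7]), (- T * P * Q', [1,2,4,7]), (- T * P' * Q, [1,2,5,6])]"

definition tau_list :: "real \<Rightarrow> real \<Rightarrow> real \<Rightarrow> real \<Rightarrow> real \<Rightarrow> real \<Rightarrow> lcomb" where
  "tau_list T S P P' Q Q' = [(3 * T * P * Q, [4,6]), (3 * T * P' * Q', [5,7]), (3 * T * P * Q', [4,7]),
    (- 3 * T * P' * Q, [5,6]), (3 * S, [4,5]), (6 * S, [6,7])]"

text \<open>With \<open>C = cosh (t/2)\<close>, \<open>s = sinh (t/2)\<close> and \<open>f\<^sup>4 = P e\<^sup>4\<close>, \<open>f\<^sup>5 = P' e\<^sup>5\<close>,
  \<open>g\<^sup>6 = Q e\<^sup>6 + Q' e\<^sup>7\<close>, \<open>g\<^sup>7 = Q' e\<^sup>7 - Q e\<^sup>6\<close>, the coframe on the fibre is \<open>C f\<^sup>4 - s g\<^sup>7\<close>,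
  \<open>C f\<^sup>5 + s g\<^sup>6\<close>, \<open>C g\<^sup>6 + s f\<^sup>5\<close>, \<open>C g\<^sup>7 - s f\<^sup>4\<close>: a boost that carries \<open>F\<close> to
  \<open>f\<^sup>4 \<and> g\<^sup>6 + f\<^sup>5 \<and> g\<^sup>7\<close>.\<close>

definition coframe_rows :: "real \<Rightarrow> real \<Rightarrow> real \<Rightarrow> real \<Rightarrow> real \<Rightarrow> real \<Rightarrow> real \<Rightarrow> nat \<Rightarrow> lcomb" where
  "coframe_rows T C s P P' Q Q' a =
    (if a = 1 then [(1, [1])] else if a = 2 then [(T, [2])] else if a = 3 then [(T, [3])]
     else if a = 4 then [(C * P, [4]), (- s * Q', [7]), (s * Q, [6])]
     else if a = 5 then [(C * P', [5]), (s * Q, [6]), (s * Q', [7])]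
     else if a = 6 then [(C * Q, [6]), (C * Q', [7]), (s * P', [5])]
     else [(C * Q', [7]), (- C * Q, [6]), (- s * P, [4])])"

lemma coframe_rows_simps:
  "coframe_rows T C s P P' Q Q' 1 = [(1, [1])]"
  "coframe_rows T C s P P' Q Q' (Suc 0) = [(1, [1])]"
  "coframe_rows T C s P P' Q Q' 2 = [(T, [2])]"
  "coframe_rows T C s P P' Q Q' 3 = [(T, [3])]"
  "coframe_rows T C s P P' Q Q' 4 = [(C * P, [4]), (- s * Q', [7]), (s * Q, [6])]"
  "coframe_rows T C s P P' Q Q' 5 = [(C * P', [5]), (s * Q, [6]), (s * Q', [7])]"
  "coframe_rows T C s P P' Q Q' 6 = [(C * Q, [6]), (C * Q', [7]), (s * P', [5])]"
  "coframe_rows T C s P P' Q Q' 7 = [(C * Q', [7]), (- C * Q, [6]), (- s * P, [4])]"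
  by (simp_all add: coframe_rows_def)

lemmas pull_simps = coframe_rows_simps lc_scale_def lc_wedge_simps

context
  fixes T S C s P P' Q Q' :: real
  assumes T: "T = C * C + s * s" and S: "S = 2 * C * s" and Cs: "C * C - s * s = 1"
    and P: "P * P' = 1" and Q: "Q * Q' = 1"
begin

text \<open>Once the hyperbolic and exponential values are treated as indeterminates, these
  relations reduce every coefficient to a normal form. The variants with \<open>x\<close> act inside
  right-nested products, where the square or product is not a subterm.\<close>

lemma reduce:
  "C * C = 1 + s * s" "C * (C * x) = x + s * (s * x)"
  "P * P' = 1" "P * (P' * x) = x" "Q * Q' = 1" "Q * (Q' * x) = x"
  using Cs P Q by (simp_all flip: mult.assoc) (simp_all add: algebra_simps)

lemma pull_tau0: "lc (lc_pull (coframe_rows T C s P P' Q Q') [(3,[4,6]), (3,[5,7])]) = lc (tau_list T S P P' Q Q')"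
  unfolding tau_list_def T S
  apply (rule lc_eqI)
  apply (simp add: pull_simps reduce)
  apply (simp add: algebra_simps reduce)
  done

lemma pull_phi0: "lc (lc_pull (coframe_rows T C s P P' Q Q')
    [(1,[1,2,3]), (1,[1,4,5]), (1,[1,6,7]), (1,[2,4,6]), (-1,[2,5,7]), (-1,[3,4,7]), (-1,[3,5,6])])
   = lc (phi_list T S P P' Q Q')"
  unfolding phi_list_def 
  apply (rule lc_eqI)
  apply (simp add: pull_simps reduce)
  apply (simp add: algebra_simps reduce T S)
  done

lemma pull_psi0: "lc (lc_pull (coframe_rows T C s P P' Q Q')
   [(1,[4,5,6,7]), (1,[2,3,4,5]), (1,[2,3,6,7]), (-1,[1,3,4,6]), (1,[1,3,5,7]), (-1,[1,2,4,7]), (-1,[1,2,5,6])])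
   = lc (psi_list T S P P' Q Q')"
  unfolding psi_list_def
  apply (rule lc_eqI)
  apply (simp add: pull_simps reduce)
  apply (simp add: algebra_simps reduce T S)
  done

end

subsection \<open>Exterior derivatives\<close>

lemma eform_row':
  "(\<Sum>i<length vs. (-1) ^ i * vs ! i $ of_nat a * eform is (take i vs @ drop (Suc i) vs)) = eform (a # is) vs"
proof (cases "length vs = Suc (length is)")
  case False
  then have "eform is (take i vs @ drop (Suc i) vs) = 0" if "i < length vs" for i
    using that by (intro eform_eq_0) auto
  then show ?thesis using False by (simp add: eform_eq_0)
qed (simp add: eform_row)

text \<open>Three partial derivatives suffice because all coefficients are constant along the
  fibres.\<close>

definition grad :: "(vec7 \<Rightarrow> real) \<Rightarrow> vec7 \<Rightarrow> real \<Rightarrow> real \<Rightarrow> real \<Rightarrow> bool" where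
  "grad f x a b c \<longleftrightarrow> (f has_derivative (\<lambda>v. a * v$1 + b * v$2 + c * v$3)) (at x)"

lemma ext_deriv_lc:
  assumes "\<forall>(f, a, b, c, is)\<in>set fs. grad f x a b c"
  shows "ext_deriv (\<lambda>y. lc (map (\<lambda>(f, a, b, c, is). (f y, is)) fs)) x =
    lc (concat (map (\<lambda>(f, a, b, c, is). [(a, 1 # is), (b, 2 # is), (c, 3 # is)]) fs))"
proof
  fix vs
  have D: "((\<lambda>y. lc (map (\<lambda>(f, a, b, c, is). (f y, is)) fs) ws) has_derivative
     (\<lambda>v. \<Sum>(f, a, b, c, is)\<leftarrow>fs. (a * v$1 + b * v$2 + c * v$3) * eform is ws)) (at x)" for ws
    using assms
  proof (induction fs)
    case (Cons z fs)
    obtain f a b c "is" where z: "z = (f, a, b, c, is)" by (cases z)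
    have "((\<lambda>y. f y * eform is ws) has_derivative (\<lambda>v. (a * v$1 + b * v$2 + c * v$3) * eform is ws)) (at x)"
      using Cons.prems by (intro has_derivative_mult_left) (simp add: z grad_def)
    then show ?case using Cons by (auto simp: z lc_Cons intro!: has_derivative_add)
  qed simp
  have "ext_deriv (\<lambda>y. lc (map (\<lambda>(f, a, b, c, is). (f y, is)) fs)) x vs =
    (\<Sum>i<length vs. (-1) ^ i * (\<Sum>(f, a, b, c, is)\<leftarrow>fs. (a * vs!i$1 + b * vs!i$2 + c * vs!i$3) *
      eform is (take i vs @ drop (Suc i) vs)))"
    unfolding ext_deriv_def frechet_derivative_at[OF D, symmetric] ..
  also have "\<dots> = lc (concat (map (\<lambda>(f, a, b, c, is). [(a, 1 # is), (b, 2 # is), (c, 3 # is)]) fs)) vs"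
  proof (induction fs)
    case (Cons z fs)
    obtain f a b c "is" where z: "z = (f, a, b, c, is)" by (cases z)
    have "(\<Sum>i<length vs. (-1) ^ i * ((a * vs!i$1 + b * vs!i$2 + c * vs!i$3) * eform is (take i vs @ drop (Suc i) vs)))
      = a * eform (1 # is) vs + b * eform (2 # is) vs + c * eform (3 # is) vs"
      unfolding eform_row'[symmetric] sum_distrib_left sum.distrib[symmetric]
      by (rule sum.cong) (simp_all add: algebra_simps)
    then show ?case using Cons by (simp add: z lc_Cons distrib_left sum.distrib)
  qed simp
  finally show "ext_deriv (\<lambda>y. lc (map (\<lambda>(f, a, b, c, is). (f y, is)) fs)) x vs =
    lc (concat (map (\<lambda>(f, a, b, c, is). [(a, 1 # is), (b, 2 # is), (c, 3 # is)]) fs)) vs" .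
qed

type_synonym coeff = "real \<Rightarrow> real \<Rightarrow> real \<Rightarrow> real \<Rightarrow> real \<Rightarrow> real \<Rightarrow> real"

text \<open>Keeping the six function values as formal parameters makes identities between forms
  polynomial identities modulo the relations among these values.\<close>

definition at_point :: "(real \<Rightarrow> real \<Rightarrow> real \<Rightarrow> real \<Rightarrow> real \<Rightarrow> real \<Rightarrow> 'a) \<Rightarrow> vec7 \<Rightarrow> 'a" where
  "at_point f x = f (cosh (x$1)) (sinh (x$1)) (exp (x$2)) (exp (- x$2)) (exp (x$3)) (exp (- x$3))"

lemma grad_const: "grad (\<lambda>y. k) x 0 0 0"
  by (simp add: grad_def)

lemma grad_mult:
  assumes "grad f x a b c" "grad g x a' b' c'"
  shows "grad (\<lambda>y. f y * g y) x (a * g x + f x * a') (b * g x + f x * b') (c * g x + f x * c')"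
  using has_derivative_mult[OF assms[unfolded grad_def]]
  unfolding grad_def by (rule has_derivative_eq_rhs) (auto simp: algebra_simps)

lemma grad_uminus: "grad f x a b c \<Longrightarrow> grad (\<lambda>y. - f y) x (- a) (- b) (- c)"
  using has_derivative_minus[of f _ "at x"]
  unfolding grad_def by (drule_tac has_derivative_minus) (erule has_derivative_eq_rhs, auto simp: algebra_simps)

lemma has_derivative_comp_coord:
  assumes "(g has_real_derivative d) (at (x $ i))"
  shows "((\<lambda>y::vec7. g (y $ i)) has_derivative (\<lambda>v. d * v $ i)) (at x)"
proof -
  have "((\<lambda>y::vec7. y $ i) has_derivative (\<lambda>v. v $ i)) (at x)"
    by (rule bounded_linear_imp_has_derivative) (rule bounded_linear_vec_nth)
  from has_derivative_compose[OF this assms[unfolded has_field_derivative_def]]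
  show ?thesis by (simp add: mult.commute)
qed

lemma grad_basic:
  "grad (\<lambda>y. cosh (y$1)) x (sinh (x$1)) 0 0"
  "grad (\<lambda>y. sinh (y$1)) x (cosh (x$1)) 0 0"
  "grad (\<lambda>y. exp (y$2)) x 0 (exp (x$2)) 0"
  "grad (\<lambda>y. exp (- y$2)) x 0 (- exp (- x$2)) 0"
  "grad (\<lambda>y. exp (y$3)) x 0 0 (exp (x$3))"
  "grad (\<lambda>y. exp (- y$3)) x 0 0 (- exp (- x$3))"
proof -
  have e: "((\<lambda>y. exp (- y)) has_real_derivative - exp (- z)) (at z)" for z :: real
    by (auto intro!: derivative_eq_intros)
  have c: "(cosh has_real_derivative sinh z) (at z)" "(sinh has_real_derivative cosh z) (at z)" for z :: real
    by (auto intro!: derivative_eq_intros)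
  show "grad (\<lambda>y. cosh (y$1)) x (sinh (x$1)) 0 0"
    unfolding grad_def using has_derivative_comp_coord[OF c(1), where x = x and i = 1] by simp
  show "grad (\<lambda>y. sinh (y$1)) x (cosh (x$1)) 0 0"
    unfolding grad_def using has_derivative_comp_coord[OF c(2), where x = x and i = 1] by simp
  show "grad (\<lambda>y. exp (y$2)) x 0 (exp (x$2)) 0"
    unfolding grad_def using has_derivative_comp_coord[OF DERIV_exp, where x = x and i = 2] by simp
  show "grad (\<lambda>y. exp (- y$2)) x 0 (- exp (- x$2)) 0"
    unfolding grad_def using has_derivative_comp_coord[OF e, where x = x and i = 2] by simp
  show "grad (\<lambda>y. exp (y$3)) x 0 0 (exp (x$3))"
    unfolding grad_def using has_derivative_comp_coord[OF DERIV_exp, where x = x and i = 3] by simp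
  show "grad (\<lambda>y. exp (- y$3)) x 0 0 (- exp (- x$3))"
    unfolding grad_def using has_derivative_comp_coord[OF e, where x = x and i = 3] by simp
qed

lemma grad_eq: "grad f x a b c \<Longrightarrow> a = a' \<Longrightarrow> b = b' \<Longrightarrow> c = c' \<Longrightarrow> grad f x a' b' c'"
  by simp

lemmas grad_intros = grad_basic grad_mult grad_uminus grad_const

text \<open>Each entry holds a coefficient, its partial derivatives in the three base coordinates,
  and the labels of its monomial. The derivatives are supplied explicitly and verified in
  \<open>has_grad_data\<close>.\<close>

definition phi_data :: "(coeff \<times> coeff \<times> coeff \<times> coeff \<times> nat list) list" where
  "phi_data = [
    (\<lambda>T S P P' Q Q'. T * T,
      \<lambda>T S P P' Q Q'. 2 * T * S, \<lambda>T S P P' Q Q'. 0, \<lambda>T S P P' Q Q'. 0, [1,2,3]),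
    (\<lambda>T S P P' Q Q'. S * P * Q,
      \<lambda>T S P P' Q Q'. T * P * Q, \<lambda>T S P P' Q Q'. S * P * Q, \<lambda>T S P P' Q Q'. S * P * Q, [1,4,6]),
    (\<lambda>T S P P' Q Q'. S * P' * Q',
      \<lambda>T S P P' Q Q'. T * P' * Q', \<lambda>T S P P' Q Q'. - S * P' * Q', \<lambda>T S P P' Q Q'. - S * P' * Q', [1,5,7]),
    (\<lambda>T S P P' Q Q'. S * P * Q',
      \<lambda>T S P P' Q Q'. T * P * Q', \<lambda>T S P P' Q Q'. S * P * Q', \<lambda>T S P P' Q Q'. - S * P * Q', [1,4,7]),
    (\<lambda>T S P P' Q Q'. - S * P' * Q,
      \<lambda>T S P P' Q Q'. - T * P' * Q, \<lambda>T S P P' Q Q'. S * P' * Q, \<lambda>T S P P' Q Q'. - S * P' * Q, [1,5,6]),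
    (\<lambda>T S P P' Q Q'. T,
      \<lambda>T S P P' Q Q'. S, \<lambda>T S P P' Q Q'. 0, \<lambda>T S P P' Q Q'. 0, [1,4,5]),
    (\<lambda>T S P P' Q Q'. 2 * T,
      \<lambda>T S P P' Q Q'. 2 * S, \<lambda>T S P P' Q Q'. 0, \<lambda>T S P P' Q Q'. 0, [1,6,7]),
    (\<lambda>T S P P' Q Q'. T * P * Q,
      \<lambda>T S P P' Q Q'. S * P * Q, \<lambda>T S P P' Q Q'. T * P * Q, \<lambda>T S P P' Q Q'. T * P * Q, [2,4,6]),
    (\<lambda>T S P P' Q Q'. - T * P' * Q',
      \<lambda>T S P P' Q Q'. - S * P' * Q', \<lambda>T S P P' Q Q'. T * P' * Q', \<lambda>T S P P' Q Q'. T * P' * Q', [2,5,7]),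
    (\<lambda>T S P P' Q Q'. T * P * Q',
      \<lambda>T S P P' Q Q'. S * P * Q', \<lambda>T S P P' Q Q'. T * P * Q', \<lambda>T S P P' Q Q'. - T * P * Q', [2,4,7]),
    (\<lambda>T S P P' Q Q'. T * P' * Q,
      \<lambda>T S P P' Q Q'. S * P' * Q, \<lambda>T S P P' Q Q'. - T * P' * Q, \<lambda>T S P P' Q Q'. T * P' * Q, [2,5,6]),
    (\<lambda>T S P P' Q Q'. T * P * Q,
      \<lambda>T S P P' Q Q'. S * P * Q, \<lambda>T S P P' Q Q'. T * P * Q, \<lambda>T S P P' Q Q'. T * P * Q, [3,4,6]),
    (\<lambda>T S P P' Q Q'. - T * P' * Q',
      \<lambda>T S P P' Q Q'. - S * P' * Q', \<lambda>T S P P' Q Q'. T * P' * Q', \<lambda>T S P P' Q Q'. T * P' * Q', [3,5,7]),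
    (\<lambda>T S P P' Q Q'. - T * P * Q',
      \<lambda>T S P P' Q Q'. - S * P * Q', \<lambda>T S P P' Q Q'. - T * P * Q', \<lambda>T S P P' Q Q'. T * P * Q', [3,4,7]),
    (\<lambda>T S P P' Q Q'. - T * P' * Q,
      \<lambda>T S P P' Q Q'. - S * P' * Q, \<lambda>T S P P' Q Q'. T * P' * Q, \<lambda>T S P P' Q Q'. - T * P' * Q, [3,5,6])]"

definition psi_data :: "(coeff \<times> coeff \<times> coeff \<times> coeff \<times> nat list) list" where
  "psi_data = [
    (\<lambda>T S P P' Q Q'. 2,
      \<lambda>T S P P' Q Q'. 0, \<lambda>T S P P' Q Q'. 0, \<lambda>T S P P' Q Q'. 0, [4,5,6,7]),
    (\<lambda>T S P P' Q Q'. T * T * S * P * Q,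
      \<lambda>T S P P' Q Q'. 2 * T * S * S * P * Q + T * T * T * P * Q, \<lambda>T S P P' Q Q'. T * T * S * P * Q, \<lambda>T S P P' Q Q'. T * T * S * P * Q, [2,3,4,6]),
    (\<lambda>T S P P' Q Q'. T * T * S * P' * Q',
      \<lambda>T S P P' Q Q'. 2 * T * S * S * P' * Q' + T * T * T * P' * Q', \<lambda>T S P P' Q Q'. - T * T * S * P' * Q', \<lambda>T S P P' Q Q'. - T * T * S * P' * Q', [2,3,5,7]),
    (\<lambda>T S P P' Q Q'. T * T * S * P * Q',
      \<lambda>T S P P' Q Q'. 2 * T * S * S * P * Q' + T * T * T * P * Q', \<lambda>T S P P' Q Q'. T * T * S * P * Q', \<lambda>T S P P' Q Q'. - T * T * S * P * Q', [2,3,4,7]),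
    (\<lambda>T S P P' Q Q'. - T * T * S * P' * Q,
      \<lambda>T S P P' Q Q'. - 2 * T * S * S * P' * Q + - T * T * T * P' * Q, \<lambda>T S P P' Q Q'. T * T * S * P' * Q, \<lambda>T S P P' Q Q'. - T * T * S * P' * Q, [2,3,5,6]),
    (\<lambda>T S P P' Q Q'. T * T * T,
      \<lambda>T S P P' Q Q'. 3 * T * T * S, \<lambda>T S P P' Q Q'. 0, \<lambda>T S P P' Q Q'. 0, [2,3,4,5]),
    (\<lambda>T S P P' Q Q'. 2 * T * T * T,
      \<lambda>T S P P' Q Q'. 6 * T * T * S, \<lambda>T S P P' Q Q'. 0, \<lambda>T S P P' Q Q'. 0, [2,3,6,7]),
    (\<lambda>T S P P' Q Q'. - T * P * Q,
      \<lambda>T S P P' Q Q'. - S * P * Q, \<lambda>T S P P' Q Q'. - T * P * Q, \<lambda>T S P P' Q Q'. - T * P * Q, [1,3,4,6]),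
    (\<lambda>T S P P' Q Q'. T * P' * Q',
      \<lambda>T S P P' Q Q'. S * P' * Q', \<lambda>T S P P' Q Q'. - T * P' * Q', \<lambda>T S P P' Q Q'. - T * P' * Q', [1,3,5,7]),
    (\<lambda>T S P P' Q Q'. - T * P * Q',
      \<lambda>T S P P' Q Q'. - S * P * Q', \<lambda>T S P P' Q Q'. - T * P * Q', \<lambda>T S P P' Q Q'. T * P * Q', [1,3,4,7]),
    (\<lambda>T S P P' Q Q'. - T * P' * Q,
      \<lambda>T S P P' Q Q'. - S * P' * Q, \<lambda>T S P P' Q Q'. T * P' * Q, \<lambda>T S P P' Q Q'. - T * P' * Q, [1,3,5,6]),
    (\<lambda>T S P P' Q Q'. T * P * Q,
      \<lambda>T S P P' Q Q'. S * P * Q, \<lambda>T S P P' Q Q'. T * P * Q, \<lambda>T S P P' Q Q'. T * P * Q, [1,2,4,6]),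
    (\<lambda>T S P P' Q Q'. - T * P' * Q',
      \<lambda>T S P P' Q Q'. - S * P' * Q', \<lambda>T S P P' Q Q'. T * P' * Q', \<lambda>T S P P' Q Q'. T * P' * Q', [1,2,5,7]),
    (\<lambda>T S P P' Q Q'. - T * P * Q',
      \<lambda>T S P P' Q Q'. - S * P * Q', \<lambda>T S P P' Q Q'. - T * P * Q', \<lambda>T S P P' Q Q'. T * P * Q', [1,2,4,7]),
    (\<lambda>T S P P' Q Q'. - T * P' * Q,
      \<lambda>T S P P' Q Q'. - S * P' * Q, \<lambda>T S P P' Q Q'. T * P' * Q, \<lambda>T S P P' Q Q'. - T * P' * Q, [1,2,5,6])]"

definition tau_data :: "(coeff \<times> coeff \<times> coeff \<times> coeff \<times> nat list) list" where
  "tau_data = [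
    (\<lambda>T S P P' Q Q'. 3 * T * P * Q,
      \<lambda>T S P P' Q Q'. 3 * S * P * Q, \<lambda>T S P P' Q Q'. 3 * T * P * Q, \<lambda>T S P P' Q Q'. 3 * T * P * Q, [4,6]),
    (\<lambda>T S P P' Q Q'. 3 * T * P' * Q',
      \<lambda>T S P P' Q Q'. 3 * S * P' * Q', \<lambda>T S P P' Q Q'. - 3 * T * P' * Q', \<lambda>T S P P' Q Q'. - 3 * T * P' * Q', [5,7]),
    (\<lambda>T S P P' Q Q'. 3 * T * P * Q',
      \<lambda>T S P P' Q Q'. 3 * S * P * Q', \<lambda>T S P P' Q Q'. 3 * T * P * Q', \<lambda>T S P P' Q Q'. - 3 * T * P * Q', [4,7]),
    (\<lambda>T S P P' Q Q'. - 3 * T * P' * Q,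
      \<lambda>T S P P' Q Q'. - 3 * S * P' * Q, \<lambda>T S P P' Q Q'. 3 * T * P' * Q, \<lambda>T S P P' Q Q'. - 3 * T * P' * Q, [5,6]),
    (\<lambda>T S P P' Q Q'. 3 * S,
      \<lambda>T S P P' Q Q'. 3 * T, \<lambda>T S P P' Q Q'. 0, \<lambda>T S P P' Q Q'. 0, [4,5]),
    (\<lambda>T S P P' Q Q'. 6 * S,
      \<lambda>T S P P' Q Q'. 6 * T, \<lambda>T S P P' Q Q'. 0, \<lambda>T S P P' Q Q'. 0, [6,7])]"

definition has_grad :: "(coeff \<times> coeff \<times> coeff \<times> coeff \<times> nat list) \<Rightarrow> bool" where
  "has_grad = (\<lambda>(f, a, b, c, is). \<forall>x. grad (at_point f) x (at_point a x) (at_point b x) (at_point c x))"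

definition data_values :: "(coeff \<times> coeff \<times> coeff \<times> coeff \<times> nat list) list \<Rightarrow>
    real \<Rightarrow> real \<Rightarrow> real \<Rightarrow> real \<Rightarrow> real \<Rightarrow> real \<Rightarrow> lcomb" where
  "data_values ds T S P P' Q Q' = map (\<lambda>(f, a, b, c, is). (f T S P P' Q Q', is)) ds"

definition derivs :: "(coeff \<times> coeff \<times> coeff \<times> coeff \<times> nat list) list \<Rightarrow>
    real \<Rightarrow> real \<Rightarrow> real \<Rightarrow> real \<Rightarrow> real \<Rightarrow> real \<Rightarrow> lcomb" where
  "derivs ds T S P P' Q Q' = concat (map (\<lambda>(f, a, b, c, is).
     [(a T S P P' Q Q', 1 # is), (b T S P P' Q Q', 2 # is), (c T S P P' Q Q', 3 # is)]) ds)"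

lemma ext_deriv_data:
  assumes "\<forall>d\<in>set ds. has_grad d"
  shows "ext_deriv (\<lambda>y. lc (at_point (data_values ds) y)) x = lc (at_point (derivs ds) x)"
proof -
  let ?fs = "map (\<lambda>(f, a, b, c, is). (at_point f, at_point a x, at_point b x, at_point c x, is)) ds"
  have "\<forall>(f, a, b, c, is)\<in>set ?fs. grad f x a b c"
    using assms unfolding has_grad_def by auto
  from ext_deriv_lc[OF this] show ?thesis
    by (simp add: at_point_def data_values_def derivs_def o_def case_prod_unfold)
qed

lemma has_grad_data:
  "\<forall>d\<in>set phi_data. has_grad d" "\<forall>d\<in>set psi_data. has_grad d" "\<forall>d\<in>set tau_data. has_grad d"
  unfolding phi_data_def psi_data_def tau_data_def
  by ((simp only: list.set ball_simps has_grad_def prod.case at_point_def[abs_def] simp_thms),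
    (intro conjI allI), (rule grad_eq, (rule grad_intros)+, (simp add: algebra_simps; fail)+)+)+

lemma data_values_eq: "data_values phi_data = phi_list" "data_values psi_data = psi_list" "data_values tau_data = tau_list"
  by (simp_all add: fun_eq_iff data_values_def phi_data_def psi_data_def tau_data_def phi_list_def psi_list_def tau_list_def)

definition phi :: "vec7 \<Rightarrow> covector" where "phi x = lc (at_point phi_list x)"
definition psi :: "vec7 \<Rightarrow> covector" where "psi x = lc (at_point psi_list x)"
definition tau :: "vec7 \<Rightarrow> covector" where "tau x = lc (at_point tau_list x)"

text \<open>In terms of F these are d(vol_B + dF) = 0, d(3F) = 3 (phi - vol_B) and d*phi = 3F \<and>
  phi. In the third, F \<and> dF = 0 because F \<and> F is constant; what remains, d*phi = 3F \<and>
  vol_B, is the maximality equation.\<close>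

lemma derivs_algebra:
  assumes T: "T * T - S * S = 1" and P: "P * P' = 1" and Q: "Q * Q' = 1"
  shows "lc (derivs phi_data T S P P' Q Q') = lc []"
    "lc (derivs tau_data T S P P' Q Q') = lc ((- 3 * T * T, [1,2,3]) # lc_scale 3 (phi_list T S P P' Q Q'))"
    "lc (derivs psi_data T S P P' Q Q') = lc (lc_wedge (tau_list T S P P' Q Q') (phi_list T S P P' Q Q'))"
proof -
  have reduce: "S * S = T * T - 1" "S * (S * x) = T * (T * x) - x"
    "P * P' = 1" "P * (P' * x) = x" "Q * Q' = 1" "Q * (Q' * x) = x" for x
    using T P Q by (simp_all flip: mult.assoc) (simp_all add: algebra_simps)
  show "lc (derivs phi_data T S P P' Q Q') = lc []"
    by (rule lc_eqI) (simp add: derivs_def phi_data_def)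
  show "lc (derivs tau_data T S P P' Q Q') = lc ((- 3 * T * T, [1,2,3]) # lc_scale 3 (phi_list T S P P' Q Q'))"
    by (rule lc_eqI) (simp add: derivs_def tau_data_def phi_list_def lc_scale_def)
  show "lc (derivs psi_data T S P P' Q Q') = lc (lc_wedge (tau_list T S P P' Q Q') (phi_list T S P P' Q Q'))"
    apply (rule lc_eqI)
    apply (simp add: derivs_def psi_data_def phi_list_def tau_list_def lc_wedge_simps)
    apply (simp add: algebra_simps reduce)
    done
qed

lemma cosh_sinh_exp_relations: "cosh (x::real) * cosh x - sinh x * sinh x = 1" "exp x * exp (- x) = 1"
  using cosh_square_eq[of x] by (simp_all add: power2_eq_square exp_minus)

lemma ext_deriv_phi: "ext_deriv phi x vs = 0"
  using ext_deriv_data[OF has_grad_data(1), of x] derivs_algebra(1)[OF cosh_sinh_exp_relations(1,2,2), of "x$1" "x$2" "x$3"]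
  by (simp add: data_values_eq phi_def[abs_def] at_point_def)

lemma ext_deriv_tau: "ext_deriv tau x vs = 3 * phi x vs - 3 * (cosh (x$1))\<^sup>2 * eform [1,2,3] vs"
  using ext_deriv_data[OF has_grad_data(3), of x] derivs_algebra(2)[OF cosh_sinh_exp_relations(1,2,2), of "x$1" "x$2" "x$3"]
  by (simp add: data_values_eq tau_def[abs_def] phi_def at_point_def lc_Cons lc_scale power2_eq_square)

lemma ext_deriv_psi: "ext_deriv psi x = wedge 2 3 (tau x) (phi x)"
proof -
  have "wedge 2 3 (tau x) (phi x) = lc (lc_wedge (at_point tau_list x) (at_point phi_list x))"
    unfolding tau_def phi_def by (rule wedge_lc) (simp_all add: at_point_def tau_list_def phi_list_def)
  then show ?thesis
    using ext_deriv_data[OF has_grad_data(2), of x] derivs_algebra(3)[OF cosh_sinh_exp_relations(1,2,2), of "x$1" "x$2" "x$3"]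
    by (simp add: data_values_eq psi_def[abs_def] at_point_def)
qed

subsection \<open>The coframe\<close>

definition cofr :: "vec7 \<Rightarrow> vec7 \<Rightarrow> vec7" where
  "cofr x v = (let C = cosh (x$1/2); s = sinh (x$1/2); P = exp (x$2); P' = exp (- x$2); Q = exp (x$3); Q' = exp (- x$3) in
    (\<chi> i. if i = 1 then v$1 else if i = 2 then cosh (x$1) * v$2 else if i = 3 then cosh (x$1) * v$3
      else if i = 4 then C * P * v$4 - s * (Q' * v$7 - Q * v$6)
      else if i = 5 then C * P' * v$5 + s * (Q * v$6 + Q' * v$7)
      else if i = 6 then C * (Q * v$6 + Q' * v$7) + s * P' * v$5
      else C * (Q' * v$7 - Q * v$6) - s * P * v$4))"

lemma cofr_nth:
  "cofr x v $ 1 = v$1" "cofr x v $ 2 = cosh (x$1) * v$2" "cofr x v $ 3 = cosh (x$1) * v$3"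
  "cofr x v $ 4 = cosh (x$1/2) * exp (x$2) * v$4 - sinh (x$1/2) * (exp (- x$3) * v$7 - exp (x$3) * v$6)"
  "cofr x v $ 5 = cosh (x$1/2) * exp (- x$2) * v$5 + sinh (x$1/2) * (exp (x$3) * v$6 + exp (- x$3) * v$7)"
  "cofr x v $ 6 = cosh (x$1/2) * (exp (x$3) * v$6 + exp (- x$3) * v$7) + sinh (x$1/2) * exp (- x$2) * v$5"
  "cofr x v $ 7 = cosh (x$1/2) * (exp (- x$3) * v$7 - exp (x$3) * v$6) - sinh (x$1/2) * exp (x$2) * v$4"
  by (simp_all add: cofr_def Let_def)

lemma linear_cofr: "linear (cofr x)"
  by (rule linearI) (simp_all add: Finite_Cartesian_Product.vec_eq_iff forall_7 cofr_nth algebra_simps)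

lemma cofr_eq_0:
  assumes "cofr x v = 0"
  shows "v = 0"
proof -
  define C s P P' Q Q' where d: "C = cosh (x$1/2)" "s = sinh (x$1/2)" "P = exp (x$2)" "P' = exp (- x$2)"
    "Q = exp (x$3)" "Q' = exp (- x$3)"
  have pos: "P > 0" "P' > 0" "Q > 0" "Q' > 0" by (simp_all add: d)
  have Cs: "C * C - s * s = 1" unfolding d by (rule cosh_sinh_exp_relations)
  have z: "cofr x v $ i = 0" for i using assms by simp
  have e: "C * (P * v$4) - s * (Q' * v$7 - Q * v$6) = 0" "C * (P' * v$5) + s * (Q * v$6 + Q' * v$7) = 0"
    "C * (Q * v$6 + Q' * v$7) + s * (P' * v$5) = 0" "C * (Q' * v$7 - Q * v$6) - s * (P * v$4) = 0"
    using z[of 4] z[of 5] z[of 6] z[of 7] by (simp_all add: cofr_nth d mult.assoc)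
  have 1: "a = 0 \<and> b = 0" if "C * a - s * b = 0" "C * b - s * a = 0" for a b
  proof -
    have "a * (C * C - s * s) = C * (C * a - s * b) + s * (C * b - s * a)"
      "b * (C * C - s * s) = C * (C * b - s * a) + s * (C * a - s * b)"
      by (simp_all add: algebra_simps)
    then show ?thesis unfolding that Cs by simp
  qed
  have "P * v$4 = 0 \<and> Q' * v$7 - Q * v$6 = 0" using e by (intro 1) auto
  \<comment> \<open>This block has +s off the diagonal; negating its second unknown brings it to the
    previous shape.\<close>
  moreover have "P' * v$5 = 0 \<and> - (Q * v$6 + Q' * v$7) = 0" using e by (intro 1) (auto simp: algebra_simps)
  ultimately have "v$4 = 0" "v$5 = 0" "Q' * v$7 = 0" "Q * v$6 = 0" using pos by auto
  then have "v$4 = 0" "v$5 = 0" "v$6 = 0" "v$7 = 0" using pos by auto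
  moreover have "v$1 = 0" "v$2 = 0" "v$3 = 0" using z[of 1] z[of 2] z[of 3] by (simp_all add: cofr_nth)
  ultimately show ?thesis by (simp add: Finite_Cartesian_Product.vec_eq_iff forall_7)
qed

lemma bij_cofr: "bij (cofr x)"
proof -
  have "inj (cofr x)"
    using linear_injective_0[OF linear_cofr] cofr_eq_0 by blast
  then show ?thesis
    using linear_injective_imp_surjective[OF linear_cofr] by (simp add: bij_def)
qed

lemma pullback_cofr:
  fixes x :: vec7
  assumes "a \<in> {1..7}"
  defines "R \<equiv> coframe_rows (cosh (x$1)) (cosh (x$1/2)) (sinh (x$1/2)) (exp (x$2)) (exp (- x$2)) (exp (x$3)) (exp (- x$3))"
  shows "homog 1 (R a) \<and> pullback (cofr x) (eform [a]) = lc (R a)"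
proof -
  have a: "a = 1 \<or> a = 2 \<or> a = 3 \<or> a = 4 \<or> a = 5 \<or> a = 6 \<or> a = 7" using assms by auto
  have "pullback (cofr x) (eform [a]) vs = lc (R a) vs" for vs
  proof (cases vs)
    case (Cons v ws)
    then show ?thesis using a unfolding R_def
      by (cases ws) (elim disjE; simp add: coframe_rows_simps lc_Cons pullback_def eform_column1 eform_Nil eform_eq_0 cofr_nth algebra_simps)+
  qed (use a in \<open>auto simp: R_def coframe_rows_simps lc_Cons pullback_def eform_eq_0\<close>)
  then show ?thesis using a unfolding R_def by (auto simp: coframe_rows_simps)
qed

lemma half_rel: "cosh (x::real) = cosh (x/2) * cosh (x/2) + sinh (x/2) * sinh (x/2)"
  "sinh x = 2 * cosh (x/2) * sinh (x/2)"
  using cosh_double[of "x/2"] sinh_double[of "x/2"] by (simp_all add: power2_eq_square)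

lemma pullback_cofr_eqs:
  "pullback (cofr x) phi0 = phi x" "pullback (cofr x) psi0 = psi x" "pullback (cofr x) tau0 = tau x"
  "pullback (cofr x) (lc [(c, [1,2,3])]) vs = c * (cosh (x$1))\<^sup>2 * eform [1,2,3] vs"
  subgoal unfolding phi0_lc phi_def at_point_def
    by (subst pullback_lc[OF pullback_cofr]) (rule pull_phi0[OF half_rel cosh_sinh_exp_relations(1,2,2)] | simp)+
  subgoal unfolding psi0_def psi_def at_point_def
    by (subst pullback_lc[OF pullback_cofr]) (rule pull_psi0[OF half_rel cosh_sinh_exp_relations(1,2,2)] | simp)+
  subgoal unfolding tau0_def tau_def at_point_def
    by (subst pullback_lc[OF pullback_cofr]) (rule pull_tau0[OF half_rel cosh_sinh_exp_relations(1,2,2)] | simp)+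
  subgoal
    by (subst pullback_lc[OF pullback_cofr]) (simp_all add: pull_simps lc_Cons power2_eq_square)
  done

lemma adapted_cofr: "adapted_coframe (phi x) (cofr x)"
  unfolding adapted_coframe_def using linear_cofr bij_cofr pullback_cofr_eqs(1) by simp

subsection \<open>Smoothness\<close>

text \<open>This class contains the coefficients of \<open>phi\<close> and \<open>tau\<close> and is
  closed under directional derivatives, so smoothness follows by induction on the order without
  computing higher derivatives.\<close>

inductive exp_poly :: "(vec7 \<Rightarrow> real) \<Rightarrow> bool" where
  const: "exp_poly (\<lambda>x. c)"
| exp: "exp_poly (\<lambda>x. exp (a * x $ i))"
| add: "exp_poly f \<Longrightarrow> exp_poly g \<Longrightarrow> exp_poly (\<lambda>x. f x + g x)"
| mult: "exp_poly f \<Longrightarrow> exp_poly g \<Longrightarrow> exp_poly (\<lambda>x. f x * g x)"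

lemma exp_poly_has_derivative:
  "exp_poly f \<Longrightarrow> \<exists>D. (\<forall>x. (f has_derivative D x) (at x)) \<and> (\<forall>v. exp_poly (\<lambda>x. D x v))"
proof (induction rule: exp_poly.induct)
  case (const c)
  show ?case by (rule exI[of _ "\<lambda>x v. 0"]) (auto intro: exp_poly.const)
next
  case (exp a i)
  have d: "((\<lambda>y. exp (a * y)) has_real_derivative a * exp (a * z)) (at z)" for z
    by (auto intro!: derivative_eq_intros)
  show ?case
  proof (intro exI[of _ "\<lambda>x v. a * exp (a * x $ i) * v $ i"] conjI allI)
    fix v :: vec7
    have "exp_poly (\<lambda>x. a * v $ i * exp (a * x $ i))"
      by (intro exp_poly.mult exp_poly.const exp_poly.exp)
    then show "exp_poly (\<lambda>x. a * exp (a * x $ i) * v $ i)" by (simp add: ac_simps)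
  qed (rule has_derivative_comp_coord[OF d])
next
  case (add f g)
  then obtain D E where D: "\<And>x. (f has_derivative D x) (at x)" "\<And>v. exp_poly (\<lambda>x. D x v)"
    and E: "\<And>x. (g has_derivative E x) (at x)" "\<And>v. exp_poly (\<lambda>x. E x v)" by blast
  show ?case
    by (rule exI[of _ "\<lambda>x v. D x v + E x v"]) (auto intro!: has_derivative_add exp_poly.add D E)
next
  case (mult f g)
  then obtain D E where D: "\<And>x. (f has_derivative D x) (at x)" "\<And>v. exp_poly (\<lambda>x. D x v)"
    and E: "\<And>x. (g has_derivative E x) (at x)" "\<And>v. exp_poly (\<lambda>x. E x v)" by blast
  show ?case
    by (rule exI[of _ "\<lambda>x v. f x * E x v + D x v * g x"])
       (auto intro!: has_derivative_mult exp_poly.add exp_poly.mult mult.hyps D E)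
qed

lemma smooth_exp_poly:
  assumes "exp_poly f"
  shows "smooth_on UNIV f"
proof -
  have "Ck_on k UNIV f" for k using assms
  proof (induction k arbitrary: f)
    case 0
    then obtain D where "\<And>x. (f has_derivative D x) (at x)" using exp_poly_has_derivative by blast
    then have "continuous_on UNIV f"
      by (auto intro!: continuous_at_imp_continuous_on has_derivative_continuous)
    then show ?case by simp
  next
    case (Suc k)
    then obtain D where D: "\<And>x. (f has_derivative D x) (at x)" "\<And>v. exp_poly (\<lambda>x. D x v)"
      using exp_poly_has_derivative by blast
    have "frechet_derivative f (at x) = D x" for x
      using frechet_derivative_at[OF D(1)] by simp
    then show ?case using D Suc.IH by (auto simp: differentiable_def)
  qed
  then show ?thesis by (simp add: smooth_on_def)
qed

lemma exp_poly_coeffs: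
  "exp_poly f \<Longrightarrow> exp_poly (\<lambda>x. - f x)"
  "exp_poly (\<lambda>x. exp (x $ i))" "exp_poly (\<lambda>x. exp (- x $ i))"
  "exp_poly (\<lambda>x. cosh (x $ i))" "exp_poly (\<lambda>x. sinh (x $ i))"
proof -
  show m: "exp_poly f \<Longrightarrow> exp_poly (\<lambda>x. - f x)" for f
    using exp_poly.mult[OF exp_poly.const[of "- 1"], of f] by simp
  show e: "exp_poly (\<lambda>x. exp (x $ i))" "exp_poly (\<lambda>x. exp (- x $ i))"
    using exp_poly.exp[of 1 i] exp_poly.exp[of "- 1" i] by simp_all
  show "exp_poly (\<lambda>x. cosh (x $ i))"
    using exp_poly.mult[OF exp_poly.const[of "1/2"] exp_poly.add[OF e]]
    by (simp add: cosh_field_def)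
  show "exp_poly (\<lambda>x. sinh (x $ i))"
    using exp_poly.mult[OF exp_poly.const[of "1/2"] exp_poly.add[OF e(1) m[OF e(2)]]]
    by (simp add: sinh_field_def)
qed

lemma smooth_phi: "smooth_on UNIV (\<lambda>x. phi x vs)"
  and smooth_tau: "smooth_on UNIV (\<lambda>x. tau x vs)"
  by (rule smooth_exp_poly,
      simp only: phi_def tau_def at_point_def phi_list_def tau_list_def lc_Cons lc_Nil,
      intro exp_poly.add exp_poly_coeffs exp_poly.mult exp_poly.const)+

lemma alternating_lc:
  assumes "homog k xs"
  shows "alternating_form k (lc xs)"
proof -
  have "lc xs vs = 0" if "length vs \<noteq> k" for vs
    using assms by (induction xs) (auto simp: lc_Cons eform_eq_0 that)
  moreover have "lc xs vs = 0" if "i < j" "j < length vs" "vs ! i = vs ! j" for vs i j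
    by (induction xs) (auto simp: lc_Cons eform_def basis_form_identical[OF that])
  ultimately show ?thesis
    using multilinear_lc[OF assms] unfolding alternating_form_def multilinear_def by blast
qed

lemma alternating_phi: "alternating_form 3 (phi x)" and alternating_tau: "alternating_form 2 (tau x)"
  unfolding phi_def tau_def
  by (rule alternating_lc, simp add: at_point_def phi_list_def tau_list_def)+

subsection \<open>The manifold\<close>

abbreviation chart0 :: "vec7 chart" where "chart0 \<equiv> (UNIV, id)"

lemma local_chart0: "local_rep chart0 chart0 h = h" "local_dom chart0 chart0 h = UNIV"
  by (auto simp: local_rep_def local_dom_def fun_eq_iff inv_into_def)

lemma Ck_const: "Ck_on k UNIV (\<lambda>x. c)"
  by (induction k arbitrary: c) (auto simp: frechet_derivative_const)

lemma frechet_derivative_id: "frechet_derivative id (at x) = id"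
  using frechet_derivative_at[OF has_derivative_ident[of "at x"]] by (simp add: id_def)

lemma smooth_id: "smooth_on UNIV (id :: vec7 \<Rightarrow> vec7)"
proof -
  have "Ck_on k UNIV (id :: vec7 \<Rightarrow> vec7)" for k
    by (cases k) (auto simp: frechet_derivative_id Ck_const continuous_on_id differentiable_def
        intro: has_derivative_ident[folded id_def])
  then show ?thesis by (simp add: smooth_on_def)
qed

lemma second_countable_vec7: "second_countable (euclidean :: vec7 topology)"
proof -
  obtain B :: "vec7 set set" where B: "countable B" "topological_basis B"
    using ex_countable_basis by blast
  then have "\<exists>V\<in>B. x \<in> V \<and> V \<subseteq> U" if "open U" "x \<in> U" for x U
    using topological_basisE[OF B(2) that] by blast
  then show ?thesis
    unfolding second_countable_def using B topological_basis_open[OF B(2)] by auto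
qed

lemma manifold: "smooth_manifold euclidean {chart0}"
  by (simp add: smooth_manifold_def is_chart_def local_chart0 smooth_id Hausdorff_space_euclidean
      second_countable_vec7)

lemma preserves_chart0:
  "preserves {chart0} \<omega> h \<longleftrightarrow>
    (\<forall>x. \<omega> chart0 x = pullback (frechet_derivative h (at x)) (\<omega> chart0 (h x)))"
  by (simp add: preserves_def local_chart0)

lemma preserves_id: "preserves {chart0} \<omega> id"
  unfolding preserves_chart0 frechet_derivative_id by (simp add: pullback_def)

abbreviation global_form :: "(vec7 \<Rightarrow> covector) \<Rightarrow> vec7 form_field" where "global_form \<omega> \<equiv> (\<lambda>c. \<omega>)"

lemma form_phi: "differential_form {chart0} 3 (global_form phi)"
  and form_tau: "differential_form {chart0} 2 (global_form tau)"
  by (simp_all add: differential_form_def alternating_phi alternating_tau smooth_phi smooth_tau preserves_id)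

lemma G2_phi: "G2_structure {chart0} (global_form phi)"
  using adapted_cofr by (auto simp: G2_structure_def form_phi)

lemma adapted_phi: "adapted (phi x) (cofr x)"
  by (rule adapted.intro[OF adapted_cofr])

lemma hodge_star_phi: "hodge_star 3 (phi x) (phi x) = psi x"
  using adapted.hodge_star_phi[OF adapted_phi] by (simp add: pullback_cofr_eqs)

lemma metric_phi: "metric (phi x) u v = cofr x u \<bullet> cofr x v"
  by (rule adapted.metric[OF adapted_phi])

lemma torsion_phi: "torsion_form {chart0} (global_form phi) (global_form tau)"
  by (simp add: torsion_form_def form_tau hodge_star_phi ext_deriv_psi)

text \<open>The squared norm 18 gives \<open>phi\<close> the coefficient 18/7 + 18/42 = 3, and the
  star of tau \<and> tau contributes -18/6 = -3 times vol_B; this is d(3F).\<close>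

lemma ERP_phi: "ERP {chart0} (global_form phi) (global_form tau)"
proof -
  have "norm_sq 2 (phi x) (tau x) = 18" for x
    using adapted.norm_sq_tau[OF adapted_phi, of x] by (simp add: pullback_cofr_eqs)
  moreover have "hodge_star 4 (phi x) (wedge 2 2 (tau x) (tau x)) vs = - 18 * (cosh (x$1))\<^sup>2 * eform [1,2,3] vs" for x vs
    using fun_cong[OF adapted.hodge_star_tau_tau[OF adapted_phi, of x], of vs]
    by (simp only: pullback_cofr_eqs)
  ultimately show ?thesis
    by (simp add: ERP_def ext_deriv_tau field_simps)
qed

lemma closed_phi: "closed_form {chart0} (global_form phi)"
  by (simp add: closed_form_def ext_deriv_phi)

lemma tau_nonzero: "not_identically_zero {chart0} (global_form tau)"
proof -
  have "tau 0 [ax 4, ax 6] = 3"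
    by (simp add: tau_def at_point_def tau_list_def lc_Cons eform_columns axis_nth eform_Nil)
  then show ?thesis unfolding not_identically_zero_def by (auto intro!: exI[of _ 0] exI[of _ "[ax 4, ax 6]"])
qed

subsection \<open>Completeness\<close>

definition spd :: "(real \<Rightarrow> vec7) \<Rightarrow> real \<Rightarrow> real" where
  "spd = speed {chart0} (global_form phi)"

lemma speed_phi: "spd \<gamma> t = norm (cofr (\<gamma> t) (vector_derivative \<gamma> (at t)))"
proof -
  have "(SOME c. c \<in> {chart0} \<and> \<gamma> t \<in> cdom c) = chart0" by (rule some_equality) auto
  then show ?thesis by (simp add: spd_def speed_def metric_phi norm_eq_sqrt_inner Let_def)
qed

lemma curve_length_phi: "curve_length {chart0} (global_form phi) \<gamma> = integral {0..1} (spd \<gamma>)"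
  by (simp add: curve_length_def spd_def)

lemma C1_curve_on_iff:
  "C1_curve_on euclidean {chart0} a b \<gamma> \<longleftrightarrow> continuous_on {a..b} \<gamma> \<and>
    (\<exists>D. continuous_on {a..b} D \<and> (\<forall>t\<in>{a..b}. (\<gamma> has_vector_derivative D t) (at t within {a..b})))"
proof -
  have "{t. a \<le> t \<and> t \<le> b} = {a..b}" by auto
  then show ?thesis by (simp add: C1_curve_on_def)
qed

lemma continuous_on_cofr:
  assumes "continuous_on S f" "continuous_on S g"
  shows "continuous_on S (\<lambda>t. cofr (f t) (g t))"
  unfolding cofr_def Let_def
proof (rule continuous_on_vec_lambda)
  fix i :: 7
  consider "i = 1" | "i \<noteq> 1" "i = 2" | "i \<noteq> 1" "i \<noteq> 2" "i = 3" | "i \<noteq> 1" "i \<noteq> 2" "i \<noteq> 3" "i = 4"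
    | "i \<noteq> 1" "i \<noteq> 2" "i \<noteq> 3" "i \<noteq> 4" "i = 5" | "i \<noteq> 1" "i \<noteq> 2" "i \<noteq> 3" "i \<noteq> 4" "i \<noteq> 5" "i = 6"
    | "i \<noteq> 1" "i \<noteq> 2" "i \<noteq> 3" "i \<noteq> 4" "i \<noteq> 5" "i \<noteq> 6" by blast
  then show "continuous_on S (\<lambda>t. if i = 1 then g t $ 1 else if i = 2 then cosh (f t $ 1) * g t $ 2
      else if i = 3 then cosh (f t $ 1) * g t $ 3
      else if i = 4 then cosh (f t $ 1 / 2) * exp (f t $ 2) * g t $ 4
        - sinh (f t $ 1 / 2) * (exp (- f t $ 3) * g t $ 7 - exp (f t $ 3) * g t $ 6)
      else if i = 5 then cosh (f t $ 1 / 2) * exp (- f t $ 2) * g t $ 5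
        + sinh (f t $ 1 / 2) * (exp (f t $ 3) * g t $ 6 + exp (- f t $ 3) * g t $ 7)
      else if i = 6 then cosh (f t $ 1 / 2) * (exp (f t $ 3) * g t $ 6 + exp (- f t $ 3) * g t $ 7)
        + sinh (f t $ 1 / 2) * exp (- f t $ 2) * g t $ 5
      else cosh (f t $ 1 / 2) * (exp (- f t $ 3) * g t $ 7 - exp (f t $ 3) * g t $ 6)
        - sinh (f t $ 1 / 2) * exp (f t $ 2) * g t $ 4)"
    by cases (simp, intro continuous_intros assms; simp)+
qed

text \<open>Displacement is the integral of the velocity, and the pointwise bound compares it with
  the speed. Keeping \<open>P\<close> and \<open>m\<close> general covers two uses:
  \<open>base\<close> with constant 1, and the identity with the constant of
  \<open>norm_cofr_ge\<close>.\<close>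

lemma segment_length:
  fixes P :: "vec7 \<Rightarrow> vec7"
  assumes C1: "C1_curve_on euclidean {chart0} a b \<gamma>" and "a \<le> b" and m: "0 \<le> m" and P: "bounded_linear P"
    and le: "\<And>t v. t \<in> {a..b} \<Longrightarrow> m * norm (P v) \<le> norm (cofr (\<gamma> t) v)"
  shows "spd \<gamma> integrable_on {a..b}" "m * norm (P (\<gamma> b - \<gamma> a)) \<le> integral {a..b} (spd \<gamma>)"
proof -
  obtain D where \<gamma>: "continuous_on {a..b} \<gamma>" and D: "continuous_on {a..b} D"
    and deriv: "\<And>t. t \<in> {a..b} \<Longrightarrow> (\<gamma> has_vector_derivative D t) (at t within {a..b})"
    using C1 unfolding C1_curve_on_iff by blast
  let ?g = "\<lambda>t. norm (cofr (\<gamma> t) (D t))"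
  have g: "?g integrable_on {a..b}"
    by (intro integrable_continuous_real continuous_on_norm continuous_on_cofr \<gamma> D)
  \<comment> \<open>The speed uses the two-sided derivative, which agrees with the one-sided
    \<open>D t\<close> in the interior; the endpoints do not affect the integral.\<close>
  have eq: "spd \<gamma> t = ?g t" if "t \<in> {a..b} - {a, b}" for t
  proof -
    have "at t within {a..b} = at t" using that by (intro at_within_interior) auto
    then have "(\<gamma> has_vector_derivative D t) (at t)" using deriv[of t] that by auto
    then show ?thesis by (simp add: speed_phi vector_derivative_at)
  qed
  show "spd \<gamma> integrable_on {a..b}"
    by (rule integrable_spike_finite[OF _ _ g, of "{a, b}"]) (simp_all add: eq)
  have int: "integral {a..b} (spd \<gamma>) = integral {a..b} ?g"
    by (rule integral_spike[of "{a, b}"]) (simp_all add: eq negligible_insert)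
  have "(D has_integral (\<gamma> b - \<gamma> a)) {a..b}"
    by (rule fundamental_theorem_of_calculus[OF \<open>a \<le> b\<close>]) (rule deriv)
  from has_integral_linear[OF this P]
  have "((\<lambda>t. P (D t)) has_integral P (\<gamma> b - \<gamma> a)) {a..b}" by (simp add: o_def)
  then have P': "((\<lambda>t. m *\<^sub>R P (D t)) has_integral m *\<^sub>R P (\<gamma> b - \<gamma> a)) {a..b}"
    by (rule has_integral_cmul)
  have "norm (integral {a..b} (\<lambda>t. m *\<^sub>R P (D t))) \<le> integral {a..b} ?g"
  proof (rule Henstock_Kurzweil_Integration.integral_norm_bound_integral)
    show "(\<lambda>t. m *\<^sub>R P (D t)) integrable_on {a..b}" using P' by (rule has_integral_integrable)
  qed (use g le m in auto)
  then show "m * norm (P (\<gamma> b - \<gamma> a)) \<le> integral {a..b} (spd \<gamma>)"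
    using m unfolding integral_unique[OF P'] int by simp
qed

lemma C1_curve_on_subset:
  assumes "C1_curve_on euclidean {chart0} a b \<gamma>" "r \<le> b"
  shows "C1_curve_on euclidean {chart0} a r \<gamma>"
proof -
  have "{a..r} \<subseteq> {a..b}" using assms(2) by auto
  then show ?thesis using assms(1) unfolding C1_curve_on_iff
    by (meson continuous_on_subset has_vector_derivative_within_subset subsetD)
qed

text \<open>Initial segments are covered so that the base displacement can be bounded at every
  intermediate time. Integrability is carried along because \<open>integral\<close> takes the
  default value 0 on non-integrable functions.\<close>

lemma curve_length_ge:
  fixes P :: "vec7 \<Rightarrow> vec7"
  assumes \<gamma>: "piecewise_C1_curve euclidean {chart0} \<gamma>" and r: "0 \<le> r" "r \<le> 1"
    and m: "0 \<le> m" and P: "bounded_linear P"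
    and le: "\<And>t v. t \<in> {0..r} \<Longrightarrow> m * norm (P v) \<le> norm (cofr (\<gamma> t) v)"
  shows "spd \<gamma> integrable_on {0..r} \<and> m * norm (P (\<gamma> r - \<gamma> 0)) \<le> integral {0..r} (spd \<gamma>)"
proof -
  obtain n t where t: "t 0 = 0" "t n = (1::real)"
    and C1: "\<And>i. i < n \<Longrightarrow> t i < t (Suc i) \<and> C1_curve_on euclidean {chart0} (t i) (t (Suc i)) \<gamma>"
    using \<gamma> unfolding piecewise_C1_curve_def by auto
  have t0: "0 \<le> t k" if "k \<le> n" for k
    using that
  proof (induction k)
    case (Suc k)
    then show ?case using C1[of k] by simp
  qed (simp add: t)
  have "\<forall>s. 0 \<le> s \<and> s \<le> t k \<and> s \<le> r \<longrightarrow>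
      spd \<gamma> integrable_on {0..s} \<and> m * norm (P (\<gamma> s - \<gamma> 0)) \<le> integral {0..s} (spd \<gamma>)" if "k \<le> n" for k
    using that
  proof (induction k)
    case 0
    have "spd \<gamma> integrable_on {0}" using integrable_on_refl[of "spd \<gamma>" 0] by simp
    moreover have "P 0 = 0" using P by (rule linear_simps(3))
    ultimately have "spd \<gamma> integrable_on {0..0} \<and> m * norm (P (\<gamma> 0 - \<gamma> 0)) \<le> integral {0..0} (spd \<gamma>)"
      by simp
    then show ?case using t by (metis order_antisym)
  next
    case (Suc k)
    show ?case
    proof (intro allI impI)
      fix s assume s: "0 \<le> s \<and> s \<le> t (Suc k) \<and> s \<le> r"
      show "spd \<gamma> integrable_on {0..s} \<and> m * norm (P (\<gamma> s - \<gamma> 0)) \<le> integral {0..s} (spd \<gamma>)"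
      proof (cases "s \<le> t k")
        case False
        have IH: "spd \<gamma> integrable_on {0..t k}" "m * norm (P (\<gamma> (t k) - \<gamma> 0)) \<le> integral {0..t k} (spd \<gamma>)"
          using Suc t0[of k] s False by auto
        have "C1_curve_on euclidean {chart0} (t k) s \<gamma>"
          by (rule C1_curve_on_subset[of _ "t (Suc k)"]) (use C1[of k] Suc.prems s in auto)
        from segment_length[OF this _ m P] le s False t0[of k] Suc.prems
        have seg: "spd \<gamma> integrable_on {t k..s}" "m * norm (P (\<gamma> s - \<gamma> (t k))) \<le> integral {t k..s} (spd \<gamma>)"
          by auto
        have int: "spd \<gamma> integrable_on {0..s}"
          using Henstock_Kurzweil_Integration.integrable_combine[OF _ _ IH(1) seg(1)] t0[of k] Suc.prems False by auto
        have "P (\<gamma> s - \<gamma> 0) = P (\<gamma> (t k) - \<gamma> 0) + P (\<gamma> s - \<gamma> (t k))"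
          by (simp flip: linear_simps(1)[OF P])
        then have "m * norm (P (\<gamma> s - \<gamma> 0)) \<le> m * norm (P (\<gamma> (t k) - \<gamma> 0)) + m * norm (P (\<gamma> s - \<gamma> (t k)))"
          using m by (metis distrib_left mult_left_mono norm_triangle_ineq)
        also have "\<dots> \<le> integral {0..t k} (spd \<gamma>) + integral {t k..s} (spd \<gamma>)"
          using IH seg by simp
        also have "\<dots> = integral {0..s} (spd \<gamma>)"
          using Henstock_Kurzweil_Integration.integral_combine[OF _ _ int, of "t k"] t0[of k] Suc.prems False by auto
        finally show ?thesis using int by simp
      qed (use Suc s in auto)
    qed
  qed
  from this[of n] show ?thesis using r t by auto
qed

definition base :: "vec7 \<Rightarrow> vec7" where "base v = (\<chi> i. if i = 1 \<or> i = 2 \<or> i = 3 then v $ i else 0)"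

lemma base_nth: "base v $ i = (if i = 1 \<or> i = 2 \<or> i = 3 then v $ i else 0)"
  by (simp add: base_def)

lemma bounded_linear_base: "bounded_linear base"
  by (rule linear_conv_bounded_linear[THEN iffD1], rule linearI)
     (auto simp: Finite_Cartesian_Product.vec_eq_iff base_nth)

lemma norm_base_le: "norm (base v) \<le> norm (cofr x v)"
proof -
  have 1: "(v $ i)\<^sup>2 \<le> (cosh (x$1) * v $ i)\<^sup>2" for i
    using mult_right_mono[of 1 "(cosh (x$1))\<^sup>2" "(v $ i)\<^sup>2"] cosh_real_ge_1[of "x$1"]
    by (simp add: power_mult_distrib)
  have "base v \<bullet> base v \<le> cofr x v \<bullet> cofr x v"
    using 1[of 2] 1[of 3] unfolding inner_7 by (simp add: base_nth cofr_nth(1-3) flip: power2_eq_square)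
      (smt (verit) zero_le_power2)
  then show ?thesis by (simp add: norm_eq_sqrt_inner)
qed

lemma cofr_base: "cofr x = cofr (base x)"
  by (simp add: fun_eq_iff Finite_Cartesian_Product.vec_eq_iff forall_7 cofr_nth base_nth)

text \<open>The minimum over a closed ball and the unit sphere is positive because the coframe is
  injective. By \<open>cofr_base\<close> the coframe is constant along fibres, so the bound holds
  over the whole noncompact preimage of the ball.\<close>

lemma norm_cofr_ge:
  assumes "0 \<le> R"
  obtains m where "m > 0" "\<And>x v. norm (base x) \<le> R \<Longrightarrow> m * norm v \<le> norm (cofr x v)"
proof -
  let ?K = "cball (0::vec7) R \<times> sphere (0::vec7) 1"
  let ?f = "\<lambda>p. norm (cofr (fst p) (snd p))"
  have "compact ?K" by (intro compact_Times) auto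
  moreover have "(0, ax 1) \<in> ?K" using assms by simp
  moreover have "continuous_on ?K ?f"
    by (intro continuous_on_norm continuous_on_cofr continuous_on_fst continuous_on_snd continuous_on_id)
  ultimately obtain p where p: "p \<in> ?K" "\<And>q. q \<in> ?K \<Longrightarrow> ?f p \<le> ?f q"
    using continuous_attains_inf[of ?K ?f] by blast
  have "snd p \<noteq> 0" using p(1) by (auto simp: mem_Times_iff)
  then have pos: "?f p > 0" using cofr_eq_0 by (metis zero_less_norm_iff)
  have "?f p * norm v \<le> norm (cofr x v)" if "norm (base x) \<le> R" for x v
  proof (cases "v = 0")
    case False
    have "(base x, v /\<^sub>R norm v) \<in> ?K" using that False by simp
    from p(2)[OF this] have "?f p \<le> norm (cofr x (v /\<^sub>R norm v))" by (simp add: cofr_base[of x])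
    also have "\<dots> = norm (cofr x v) / norm v"
      by (simp add: linear_cmul[OF linear_cofr] divide_inverse mult.commute)
    finally show ?thesis using False by (simp add: field_simps)
  qed simp
  then show ?thesis using that pos by blast
qed

lemma norm_cofr_le:
  obtains M where "M > 0" "\<And>x v. x \<in> cball p 1 \<Longrightarrow> norm (cofr x v) \<le> M * norm v"
proof -
  let ?K = "cball (p::vec7) 1 \<times> sphere (0::vec7) 1"
  let ?f = "\<lambda>p. norm (cofr (fst p) (snd p))"
  have "compact ?K" by (intro compact_Times) auto
  moreover have "(p, ax 1) \<in> ?K" by simp
  moreover have "continuous_on ?K ?f"
    by (intro continuous_on_norm continuous_on_cofr continuous_on_fst continuous_on_snd continuous_on_id)
  ultimately obtain z where z: "\<And>q. q \<in> ?K \<Longrightarrow> ?f q \<le> ?f z"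
    using continuous_attains_sup[of ?K ?f] by blast
  have "norm (cofr x v) \<le> (?f z + 1) * norm v" if "x \<in> cball p 1" for x v
  proof (cases "v = 0")
    case False
    have "(x, v /\<^sub>R norm v) \<in> ?K" using that False by simp
    from z[OF this] have "norm (cofr x (v /\<^sub>R norm v)) \<le> ?f z" by simp
    also have "norm (cofr x (v /\<^sub>R norm v)) = norm (cofr x v) / norm v"
      by (simp add: linear_cmul[OF linear_cofr] divide_inverse mult.commute)
    finally have "norm (cofr x v) \<le> ?f z * norm v" using False by (simp add: pos_divide_le_eq)
    also have "\<dots> \<le> (?f z + 1) * norm v" by (intro mult_right_mono) auto
    finally show ?thesis .
  qed (simp add: linear_0[OF linear_cofr])
  moreover have "?f z + 1 > 0" by (simp add: add_nonneg_pos)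
  ultimately show ?thesis using that by blast
qed

lemma line_curve:
  fixes p q :: vec7
  defines "\<gamma> \<equiv> \<lambda>t. p + t *\<^sub>R (q - p)"
  shows "piecewise_C1_curve euclidean {chart0} \<gamma>" "vector_derivative \<gamma> (at t) = q - p"
proof -
  have d: "(\<gamma> has_vector_derivative (q - p)) (at t within S)" for t S
    unfolding \<gamma>_def by (auto intro!: derivative_eq_intros)
  then show "vector_derivative \<gamma> (at t) = q - p" by (rule vector_derivative_at)
  have "C1_curve_on euclidean {chart0} 0 1 \<gamma>"
    unfolding C1_curve_on_iff using d
    by (auto simp: \<gamma>_def intro!: continuous_intros exI[of _ "\<lambda>_. q - p"])
  then show "piecewise_C1_curve euclidean {chart0} \<gamma>"
    unfolding piecewise_C1_curve_def by (intro exI[of _ 1] exI[of _ real]) auto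
qed

section \<open>Comparison of the Riemannian and the Euclidean distance\<close>

abbreviation rdist :: "vec7 \<Rightarrow> vec7 \<Rightarrow> real" where
  "rdist \<equiv> riem_dist euclidean {chart0} (global_form phi)"

abbreviation lengths :: "vec7 \<Rightarrow> vec7 \<Rightarrow> real set" where
  "lengths p q \<equiv> {curve_length {chart0} (global_form phi) \<gamma> | \<gamma>. piecewise_C1_curve euclidean {chart0} \<gamma> \<and> \<gamma> 0 = p \<and> \<gamma> 1 = q}"

lemma curve_length_base:
  assumes "piecewise_C1_curve euclidean {chart0} \<gamma>" "0 \<le> r" "r \<le> 1"
  shows "norm (base (\<gamma> r - \<gamma> 0)) \<le> curve_length {chart0} (global_form phi) \<gamma>"
proof -
  have *: "spd \<gamma> integrable_on {0..s} \<and> 1 * norm (base (\<gamma> s - \<gamma> 0)) \<le> integral {0..s} (spd \<gamma>)"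
    if "0 \<le> s" "s \<le> 1" for s
    by (rule curve_length_ge[OF assms(1) that _ bounded_linear_base]) (simp_all add: norm_base_le)
  have "integral {0..r} (spd \<gamma>) \<le> integral {0..1} (spd \<gamma>)"
    using *[of r] *[of 1] assms by (intro integral_subset_le) (auto simp: speed_phi)
  then show ?thesis using *[OF assms(2,3)] by (simp add: curve_length_phi)
qed

lemma lengths_nonempty: "lengths p q \<noteq> {}"
  using line_curve(1)[of p q] by fastforce

lemma base_le_rdist: "norm (base (q - p)) \<le> rdist p q"
  unfolding riem_dist_def
proof (rule cInf_greatest[OF lengths_nonempty])
  fix l assume "l \<in> lengths p q"
  then show "norm (base (q - p)) \<le> l" using curve_length_base[of _ 1] by auto
qed

lemma rdist_lessD:
  assumes "rdist p q < d"
  obtains \<gamma> where "piecewise_C1_curve euclidean {chart0} \<gamma>" "\<gamma> 0 = p" "\<gamma> 1 = q"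
    "curve_length {chart0} (global_form phi) \<gamma> < d"
  using cInf_lessD[OF lengths_nonempty, of p q d] assms that unfolding riem_dist_def by blast

lemma rdist_le:
  assumes "q \<in> cball p 1" and M: "\<And>x v. x \<in> cball p 1 \<Longrightarrow> norm (cofr x v) \<le> M * norm v"
  shows "rdist q p \<le> M * norm (p - q)"
proof -
  let ?\<gamma> = "\<lambda>t. q + t *\<^sub>R (p - q)"
  have c: "piecewise_C1_curve euclidean {chart0} ?\<gamma>" by (rule line_curve)
  have int: "spd ?\<gamma> integrable_on {0..1}"
    using curve_length_ge[OF c _ _ _ bounded_linear_base, of 1 1] by (simp add: norm_base_le)
  have "curve_length {chart0} (global_form phi) ?\<gamma> \<le> integral {0..1} (\<lambda>t::real. M * norm (p - q))"
    unfolding curve_length_phi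
  proof (rule integral_le[OF int])
    fix t :: real assume t: "t \<in> {0..1}"
    have "p - ?\<gamma> t = (1 - t) *\<^sub>R (p - q)" by (simp add: algebra_simps)
    then have "norm (p - ?\<gamma> t) \<le> 1 * norm (p - q)"
      using t by (simp only: norm_scaleR) (intro mult_right_mono, auto)
    then have "?\<gamma> t \<in> cball p 1" using assms(1) by (simp add: dist_norm)
    then show "spd ?\<gamma> t \<le> M * norm (p - q)" unfolding speed_phi line_curve(2) by (rule M)
  qed auto
  also have "\<dots> = M * norm (p - q)" by simp
  finally have le: "curve_length {chart0} (global_form phi) ?\<gamma> \<le> M * norm (p - q)" .
  have "rdist q p \<le> curve_length {chart0} (global_form phi) ?\<gamma>"
    unfolding riem_dist_def
  proof (rule cInf_lower)
    show "curve_length {chart0} (global_form phi) ?\<gamma> \<in> lengths q p" using c by fastforce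
    \<comment> \<open>The instance r = 0 says that lengths are nonnegative.\<close>
    show "bdd_below (lengths q p)"
      using curve_length_base[of _ 0] by (intro bdd_belowI[of _ 0]) (auto intro: order_trans[OF norm_ge_zero])
  qed
  then show ?thesis using le by simp
qed

text \<open>A Cauchy sequence and the short curves joining its terms stay over a bounded part of the
  base. There the metric dominates a fixed multiple of the Euclidean metric in all seven
  coordinates, so the sequence converges in the Euclidean sense; the local upper bound on the
  coframe carries this back to the Riemannian distance.\<close>

lemma complete_phi: "complete_metric euclidean {chart0} (global_form phi)"
  unfolding complete_metric_def
proof (intro allI impI)
  fix \<sigma> :: "nat \<Rightarrow> vec7"
  assume "range \<sigma> \<subseteq> topspace euclidean \<and> (\<forall>\<epsilon>>0. \<exists>N. \<forall>m\<ge>N. \<forall>n\<ge>N. rdist (\<sigma> m) (\<sigma> n) < \<epsilon>)"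
  then have cauchy: "\<And>\<epsilon>. \<epsilon> > 0 \<Longrightarrow> \<exists>N. \<forall>m\<ge>N. \<forall>n\<ge>N. rdist (\<sigma> m) (\<sigma> n) < \<epsilon>" by blast
  obtain N where N: "\<And>m n. m \<ge> N \<Longrightarrow> n \<ge> N \<Longrightarrow> rdist (\<sigma> m) (\<sigma> n) < 1"
    using cauchy[of 1] by auto
  \<comment> \<open>The 2 allows one unit between two terms of the sequence and one unit along a
    connecting curve.\<close>
  define R where "R = norm (base (\<sigma> N)) + 2"
  have "0 \<le> R" by (simp add: R_def)
  then obtain m where m: "m > 0" "\<And>x v. norm (base x) \<le> R \<Longrightarrow> m * norm v \<le> norm (cofr x v)"
    using norm_cofr_ge by blast
  have base_add: "base (x - y) = base x - base y" for x y
    by (simp add: Finite_Cartesian_Product.vec_eq_iff base_nth)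
  have est: "m * norm (\<sigma> j - \<sigma> i) \<le> d"
    if ij: "i \<ge> N" "j \<ge> N" and d: "d \<le> 1" "rdist (\<sigma> i) (\<sigma> j) < d" for i j d
  proof -
    obtain \<gamma> where \<gamma>: "piecewise_C1_curve euclidean {chart0} \<gamma>" "\<gamma> 0 = \<sigma> i" "\<gamma> 1 = \<sigma> j"
      "curve_length {chart0} (global_form phi) \<gamma> < d" by (rule rdist_lessD[OF d(2)])
    have "norm (base (\<gamma> t)) \<le> R" if "t \<in> {0..1}" for t
    proof -
      have "norm (base (\<gamma> t) - base (\<sigma> i)) < 1"
        using curve_length_base[OF \<gamma>(1), of t] that \<gamma> d by (simp add: base_add)
      moreover have "norm (base (\<sigma> i) - base (\<sigma> N)) < 1"
        using base_le_rdist[of "\<sigma> i" "\<sigma> N"] N[of N i] ij by (simp add: base_add)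
      moreover have "base (\<gamma> t) = (base (\<gamma> t) - base (\<sigma> i)) + (base (\<sigma> i) - base (\<sigma> N)) + base (\<sigma> N)"
        by simp
      ultimately show ?thesis unfolding R_def by (smt (verit) norm_triangle_ineq)
    qed
    then have "m * norm (\<gamma> 1 - \<gamma> 0) \<le> integral {0..1} (spd \<gamma>)"
      using curve_length_ge[OF \<gamma>(1) _ _ _ bounded_linear_ident, of 1 m] m by simp
    then show ?thesis using \<gamma> by (simp add: curve_length_phi)
  qed
  have "Cauchy \<sigma>"
    unfolding Cauchy_def
  proof (intro allI impI)
    fix e :: real assume e: "e > 0"
    define d where "d = min 1 (m * e / 2)"
    have d: "d > 0" "d \<le> 1" "d \<le> m * e / 2" using e m by (auto simp: d_def)
    obtain N' where N': "\<forall>i\<ge>N'. \<forall>j\<ge>N'. rdist (\<sigma> i) (\<sigma> j) < d" using cauchy[OF d(1)] by blast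
    have "dist (\<sigma> j) (\<sigma> i) < e" if "i \<ge> max N N'" "j \<ge> max N N'" for i j
    proof -
      have "m * norm (\<sigma> j - \<sigma> i) \<le> m * e / 2"
        using est[of i j d] that N' d by fastforce
      also have "\<dots> < m * e" using m e by simp
      finally show ?thesis using m by (simp add: dist_norm)
    qed
    then show "\<exists>M. \<forall>m\<ge>M. \<forall>n\<ge>M. dist (\<sigma> m) (\<sigma> n) < e" by blast
  qed
  then obtain p where p: "\<sigma> \<longlonglongrightarrow> p" using Cauchy_convergent convergent_def by blast
  obtain M where M: "M > 0" "\<And>x v. x \<in> cball p 1 \<Longrightarrow> norm (cofr x v) \<le> M * norm v"
    using norm_cofr_le[of p] by blast
  have "(\<lambda>n. rdist (\<sigma> n) p) \<longlonglongrightarrow> 0"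
  proof (rule tendsto_sandwich[of "\<lambda>_. 0" _ _ "\<lambda>n. M * norm (p - \<sigma> n)"])
    show "\<forall>\<^sub>F n in sequentially. 0 \<le> rdist (\<sigma> n) p"
      by (intro always_eventually allI order_trans[OF norm_ge_zero base_le_rdist])
    have "\<forall>\<^sub>F n in sequentially. dist (\<sigma> n) p < 1" using tendstoD[OF p, of 1] by simp
    then show "\<forall>\<^sub>F n in sequentially. rdist (\<sigma> n) p \<le> M * norm (p - \<sigma> n)"
      by eventually_elim (rule rdist_le[OF _ M(2)], auto simp: dist_commute)
    have "(\<lambda>n. M * norm (p - \<sigma> n)) \<longlonglongrightarrow> M * norm (p - p)"
      by (intro tendsto_intros p)
    then show "(\<lambda>n. M * norm (p - \<sigma> n)) \<longlonglongrightarrow> 0" by simp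
  qed simp
  then show "\<exists>p\<in>topspace euclidean. (\<lambda>n. rdist (\<sigma> n) p) \<longlonglongrightarrow> 0" by auto
qed

subsection \<open>Naturality of the exterior derivative\<close>

lemma DERIV_along_line:
  fixes f :: "'a::real_normed_vector \<Rightarrow> real"
  assumes "(f has_derivative f') (at (p + s *\<^sub>R v))"
  shows "((\<lambda>s. f (p + s *\<^sub>R v)) has_real_derivative f' v) (at s)"
proof -
  have "((\<lambda>s. p + s *\<^sub>R v) has_derivative (\<lambda>r. r *\<^sub>R v)) (at s)"
    by (auto intro!: derivative_eq_intros)
  from has_derivative_compose[OF this assms]
  have "((\<lambda>s. f (p + s *\<^sub>R v)) has_derivative (\<lambda>r. f' (r *\<^sub>R v))) (at s)" .
  moreover have "f' (r *\<^sub>R v) = f' v * r" for r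
    using linear_cmul[OF has_derivative_linear[OF assms]] by (simp add: mult.commute)
  ultimately show ?thesis by (simp add: has_field_derivative_def)
qed

lemma second_difference:
  fixes f :: "'a::real_normed_vector \<Rightarrow> real"
  assumes f: "\<And>y. (f has_derivative f' y) (at y)" and A: "\<And>y. ((\<lambda>y. f' y v) has_derivative A y) (at y)"
    and "0 < e"
  obtains s r where "0 < s" "s < e" "0 < r" "r < e"
    "f (x + e *\<^sub>R v + e *\<^sub>R w) - f (x + e *\<^sub>R v) - f (x + e *\<^sub>R w) + f x = e * (e * A (x + s *\<^sub>R v + r *\<^sub>R w) w)"
proof -
  let ?g = "\<lambda>s. f ((x + e *\<^sub>R w) + s *\<^sub>R v) - f (x + s *\<^sub>R v)"
  have "(?g has_real_derivative f' ((x + e *\<^sub>R w) + s *\<^sub>R v) v - f' (x + s *\<^sub>R v) v) (at s)" for s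
    by (intro DERIV_diff DERIV_along_line f)
  from MVT2[OF \<open>0 < e\<close> this] obtain s where s: "0 < s" "s < e"
    "?g e - ?g 0 = (e - 0) * (f' ((x + e *\<^sub>R w) + s *\<^sub>R v) v - f' (x + s *\<^sub>R v) v)" by blast
  have "((\<lambda>r. f' ((x + s *\<^sub>R v) + r *\<^sub>R w) v) has_real_derivative A ((x + s *\<^sub>R v) + r *\<^sub>R w) w) (at r)" for r
    by (intro DERIV_along_line[of "\<lambda>y. f' y v"] A)
  from MVT2[OF \<open>0 < e\<close> this] obtain r where r: "0 < r" "r < e"
    "f' ((x + s *\<^sub>R v) + e *\<^sub>R w) v - f' ((x + s *\<^sub>R v) + 0 *\<^sub>R w) v = (e - 0) * A ((x + s *\<^sub>R v) + r *\<^sub>R w) w"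
    by blast
  have "f (x + e *\<^sub>R v + e *\<^sub>R w) - f (x + e *\<^sub>R v) - f (x + e *\<^sub>R w) + f x = ?g e - ?g 0"
    by (simp add: algebra_simps)
  also have "\<dots> = e * (f' ((x + s *\<^sub>R v) + e *\<^sub>R w) v - f' ((x + s *\<^sub>R v) + 0 *\<^sub>R w) v)"
    unfolding s(3) by (simp add: algebra_simps)
  also have "\<dots> = e * (e * A (x + s *\<^sub>R v + r *\<^sub>R w) w)" unfolding r(3) by simp
  finally show ?thesis using that s r by blast
qed

text \<open>The second difference is symmetric in v and w, so by \<open>second_difference\<close>
  the two mixed derivatives agree at a pair of points arbitrarily close to x; continuity at x does
  the rest.\<close>

lemma second_derivative_symmetric:
  fixes f :: "'a::real_normed_vector \<Rightarrow> real"
  assumes f: "\<And>y. (f has_derivative f' y) (at y)"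
    and A: "\<And>y. ((\<lambda>y. f' y v) has_derivative A y) (at y)" and C: "\<And>y. ((\<lambda>y. f' y w) has_derivative C y) (at y)"
    and cont: "isCont (\<lambda>y. A y w) x" "isCont (\<lambda>y. C y v) x"
  shows "A x w = C x v"
proof (rule ccontr)
  assume "A x w \<noteq> C x v"
  then have d: "\<bar>A x w - C x v\<bar> / 2 > 0" by simp
  obtain d1 where d1: "d1 > 0" "\<And>y. dist y x < d1 \<Longrightarrow> dist (A y w) (A x w) < \<bar>A x w - C x v\<bar> / 2"
    using cont(1) d unfolding continuous_at_eps_delta by metis
  obtain d2 where d2: "d2 > 0" "\<And>y. dist y x < d2 \<Longrightarrow> dist (C y v) (C x v) < \<bar>A x w - C x v\<bar> / 2"
    using cont(2) d unfolding continuous_at_eps_delta by metis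
  \<comment> \<open>This size keeps all sample points within \<open>min d1 d2\<close> of x; the
    summand 1 makes the denominator positive and the estimate strict.\<close>
  define e where "e = min d1 d2 / (norm v + norm w + 1)"
  have pos: "norm v + norm w + 1 > 0" by (smt (verit) norm_ge_zero)
  then have e: "e > 0" using d1 d2 by (simp add: e_def)
  have close: "dist (x + s *\<^sub>R v + r *\<^sub>R w) x < min d1 d2" if "0 < s" "s < e" "0 < r" "r < e" for s r
  proof -
    have "dist (x + s *\<^sub>R v + r *\<^sub>R w) x = norm (s *\<^sub>R v + r *\<^sub>R w)" by (simp add: dist_norm)
    also have "\<dots> \<le> s * norm v + r * norm w"
      using norm_triangle_ineq[of "s *\<^sub>R v" "r *\<^sub>R w"] that by simp
    also have "\<dots> \<le> e * norm v + e * norm w" using that by (intro add_mono mult_right_mono) auto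
    also have "\<dots> < e * (norm v + norm w + 1)" using e by (simp add: algebra_simps)
    also have "\<dots> = min d1 d2" using pos by (simp add: e_def)
    finally show ?thesis .
  qed
  obtain s r where sr: "0 < s" "s < e" "0 < r" "r < e"
    "f (x + e *\<^sub>R v + e *\<^sub>R w) - f (x + e *\<^sub>R v) - f (x + e *\<^sub>R w) + f x = e * (e * A (x + s *\<^sub>R v + r *\<^sub>R w) w)"
    by (rule second_difference[OF f A e])
  obtain s' r' where sr': "0 < s'" "s' < e" "0 < r'" "r' < e"
    "f (x + e *\<^sub>R w + e *\<^sub>R v) - f (x + e *\<^sub>R w) - f (x + e *\<^sub>R v) + f x = e * (e * C (x + s' *\<^sub>R w + r' *\<^sub>R v) v)"
    by (rule second_difference[OF f C e])
  have comm: "x + e *\<^sub>R w + e *\<^sub>R v = x + e *\<^sub>R v + e *\<^sub>R w" "x + s' *\<^sub>R w + r' *\<^sub>R v = x + r' *\<^sub>R v + s' *\<^sub>R w"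
    by (simp_all add: add_ac)
  have "e * (e * A (x + s *\<^sub>R v + r *\<^sub>R w) w) = e * (e * C (x + r' *\<^sub>R v + s' *\<^sub>R w) v)"
    using sr(5) sr'(5) unfolding comm by linarith
  then have "A (x + s *\<^sub>R v + r *\<^sub>R w) w = C (x + r' *\<^sub>R v + s' *\<^sub>R w) v" using e by simp
  moreover have "dist (A (x + s *\<^sub>R v + r *\<^sub>R w) w) (A x w) < \<bar>A x w - C x v\<bar> / 2"
    using close sr by (intro d1) auto
  moreover have "dist (C (x + r' *\<^sub>R v + s' *\<^sub>R w) v) (C x v) < \<bar>A x w - C x v\<bar> / 2"
    using close sr' by (intro d2) auto
  ultimately show False unfolding dist_real_def by (auto simp: abs_if split: if_splits)
qed

text \<open>This is the Leibniz rule for a multilinear expression. Expansion in the first vector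
  also removes a label, so the label list has to vary in the induction.\<close>

lemma eform_has_derivative:
  fixes us :: "('a::real_normed_vector \<Rightarrow> vec7) list"
  assumes "length us' = length us" "\<And>i. i < length us \<Longrightarrow> (us ! i has_derivative us' ! i) (at x)"
  shows "((\<lambda>y. eform is (map (\<lambda>u. u y) us)) has_derivative
    (\<lambda>w. \<Sum>k<length us. eform is ((map (\<lambda>u. u x) us)[k := (us' ! k) w]))) (at x)"
  using assms
proof (induction us arbitrary: us' "is")
  case (Cons u us)
  then obtain u' vs' where us': "us' = u' # vs'" "length vs' = length us" by (cases us') auto
  let ?n = "length us" and ?m = "\<lambda>j. take j is @ drop (Suc j) is"
  have u: "(u has_derivative u') (at x)" using Cons.prems(2)[of 0] us' by simp
  have IH: "((\<lambda>y. eform (?m j) (map (\<lambda>u. u y) us)) has_derivative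
    (\<lambda>w. \<Sum>k<?n. eform (?m j) ((map (\<lambda>u. u x) us)[k := (vs' ! k) w]))) (at x)" for j
    using Cons.prems(2)[of "Suc _"] us' by (intro Cons.IH) auto
  show ?case
  proof (cases "length is = Suc ?n")
    case False
    then have z: "eform is vs = 0" if "length vs = Suc ?n" for vs
      using that by (intro eform_eq_0) auto
    have l: "(\<lambda>y. eform is (map (\<lambda>u. u y) (u # us))) = (\<lambda>y. 0)"
      by (intro ext z) simp
    have r: "(\<lambda>w. \<Sum>k<length (u # us). eform is ((map (\<lambda>u. u x) (u # us))[k := (us' ! k) w])) = (\<lambda>w. 0)"
      by (intro ext sum.neutral ballI z) (simp split: nat.split)
    show ?thesis unfolding l r by (rule has_derivative_const)
  next
    case True
    have ui: "((\<lambda>y. u y $ i) has_derivative (\<lambda>w. u' w $ i)) (at x)" for i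
      by (rule bounded_linear.has_derivative[OF bounded_linear_vec_nth u])
    have col: "eform is (v # vs) = (\<Sum>j<length is. (-1) ^ j * v $ of_nat (is ! j) * eform (?m j) vs)"
      if "length vs = ?n" for v vs
      using that True by (intro eform_column) simp
    have "((\<lambda>y. \<Sum>j<length is. (-1) ^ j * u y $ of_nat (is ! j) * eform (?m j) (map (\<lambda>u. u y) us)) has_derivative
       (\<lambda>w. \<Sum>j<length is. (-1) ^ j * u x $ of_nat (is ! j) * (\<Sum>k<?n. eform (?m j) ((map (\<lambda>u. u x) us)[k := (vs' ! k) w]))
          + (-1) ^ j * u' w $ of_nat (is ! j) * eform (?m j) (map (\<lambda>u. u x) us))) (at x)"
      by (intro has_derivative_sum has_derivative_mult has_derivative_mult_right ui IH)
    then have "((\<lambda>y. eform is (map (\<lambda>u. u y) (u # us))) has_derivative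
       (\<lambda>w. eform is (u' w # map (\<lambda>u. u x) us) +
         (\<Sum>k<?n. eform is (u x # (map (\<lambda>u. u x) us)[k := (vs' ! k) w])))) (at x)"
      by (simp add: col sum.distrib sum_distrib_left add.commute sum.swap[of _ "{..<length is}"])
    then show ?thesis by (simp add: us' sum.lessThan_Suc_shift del: sum.lessThan_Suc)
  qed
qed simp

lemma eform_swap_args: "eform is (xs @ a # b # ys) = - eform is (xs @ b # a # ys)"
proof -
  let ?vs = "xs @ b # a # ys" and ?k = "length xs"
  let ?q = "Transposition.transpose ?k (Suc ?k)"
  have q: "?q permutes {..<length ?vs}" by (rule permutes_swap_id) auto
  show ?thesis
    unfolding swap_conv_nth_transpose[of xs a b ys] eform_permute[OF q] by (simp add: sign_swap_id)
qed

lemma eform_to_front: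
  "eform is (a # b # vs) = - eform is (b # a # vs)"
  "eform is (a # c # b # vs) = eform is (b # a # c # vs)"
  "eform is (a # c # d # b # vs) = - eform is (b # a # c # d # vs)"
  using eform_swap_args[of "is" "[]" a b vs] eform_swap_args[of "is" "[a]" c b vs] eform_swap_args[of "is" "[]" a b "c # vs"]
    eform_swap_args[of "is" "[a,c]" d b vs] eform_swap_args[of "is" "[a]" c b "d # vs"] eform_swap_args[of "is" "[]" a b "c # d # vs"]
  by simp_all

lemma list_length_5: "length vs = 5 \<Longrightarrow> \<exists>a b c d e. vs = [a, b, c, d, e]"
  by (auto simp: eval_nat_numeral length_Suc_conv)

text \<open>The terms with second derivatives cancel in pairs: the pairs \<open>(i, j)\<close> and \<open>(j, i)\<close> of
  an omitted and a differentiated argument carry opposite signs.\<close>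

lemma second_order_terms_cancel:
  assumes B: "\<And>v w. B v w = B w v" and "length vs = 5"
  shows "(\<Sum>i<length vs. (-1) ^ i * (\<Sum>k<4. eform is ((map L (take i vs @ drop (Suc i) vs))
      [k := B ((take i vs @ drop (Suc i) vs) ! k) (vs ! i)]))) = 0"
proof -
  obtain a b c d e where vs: "vs = [a, b, c, d, e]" using list_length_5[OF assms(2)] by blast
  have sym: "B b a = B a b" "B c a = B a c" "B d a = B a d" "B e a = B a e" "B c b = B b c"
    "B d b = B b d" "B e b = B b e" "B d c = B c d" "B e c = B c e" "B e d = B d e"
    by (rule B)+
  have fr: "eform is (L p # B v w # us) = - eform is (B v w # L p # us)"
    "eform is (L p # L q # B v w # us) = eform is (B v w # L p # L q # us)"
    "eform is (L p # L q # L r # B v w # us) = - eform is (B v w # L p # L q # L r # us)" for p q r v w us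
    by (rule eform_to_front)+
  show ?thesis
    unfolding vs by (simp add: sum_lessThan_numeral sym fr)
qed

text \<open>Differentiating the pulled-back form gives terms with second derivatives of h, which
  cancel, and chain-rule terms, which assemble to the exterior derivative at \<open>h x\<close>.
  Five arguments are what d of a 4-form takes.\<close>

lemma ext_deriv_pullback:
  fixes fs :: "((vec7 \<Rightarrow> real) \<times> nat list) list"
  assumes fs: "\<forall>(f, is)\<in>set fs. f differentiable (at (h x))"
    and h: "(h has_derivative L) (at x)" "L = Dh x"
    and Dh: "\<And>v. ((\<lambda>y. Dh y v) has_derivative (\<lambda>w. B v w)) (at x)"
    and B: "\<And>v w. B v w = B w v" and vs: "length vs = 5"
  shows "ext_deriv (\<lambda>y. pullback (Dh y) (lc (map (\<lambda>(f, is). (f (h y), is)) fs))) x vs =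
    ext_deriv (\<lambda>z. lc (map (\<lambda>(f, is). (f z, is)) fs)) (h x) (map L vs)"
proof -
  let ?d = "\<lambda>f. frechet_derivative f (at (h x))"
  let ?m = "\<lambda>i vs. take i vs @ drop (Suc i) vs"
  have D1: "((\<lambda>z. lc (map (\<lambda>(f, is). (f z, is)) fs) us) has_derivative
     (\<lambda>w. \<Sum>(f, is)\<leftarrow>fs. ?d f w * eform is us)) (at (h x))" for us
    using fs
  proof (induction fs)
    case (Cons z fs)
    obtain f "is" where z: "z = (f, is)" by (cases z)
    have "((\<lambda>z. f z * eform is us) has_derivative (\<lambda>w. ?d f w * eform is us)) (at (h x))"
      using Cons.prems by (intro has_derivative_mult_left) (simp add: z frechet_derivative_works[symmetric])
    then show ?case using Cons by (auto simp: z lc_Cons intro!: has_derivative_add)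
  qed simp
  have D2: "((\<lambda>y. pullback (Dh y) (lc (map (\<lambda>(f, is). (f (h y), is)) fs)) us) has_derivative
     (\<lambda>w. \<Sum>(f, is)\<leftarrow>fs. f (h x) * (\<Sum>k<length us. eform is ((map L us)[k := B (us ! k) w])) +
         ?d f (L w) * eform is (map L us))) (at x)" for us
    using fs
  proof (induction fs)
    case (Cons z fs)
    obtain f "is" where z: "z = (f, is)" by (cases z)
    have "((\<lambda>y. eform is (map (\<lambda>u. u y) (map (\<lambda>v y. Dh y v) us))) has_derivative
      (\<lambda>w. \<Sum>k<length (map (\<lambda>v y. Dh y v) us). eform is ((map (\<lambda>u. u x) (map (\<lambda>v y. Dh y v) us))
        [k := (map B us ! k) w]))) (at x)"
      by (rule eform_has_derivative) (use Dh in auto)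
    then have e: "((\<lambda>y. eform is (map (Dh y) us)) has_derivative
      (\<lambda>w. \<Sum>k<length us. eform is ((map L us)[k := B (us ! k) w]))) (at x)"
      by (simp add: o_def h(2))
    have "((\<lambda>y. f (h y)) has_derivative (\<lambda>w. ?d f (L w))) (at x)"
      using Cons.prems by (intro has_derivative_compose[OF h(1)]) (simp add: z frechet_derivative_works[symmetric])
    from has_derivative_mult[OF this e]
    show ?case using Cons by (auto simp: z pullback_def lc_Cons h(2) intro!: has_derivative_add)
  qed (simp add: pullback_def)
  have len: "length (?m i vs) = 4" if "i < length vs" for i using that vs by auto
  have "ext_deriv (\<lambda>y. pullback (Dh y) (lc (map (\<lambda>(f, is). (f (h y), is)) fs))) x vs =
    (\<Sum>i<length vs. (-1) ^ i * (\<Sum>(f, is)\<leftarrow>fs. f (h x) * (\<Sum>k<4. eform is ((map L (?m i vs))[k := B (?m i vs ! k) (vs ! i)])) +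
         ?d f (L (vs ! i)) * eform is (map L (?m i vs))))"
    unfolding ext_deriv_def frechet_derivative_at[OF D2, symmetric]
    by (rule sum.cong[OF refl]) (simp only: len lessThan_iff)
  also have "\<dots> = (\<Sum>(f, is)\<leftarrow>fs. f (h x) * (\<Sum>i<length vs. (-1) ^ i * (\<Sum>k<4. eform is ((map L (?m i vs))[k := B (?m i vs ! k) (vs ! i)]))) +
      (\<Sum>i<length vs. (-1) ^ i * (?d f (L (vs ! i)) * eform is (map L (?m i vs)))))"
    by (induction fs) (auto simp: sum.distrib distrib_left sum_distrib_left mult.left_commute split: prod.splits)
  also have "\<dots> = (\<Sum>(f, is)\<leftarrow>fs. (\<Sum>i<length vs. (-1) ^ i * (?d f (L (vs ! i)) * eform is (map L (?m i vs)))))"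
    using second_order_terms_cancel[where B = B and L = L, OF B vs] by (simp only: mult_zero_right add_0_left)
  also have "\<dots> = (\<Sum>i<length vs. (-1) ^ i * (\<Sum>(f, is)\<leftarrow>fs. ?d f (L (vs ! i)) * eform is (map L (?m i vs))))"
    by (induction fs) (auto simp: sum.distrib distrib_left split: prod.splits)
  also have "\<dots> = ext_deriv (\<lambda>z. lc (map (\<lambda>(f, is). (f z, is)) fs)) (h x) (map L vs)"
    unfolding ext_deriv_def frechet_derivative_at[OF D1, symmetric]
    by (intro sum.cong) (simp_all add: take_map drop_map)
  finally show ?thesis .
qed

subsection \<open>The invariant five-form\<close>

text \<open>The product of e^123 with a 2-form on the fibre. Its coefficients stay free so that the
  linear algebra involves them only through their Pfaffian.\<close>

definition chi_list :: "real \<Rightarrow> real \<Rightarrow> real \<Rightarrow> real \<Rightarrow> real \<Rightarrow> real \<Rightarrow> lcomb" where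
  "chi_list g45 g46 g47 g56 g57 g67 = [(g45, [1,2,3,4,5]), (g46, [1,2,3,4,6]), (g47, [1,2,3,4,7]),
    (g56, [1,2,3,5,6]), (g57, [1,2,3,5,7]), (g67, [1,2,3,6,7])]"

text \<open>This is vol_B \<and> 3F, with vol_B = T^2 e^123.\<close>

definition chi :: "vec7 \<Rightarrow> covector" where
  "chi x = lc (at_point (\<lambda>T S P P' Q Q'. chi_list (T * T * (3 * S)) (T * T * (3 * T * P * Q))
     (T * T * (3 * T * P * Q')) (T * T * (- 3 * T * P' * Q)) (T * T * (3 * T * P' * Q')) (T * T * (6 * S))) x)"

lemma derivs_psi_chi:
  assumes T: "T * T - S * S = 1"
  shows "lc (derivs psi_data T S P P' Q Q') = lc (chi_list (T * T * (3 * S)) (T * T * (3 * T * P * Q))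
     (T * T * (3 * T * P * Q')) (T * T * (- 3 * T * P' * Q)) (T * T * (3 * T * P' * Q')) (T * T * (6 * S)))"
proof -
  have reduce: "S * S = T * T - 1" "S * (S * x) = T * (T * x) - x" for x
    using T by (simp_all flip: mult.assoc) (simp_all add: algebra_simps)
  show ?thesis
    apply (rule lc_eqI)
    apply (simp add: derivs_def psi_data_def chi_list_def)
    apply (simp add: algebra_simps reduce)
    done
qed

lemma ext_deriv_psi_chi: "ext_deriv psi x = chi x"
  using ext_deriv_data[OF has_grad_data(2), of x] derivs_psi_chi[OF cosh_sinh_exp_relations(1), of "x$1"]
  by (simp add: data_values_eq psi_def[abs_def] chi_def at_point_def)

lemma one_form_wedge_chi_list:
  "lc (lc_wedge [(c1,[1]), (c2,[2]), (c3,[3]), (c4,[4]), (c5,[5]), (c6,[6]), (c7,[7])]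
      (chi_list g45 g46 g47 g56 g57 g67)) =
    lc [(- (c4 * g56 - c5 * g46 + c6 * g45), [1,2,3,4,5,6]), (- (c4 * g57 - c5 * g47 + c7 * g45), [1,2,3,4,5,7]),
      (- (c4 * g67 - c6 * g47 + c7 * g46), [1,2,3,4,6,7]), (- (c5 * g67 - c6 * g57 + c7 * g56), [1,2,3,5,6,7])]"
  by (rule lc_eqI) (simp add: chi_list_def lc_wedge_simps algebra_simps)

lemma eform_axis:
  assumes "\<forall>j\<in>set is. of_nat j \<noteq> i"
  shows "eform is (ax i # vs) = 0" "of_nat a = i \<Longrightarrow> eform (a # is) (ax i # vs) = eform is vs"
proof -
  have z: "ax i $ of_nat (is ! j) = 0" if "j < length is" for j
    using assms that by (auto simp: axis_nth)
  show "eform is (ax i # vs) = 0"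
  proof (cases "length is = Suc (length vs)")
    case True
    show ?thesis unfolding eform_column[OF True] using z by (intro sum.neutral) auto
  qed (simp add: eform_eq_0)
  show "eform (a # is) (ax i # vs) = eform is vs" if a: "of_nat a = i"
  proof (cases "length is = length vs")
    case True
    then have "eform (a # is) (ax i # vs) = (\<Sum>j<Suc (length is). (-1) ^ j * ax i $ of_nat ((a # is) ! j) *
        eform (take j (a # is) @ drop (Suc j) (a # is)) vs)"
      by (subst eform_column) simp_all
    also have "\<dots> = ax i $ of_nat a * eform is vs + (\<Sum>j<length is. 0)"
      unfolding sum.lessThan_Suc_shift using z by (intro arg_cong2[where f = "(+)"] sum.cong) simp_all
    also have "\<dots> = eform is vs" using a by (simp add: axis_nth)
    finally show ?thesis .
  qed (simp add: eform_eq_0)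
qed

text \<open>A 2-form on \<real>^4 with nonzero Pfaffian is nondegenerate, so multiplying 1-forms of
  the fibre by it is injective. The combinations in the proof invert this map up to the factor
  Pfaffian.\<close>

lemma one_form_wedge_chi_list_0:
  assumes "wedge 1 5 (lc [(c1,[1]), (c2,[2]), (c3,[3]), (c4,[4]), (c5,[5]), (c6,[6]), (c7,[7])])
      (lc (chi_list g45 g46 g47 g56 g57 g67)) = (\<lambda>_. 0)"
    and Pf: "g45 * g67 - g46 * g57 + g47 * g56 \<noteq> 0"
  shows "c4 = 0" "c5 = 0" "c6 = 0" "c7 = 0"
proof -
  have "wedge 1 5 (lc [(c1,[1]), (c2,[2]), (c3,[3]), (c4,[4]), (c5,[5]), (c6,[6]), (c7,[7])])
      (lc (chi_list g45 g46 g47 g56 g57 g67)) = lc (lc_wedge [(c1,[1]), (c2,[2]), (c3,[3]), (c4,[4]), (c5,[5]), (c6,[6]), (c7,[7])]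
      (chi_list g45 g46 g47 g56 g57 g67))"
    by (rule wedge_lc) (simp_all add: chi_list_def)
  then have z: "lc [(- (c4 * g56 - c5 * g46 + c6 * g45), [1,2,3,4,5,6]), (- (c4 * g57 - c5 * g47 + c7 * g45), [1,2,3,4,5,7]),
      (- (c4 * g67 - c6 * g47 + c7 * g46), [1,2,3,4,6,7]), (- (c5 * g67 - c6 * g57 + c7 * g56), [1,2,3,5,6,7])] vs = 0" for vs
    using assms(1) unfolding one_form_wedge_chi_list by metis
  have k1: "c4 * g56 - c5 * g46 + c6 * g45 = 0"
    using z[of "[ax 1, ax 2, ax 3, ax 4, ax 5, ax 6]"] by (simp add: lc_Cons eform_axis) (simp add: eform_columns axis_nth eform_Nil)
  have k2: "c4 * g57 - c5 * g47 + c7 * g45 = 0"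
    using z[of "[ax 1, ax 2, ax 3, ax 4, ax 5, ax 7]"] by (simp add: lc_Cons eform_axis) (simp add: eform_columns axis_nth eform_Nil)
  have k3: "c4 * g67 - c6 * g47 + c7 * g46 = 0"
    using z[of "[ax 1, ax 2, ax 3, ax 4, ax 6, ax 7]"] by (simp add: lc_Cons eform_axis) (simp add: eform_columns axis_nth eform_Nil)
  have k4: "c5 * g67 - c6 * g57 + c7 * g56 = 0"
    using z[of "[ax 1, ax 2, ax 3, ax 5, ax 6, ax 7]"] by (simp add: lc_Cons eform_axis) (simp add: eform_columns axis_nth eform_Nil)
  let ?p = "g45 * g67 - g46 * g57 + g47 * g56"
  have "c4 * ?p = g45 * (c4 * g67 - c6 * g47 + c7 * g46) + g47 * (c4 * g56 - c5 * g46 + c6 * g45)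
      - g46 * (c4 * g57 - c5 * g47 + c7 * g45)"
    "c5 * ?p = g45 * (c5 * g67 - c6 * g57 + c7 * g56) + g57 * (c4 * g56 - c5 * g46 + c6 * g45)
      - g56 * (c4 * g57 - c5 * g47 + c7 * g45)"
    "c6 * ?p = g67 * (c4 * g56 - c5 * g46 + c6 * g45) - g56 * (c4 * g67 - c6 * g47 + c7 * g46)
      + g46 * (c5 * g67 - c6 * g57 + c7 * g56)"
    "c7 * ?p = g67 * (c4 * g57 - c5 * g47 + c7 * g45) - g57 * (c4 * g67 - c6 * g47 + c7 * g46)
      + g47 * (c5 * g67 - c6 * g57 + c7 * g56)"
    by (simp_all add: algebra_simps)
  then show "c4 = 0" "c5 = 0" "c6 = 0" "c7 = 0"
    unfolding k1 k2 k3 k4 using Pf by auto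
qed

lemma linear_expand:
  fixes f :: "vec7 \<Rightarrow> real"
  assumes "linear f"
  shows "f v = v$1 * f (ax 1) + v$2 * f (ax 2) + v$3 * f (ax 3) + v$4 * f (ax 4) + v$5 * f (ax 5)
    + v$6 * f (ax 6) + v$7 * f (ax 7)"
proof -
  have "f v = f (\<Sum>i\<in>UNIV. v $ i *\<^sub>R ax i)"
    using basis_expansion[of v] by (simp add: scalar_mult_eq_scaleR)
  also have "\<dots> = (\<Sum>i\<in>UNIV. v $ i * f (ax i))"
    by (simp add: linear_sum[OF assms] linear_cmul[OF assms])
  finally show ?thesis by (simp add: sum_7)
qed

text \<open>The three base 1-forms have zero product with \<open>chi z\<close>, so their pullbacks
  by L have zero product with \<open>chi x\<close>. Nondegeneracy of F on the fibre leaves these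
  pullbacks no fibre component, hence they vanish on vertical vectors.\<close>

lemma vertical_chi:
  assumes L: "linear L" and chi: "chi x = pullback L (chi z)" and v: "base v = 0"
  shows "base (L v) = 0"
proof -
  have "L v $ of_nat a = 0" if a: "a = 1 \<or> a = 2 \<or> a = 3" for a
  proof -
    let ?f = "\<lambda>v. L v $ of_nat a"
    have f: "linear ?f"
      using L by (auto simp: linear_iff)
    let ?\<alpha> = "[(?f (ax 1),[1]), (?f (ax 2),[2]), (?f (ax 3),[3]), (?f (ax 4),[4]), (?f (ax 5),[5]), (?f (ax 6),[6]), (?f (ax 7),[7])]"
    have "pullback L (eform [a]) vs = lc ?\<alpha> vs" for vs
    proof (cases "length vs = 1")
      case True
      then obtain u where "vs = [u]" by (metis One_nat_def length_0_conv length_Suc_conv)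
      then show ?thesis using linear_expand[OF f, of u]
        by (simp add: pullback_def lc_Cons eform_column1 eform_Nil mult.commute)
    qed (simp add: pullback_def lc_Cons eform_eq_0)
    then have \<alpha>: "pullback L (eform [a]) = lc ?\<alpha>" ..
    obtain g45 g46 g47 g56 g57 g67 where z: "chi z = lc (chi_list g45 g46 g47 g56 g57 g67)"
      unfolding chi_def at_point_def by blast
    have "wedge 1 5 (lc [(1, [a])]) (chi z) = lc (lc_wedge [(1, [a])] (chi_list g45 g46 g47 g56 g57 g67))"
      unfolding z by (rule wedge_lc) (simp_all add: chi_list_def)
    also have "\<dots> = lc []"
      by (rule lc_eqI) (use a in \<open>auto simp: chi_list_def lc_wedge_simps\<close>)
    finally have "wedge 1 5 (eform [a]) (chi z) = (\<lambda>_. 0)"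
      by (simp add: lc_def[abs_def])
    then have "pullback L (wedge 1 5 (eform [a]) (chi z)) = (\<lambda>_. 0)"
      by (simp add: pullback_def)
    then have 0: "wedge 1 5 (lc ?\<alpha>) (chi x) = (\<lambda>_. 0)"
      unfolding pullback_wedge \<alpha> chi[symmetric] .
    define T S P P' Q Q' where d: "T = cosh (x$1)" "S = sinh (x$1)" "P = exp (x$2)" "P' = exp (- x$2)"
      "Q = exp (x$3)" "Q' = exp (- x$3)"
    have PP: "P * P' = 1" "Q * Q' = 1" "T * T - S * S = 1" "T > 0" unfolding d by (rule cosh_sinh_exp_relations cosh_real_pos)+
    \<comment> \<open>The Pfaffian of the fibre factor is T^4 (18 S^2 - 18 T^2) = -18 T^4.\<close>
    have "T * T * (3 * S) * (T * T * (6 * S)) - T * T * (3 * T * P * Q) * (T * T * (3 * T * P' * Q'))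
        + T * T * (3 * T * P * Q') * (T * T * (- 3 * T * P' * Q))
      = (T * T) * (T * T) * (18 * (S * S) - 9 * (T * T) * ((P * P') * (Q * Q')) - 9 * (T * T) * ((P * P') * (Q * Q')))"
      by (simp add: algebra_simps)
    also have "\<dots> = (T * T) * (T * T) * (- 18)"
      using PP(3) unfolding PP(1,2) by (simp add: algebra_simps)
    finally have Pf: "T * T * (3 * S) * (T * T * (6 * S)) - T * T * (3 * T * P * Q) * (T * T * (3 * T * P' * Q'))
        + T * T * (3 * T * P * Q') * (T * T * (- 3 * T * P' * Q)) \<noteq> 0"
      using PP(4) by simp
    have "?f (ax 4) = 0" "?f (ax 5) = 0" "?f (ax 6) = 0" "?f (ax 7) = 0"
      using one_form_wedge_chi_list_0[OF 0[unfolded chi_def at_point_def d[symmetric]] Pf] by auto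
    moreover have "v$1 = 0" "v$2 = 0" "v$3 = 0"
      using arg_cong[OF v, of "\<lambda>w. w$1"] arg_cong[OF v, of "\<lambda>w. w$2"] arg_cong[OF v, of "\<lambda>w. w$3"]
      by (simp_all add: base_nth)
    ultimately show ?thesis using linear_expand[OF f, of v] by simp
  qed
  from this[of 1] this[of 2] this[of 3] show ?thesis
    by (simp add: Finite_Cartesian_Product.vec_eq_iff forall_7 base_nth)
qed

subsection \<open>Automorphisms\<close>

lemma linear_base: "linear base"
  using bounded_linear_base by (rule bounded_linear.linear)

lemma base_base: "base (base v) = base v"
  by (simp add: Finite_Cartesian_Product.vec_eq_iff base_nth)

lemma horizontal_nth: "base u = u \<Longrightarrow> u$4 = 0 \<and> u$5 = 0 \<and> u$6 = 0 \<and> u$7 = 0"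
  using base_nth[of u 4] base_nth[of u 5] base_nth[of u 6] base_nth[of u 7] by simp

lemma vertical_nth: "base u = 0 \<Longrightarrow> u$1 = 0 \<and> u$2 = 0 \<and> u$3 = 0"
  using base_nth[of u 1] base_nth[of u 2] base_nth[of u 3] by simp

lemma horizontal_vertical_orthogonal:
  assumes "base u = u" "base v = 0"
  shows "cofr x u \<bullet> cofr x v = 0"
  using horizontal_nth[OF assms(1)] vertical_nth[OF assms(2)] by (simp add: inner_7 cofr_nth)

lemma smooth_has_derivative:
  assumes "smooth_on UNIV f"
  shows "(f has_derivative frechet_derivative f (at x)) (at x)"
proof -
  have "Ck_on 1 UNIV f" using assms by (simp add: smooth_on_def)
  then show ?thesis by (simp add: frechet_derivative_works[symmetric])
qed

lemma smooth_frechet_derivative: "smooth_on UNIV f \<Longrightarrow> smooth_on UNIV (\<lambda>x. frechet_derivative f (at x) v)"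
  unfolding smooth_on_def by (metis Ck_on.simps(2))

lemma smooth_continuous: "smooth_on UNIV f \<Longrightarrow> isCont f x"
  unfolding smooth_on_def by (metis Ck_on.simps(1) UNIV_I continuous_on_eq_continuous_at open_UNIV)

lemma psi_coefficients:
  "\<exists>fs. (\<forall>z. psi z = lc (map (\<lambda>(f, is). (f z, is)) fs)) \<and> (\<forall>z. \<forall>(f, is)\<in>set fs. f differentiable (at z))"
proof (intro exI[of _ "map (\<lambda>(f, a, b, c, is). (at_point f, is)) psi_data"] conjI allI)
  fix z
  show "psi z = lc (map (\<lambda>(f, is). (f z, is)) (map (\<lambda>(f, a, b, c, is). (at_point f, is)) psi_data))"
    unfolding psi_def data_values_eq(2)[symmetric]
    by (simp add: at_point_def data_values_def o_def case_prod_unfold)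
  show "\<forall>(f, is)\<in>set (map (\<lambda>(f, a, b, c, is). (at_point f, is)) psi_data). f differentiable (at z)"
    using has_grad_data(2) unfolding has_grad_def grad_def differentiable_def by fastforce
qed

section \<open>Objects preserved by an automorphism\<close>

locale automorphism =
  fixes h :: "vec7 \<Rightarrow> vec7"
  assumes bij: "bij h" and smooth: "smooth_on UNIV h" and smooth_inv: "smooth_on UNIV (inv_into UNIV h)"
    and pres: "\<And>x. phi x = pullback (frechet_derivative h (at x)) (phi (h x))"
begin

definition D :: "vec7 \<Rightarrow> vec7 \<Rightarrow> vec7" where "D x = frechet_derivative h (at x)"

definition D2 :: "vec7 \<Rightarrow> vec7 \<Rightarrow> vec7 \<Rightarrow> vec7" where "D2 x v w = frechet_derivative (\<lambda>y. D y v) (at x) w"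

lemma pres_phi: "phi x = pullback (D x) (phi (h x))"
  unfolding D_def by (rule pres)

lemma h_deriv: "(h has_derivative D x) (at x)"
  unfolding D_def by (rule smooth_has_derivative[OF smooth])

lemma linear_D: "linear (D x)"
  using h_deriv by (rule has_derivative_linear)

lemma smooth_D: "smooth_on UNIV (\<lambda>x. D x v)"
  unfolding D_def by (rule smooth_frechet_derivative[OF smooth])

lemma D_deriv: "((\<lambda>y. D y v) has_derivative (\<lambda>w. D2 x v w)) (at x)"
  unfolding D2_def by (rule smooth_has_derivative[OF smooth_D])

lemma D2_symmetric: "D2 x v w = D2 x w v"
proof -
  have nth: "((\<lambda>y. f y $ i) has_derivative (\<lambda>w. f' w $ i)) (at y)"
    if "(f has_derivative f') (at y)" for f :: "vec7 \<Rightarrow> vec7" and f' i y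
    by (rule bounded_linear.has_derivative[OF bounded_linear_vec_nth that])
  have cont: "isCont (\<lambda>y. D2 y v w $ i) x" for v w i
    using smooth_continuous[OF smooth_frechet_derivative[OF smooth_D]]
    unfolding D2_def by (intro isCont_vec_nth)
  have "D2 x v w $ i = D2 x w v $ i" for i
    by (rule second_derivative_symmetric[of "\<lambda>y. h y $ i" "\<lambda>y v. D y v $ i" v "\<lambda>y w. D2 y v w $ i" w "\<lambda>y v. D2 y w v $ i"])
       (intro nth h_deriv D_deriv cont)+
  then show ?thesis by (simp add: Finite_Cartesian_Product.vec_eq_iff)
qed

lemma bij_D: "bij (D x)"
proof -
  let ?g = "inv_into UNIV h"
  have "((\<lambda>y. ?g (h y)) has_derivative (\<lambda>v. frechet_derivative ?g (at (h x)) (D x v))) (at x)"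
    by (rule has_derivative_compose[OF h_deriv smooth_has_derivative[OF smooth_inv]])
  moreover have "(\<lambda>y. ?g (h y)) = (\<lambda>y. y)"
    using bij by (simp add: bij_is_inj)
  ultimately have "(\<lambda>v. frechet_derivative ?g (at (h x)) (D x v)) = (\<lambda>v. v)"
    using has_derivative_unique has_derivative_ident by metis
  then have "inj (D x)" by (metis injI)
  then show ?thesis
    using linear_injective_imp_surjective[OF linear_D] by (simp add: bij_def)
qed

text \<open>This gives a second adapted coframe at x besides \<open>cofr x\<close>. Computing the
  metric and the 4-form from both yields their invariance.\<close>

lemma adapted_D: "adapted (phi x) (cofr (h x) \<circ> D x)"
proof (rule adapted.intro)
  have "phi x = pullback (D x) (pullback (cofr (h x)) phi0)"
    using pres_phi[of x] by (simp add: pullback_cofr_eqs)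
  then show "adapted_coframe (phi x) (cofr (h x) \<circ> D x)"
    unfolding adapted_coframe_def
    using linear_compose[OF linear_D linear_cofr] bij_comp[OF bij_D bij_cofr] by (simp add: pullback_def o_def)
qed

lemma pres_psi: "psi x = pullback (D x) (psi (h x))"
proof -
  have "psi x = pullback (cofr (h x) \<circ> D x) psi0"
    using adapted.hodge_star_phi[OF adapted_D] hodge_star_phi by metis
  also have "\<dots> = pullback (D x) (psi (h x))"
    unfolding pullback_cofr_eqs(2)[symmetric] by (simp add: pullback_def o_def)
  finally show ?thesis .
qed

lemma pres_metric: "cofr (h x) (D x u) \<bullet> cofr (h x) (D x v) = cofr x u \<bullet> cofr x v"
  using adapted.metric[OF adapted_D] metric_phi by (metis comp_apply)

lemma pres_chi: "chi x = pullback (D x) (chi (h x))"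
proof
  fix vs
  obtain fs where psi: "\<And>z. psi z = lc (map (\<lambda>(f, is). (f z, is)) fs)"
    and diff: "\<And>z. \<forall>(f, is)\<in>set fs. f differentiable (at z)"
    using psi_coefficients by blast
  show "chi x vs = pullback (D x) (chi (h x)) vs"
  proof (cases "length vs = 5")
    case True
    have eq: "(\<lambda>y. pullback (D y) (lc (map (\<lambda>(f, is). (f (h y), is)) fs))) = psi"
      by (rule ext) (simp only: psi[symmetric] pres_psi[symmetric])
    have eq': "(\<lambda>z. lc (map (\<lambda>(f, is). (f z, is)) fs)) = psi"
      by (rule ext) (simp only: psi)
    have "ext_deriv psi x vs = ext_deriv psi (h x) (map (D x) vs)"
      using ext_deriv_pullback[OF diff h_deriv refl D_deriv D2_symmetric True] unfolding eq eq' .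
    then show ?thesis by (simp only: ext_deriv_psi_chi pullback_def)
  qed (simp add: chi_def at_point_def chi_list_def lc_Cons eform_eq_0 pullback_def)
qed

lemma vertical_D: "base v = 0 \<Longrightarrow> base (D x v) = 0"
  by (rule vertical_chi[OF linear_D pres_chi])

abbreviation D_inv :: "vec7 \<Rightarrow> vec7 \<Rightarrow> vec7" where "D_inv x \<equiv> inv_into UNIV (D x)"

lemma D_D_inv: "D x (D_inv x v) = v"
  using bij_D by (simp add: bij_is_surj surj_f_inv_f)

lemma vertical_D_inv:
  assumes "base v = 0"
  shows "base (D_inv x v) = 0"
proof (rule vertical_chi[OF _ _ assms])
  show "linear (D_inv x)"
    using linear_D bij_D by (intro inj_linear_imp_inv_linear) (auto simp: bij_is_inj)
  show "chi (h x) = pullback (D_inv x) (chi x)"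
    unfolding pres_chi[of x] by (simp add: pullback_def o_def D_D_inv)
qed

text \<open>The vertical part w of the image is itself the image of a vertical vector, so it is
  orthogonal to the image of u. It is also orthogonal to the base part of that image, hence to
  itself.\<close>

lemma horizontal_D:
  assumes u: "base u = u"
  shows "base (D x u) = D x u"
proof -
  define w where "w = D x u - base (D x u)"
  have w: "base w = 0" by (simp add: w_def linear_diff[OF linear_base] base_base)
  have "cofr (h x) (D x u) \<bullet> cofr (h x) (D x (D_inv x w)) = 0"
    unfolding pres_metric by (rule horizontal_vertical_orthogonal[OF u vertical_D_inv[OF w]])
  then have "cofr (h x) (D x u) \<bullet> cofr (h x) w = 0" by (simp add: D_D_inv)
  moreover have "D x u = base (D x u) + w" by (simp add: w_def)
  then have "cofr (h x) (D x u) = cofr (h x) (base (D x u)) + cofr (h x) w"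
    using linear_add[OF linear_cofr] by metis
  moreover have "cofr (h x) (base (D x u)) \<bullet> cofr (h x) w = 0"
    by (rule horizontal_vertical_orthogonal[OF base_base w])
  ultimately have "cofr (h x) w \<bullet> cofr (h x) w = 0" by (simp add: inner_add_left)
  then have "w = 0" using cofr_eq_0 by simp
  then show ?thesis by (simp add: w_def)
qed

section \<open>An automorphism is a product map\<close>

lemma constant_along:
  assumes "\<And>y. D y u $ i = 0"
  shows "h (x + u) $ i = h x $ i"
proof -
  have "((\<lambda>s. h (x + s *\<^sub>R u) $ i) has_real_derivative 0) (at s)" for s
    using DERIV_along_line[of "\<lambda>y. h y $ i" "\<lambda>v. D (x + s *\<^sub>R u) v $ i" x s u]
      bounded_linear.has_derivative[OF bounded_linear_vec_nth h_deriv] assms by simp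
  from DERIV_isconst_all[of "\<lambda>s. h (x + s *\<^sub>R u) $ i" 1 0] this show ?thesis by simp
qed

lemma base_h: "base v = 0 \<Longrightarrow> base (h (x + v)) = base (h x)"
  using constant_along[of v 1 x] constant_along[of v 2 x] constant_along[of v 3 x] vertical_nth[OF vertical_D]
  by (simp add: Finite_Cartesian_Product.vec_eq_iff forall_7 base_nth)

lemma vertical_h:
  assumes "base u = u"
  shows "h (x + u) - base (h (x + u)) = h x - base (h x)"
  using constant_along[of u 4 x] constant_along[of u 5 x] constant_along[of u 6 x] constant_along[of u 7 x]
    horizontal_nth[OF horizontal_D[OF assms]]
  by (simp add: Finite_Cartesian_Product.vec_eq_iff forall_7 base_nth)

text \<open>By \<open>vertical_h\<close> the fibre component of h is unchanged by horizontal
  translation, and so is its derivative; on a vertical vector that derivative is all of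
  \<open>D\<close>.\<close>

lemma D_horizontal_translate:
  assumes u: "base u = u" and v: "base v = 0"
  shows "D (x + u) v = D x v"
proof -
  let ?g = "\<lambda>y. h y - base (h y)"
  have g: "(?g has_derivative (\<lambda>w. D y w - base (D y w))) (at y)" for y
    by (intro has_derivative_diff h_deriv bounded_linear.has_derivative[OF bounded_linear_base])
  have "((\<lambda>y. y + u) has_derivative (\<lambda>w. w)) (at x)" by (auto intro!: derivative_eq_intros)
  from has_derivative_compose[OF this g]
  have "((\<lambda>y. ?g (y + u)) has_derivative (\<lambda>w. D (x + u) w - base (D (x + u) w))) (at x)" .
  moreover have "(\<lambda>y. ?g (y + u)) = ?g" by (rule ext, rule vertical_h[OF u])
  ultimately have "(?g has_derivative (\<lambda>w. D (x + u) w - base (D (x + u) w))) (at x)" by simp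
  from has_derivative_unique[OF this g]
  have "(\<lambda>w. D (x + u) w - base (D (x + u) w)) = (\<lambda>w. D x w - base (D x w))" .
  from fun_cong[OF this, of v] show ?thesis using vertical_D[OF v] by simp
qed

text \<open>On three horizontal vectors only the e^123 term of \<open>phi\<close> survives, and it
  is vol_B. This expresses \<open>tau\<close> on fibres through two invariant forms.\<close>

lemma chi_split:
  assumes u: "base u1 = u1" "base u2 = u2" "base u3 = u3" and v: "base v = 0" "base w = 0"
  shows "chi x [u1, u2, u3, v, w] = phi x [u1, u2, u3] * tau x [v, w]"
proof -
  note n = horizontal_nth[OF u(1)] horizontal_nth[OF u(2)] horizontal_nth[OF u(3)] vertical_nth[OF v(1)] vertical_nth[OF v(2)]
  have s: "eform [1,2,3,a,b] [u1, u2, u3, v, w] = eform [1,2,3] [u1, u2, u3] * eform [a,b] [v, w]"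
    if "a \<in> {4,5,6,7}" "b \<in> {4,5,6,7}" for a b
  proof -
    have "u1 $ of_nat a = 0" "u2 $ of_nat a = 0" "u3 $ of_nat a = 0" "u1 $ of_nat b = 0" "u2 $ of_nat b = 0" "u3 $ of_nat b = 0"
      using that n by auto
    then show ?thesis using n by (simp add: eform_columns eform_Nil algebra_simps)
  qed
  have "phi x [u1, u2, u3] = cosh (x$1) * cosh (x$1) * eform [1,2,3] [u1, u2, u3]"
    using n by (simp add: phi_def at_point_def phi_list_def lc_Cons eform_columns eform_Nil)
  then show ?thesis
    unfolding chi_def tau_def at_point_def chi_list_def tau_list_def lc_Cons lc_Nil
    by (simp only: s insert_iff simp_thms) (simp add: algebra_simps)
qed

lemma pres_tau:
  assumes v: "base v = 0" "base w = 0"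
  shows "tau x [v, w] = tau (h x) [D x v, D x w]"
proof -
  have e: "base (ax 1) = ax 1" "base (ax 2) = ax 2" "base (ax 3) = ax 3"
    by (simp_all add: Finite_Cartesian_Product.vec_eq_iff forall_7 base_nth axis_nth)
  have "phi x [ax 1, ax 2, ax 3] * tau x [v, w] = chi x [ax 1, ax 2, ax 3, v, w]"
    by (rule chi_split[OF e v, symmetric])
  also have "\<dots> = chi (h x) [D x (ax 1), D x (ax 2), D x (ax 3), D x v, D x w]"
    using fun_cong[OF pres_chi, of x "[ax 1, ax 2, ax 3, v, w]"] by (simp add: pullback_def)
  also have "\<dots> = phi (h x) [D x (ax 1), D x (ax 2), D x (ax 3)] * tau (h x) [D x v, D x w]"
    by (intro chi_split horizontal_D vertical_D e v)
  also have "phi (h x) [D x (ax 1), D x (ax 2), D x (ax 3)] = phi x [ax 1, ax 2, ax 3]"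
    using fun_cong[OF pres_phi, of x "[ax 1, ax 2, ax 3]"] by (simp add: pullback_def)
  finally have "phi x [ax 1, ax 2, ax 3] * tau x [v, w] = phi x [ax 1, ax 2, ax 3] * tau (h x) [D x v, D x w]" .
  moreover have "phi x [ax 1, ax 2, ax 3] \<noteq> 0"
    using cosh_real_pos[of "x$1"] by (simp add: phi_def at_point_def phi_list_def lc_Cons eform_columns eform_Nil axis_nth)
  ultimately show ?thesis by simp
qed

end

section \<open>Pencils of 2-forms on the fibre\<close>

definition eps :: covector where "eps = lc [(1, [4,5]), (2, [6,7])]"

definition point :: "real \<Rightarrow> real \<Rightarrow> real \<Rightarrow> vec7" where
  "point t p q = (\<chi> i. if i = 1 then t else if i = 2 then p else if i = 3 then q else 0)"

lemma point_nth: "point t p q $ i = (if i = 1 then t else if i = 2 then p else if i = 3 then q else 0)"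
  by (simp add: point_def)

lemma base_point: "base (point t p q) = point t p q"
  by (simp add: Finite_Cartesian_Product.vec_eq_iff base_nth point_nth)

lemma base_eq_point: "base x = point (x$1) (x$2) (x$3)"
  by (simp add: Finite_Cartesian_Product.vec_eq_iff base_nth point_nth)

lemma tau_base: "tau (base x) = tau x"
  by (simp add: tau_def at_point_def base_nth)

lemma tau_point: "tau (point t p q) vs = cosh t * tau (point 0 p q) vs + 3 * sinh t * eps vs"
  by (simp add: tau_def at_point_def point_nth tau_list_def eps_def lc_Cons algebra_simps)

lemma tau_frame:
  "tau x [ax 4, ax 5] = 3 * sinh (x$1)" "tau x [ax 6, ax 7] = 6 * sinh (x$1)"
  "tau x [ax 4, ax 6] = 3 * cosh (x$1) * exp (x$2) * exp (x$3)"
  "tau x [ax 4, ax 7] = 3 * cosh (x$1) * exp (x$2) * exp (- x$3)"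
  "tau x [ax 5, ax 6] = - 3 * cosh (x$1) * exp (- x$2) * exp (x$3)"
  "tau x [ax 5, ax 7] = 3 * cosh (x$1) * exp (- x$2) * exp (- x$3)"
  by (simp_all add: tau_def at_point_def tau_list_def lc_Cons eform_columns axis_nth eform_Nil)

text \<open>The first relation reflects the coefficients 1 and 2 of the sinh part, the second the
  product form of the exponential coefficients, and the third the constancy of F \<and> F: its
  left-hand side is the Pfaffian of 3F.\<close>

lemma tau_relations:
  "tau x [ax 6, ax 7] = 2 * tau x [ax 4, ax 5]"
  "tau x [ax 4, ax 6] * tau x [ax 5, ax 7] + tau x [ax 4, ax 7] * tau x [ax 5, ax 6] = 0"
  "tau x [ax 4, ax 5] * tau x [ax 6, ax 7] - tau x [ax 4, ax 6] * tau x [ax 5, ax 7]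
     + tau x [ax 4, ax 7] * tau x [ax 5, ax 6] = - 18"
proof -
  define T S P P' Q Q' where d: "T = cosh (x$1)" "S = sinh (x$1)" "P = exp (x$2)" "P' = exp (- x$2)"
    "Q = exp (x$3)" "Q' = exp (- x$3)"
  have r: "P * P' = 1" "Q * Q' = 1" "T * T - S * S = 1" unfolding d by (rule cosh_sinh_exp_relations)+
  note f = tau_frame[of x, folded d]
  show "tau x [ax 6, ax 7] = 2 * tau x [ax 4, ax 5]" by (simp add: f)
  show "tau x [ax 4, ax 6] * tau x [ax 5, ax 7] + tau x [ax 4, ax 7] * tau x [ax 5, ax 6] = 0"
    by (simp add: f)
  have "tau x [ax 4, ax 5] * tau x [ax 6, ax 7] - tau x [ax 4, ax 6] * tau x [ax 5, ax 7]
     + tau x [ax 4, ax 7] * tau x [ax 5, ax 6] = 18 * (S * S) - 18 * (T * T) * ((P * P') * (Q * Q'))"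
    unfolding f by (simp add: algebra_simps)
  then show "tau x [ax 4, ax 5] * tau x [ax 6, ax 7] - tau x [ax 4, ax 6] * tau x [ax 5, ax 7]
     + tau x [ax 4, ax 7] * tau x [ax 5, ax 6] = - 18"
    using r(3) unfolding r(1,2) by (simp add: algebra_simps)
qed

text \<open>A label such as 46 stands for the pair of basis vectors with indices 4 and 6. Adding and
  subtracting the relations at (c, s) and (c, -s) separates each quadratic form into its values on
  \<open>a\<close> and \<open>g\<close> and its polar part. The Pfaffian 2 of \<open>g\<close> comes
  from -18 for \<open>a\<close> and c^2 - 1 = s^2.\<close>

lemma pencil_relations:
  fixes a g :: "nat \<Rightarrow> real" and c s :: real
  assumes cs: "c * c - s * s = 1" "s \<noteq> 0" "c \<noteq> 0"
    and a: "a 67 = 2 * a 45" "a 46 * a 57 + a 47 * a 56 = 0" "a 45 * a 67 - a 46 * a 57 + a 47 * a 56 = - 18"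
    and p: "\<And>i. p i = c * a i + 3 * s * g i" "p 67 = 2 * p 45" "p 46 * p 57 + p 47 * p 56 = 0"
      "p 45 * p 67 - p 46 * p 57 + p 47 * p 56 = - 18"
    and m: "\<And>i. m i = c * a i + 3 * (- s) * g i" "m 46 * m 57 + m 47 * m 56 = 0"
      "m 45 * m 67 - m 46 * m 57 + m 47 * m 56 = - 18"
  shows "g 67 = 2 * g 45" "g 46 * g 57 + g 47 * g 56 = 0"
    "a 46 * g 57 + a 57 * g 46 + a 47 * g 56 + a 56 * g 47 = 0"
    "a 45 * g 67 + a 67 * g 45 - a 46 * g 57 - a 57 * g 46 + a 47 * g 56 + a 56 * g 47 = 0"
    "g 45 * g 67 - g 46 * g 57 + g 47 * g 56 = 2"
proof -
  have "3 * s * g 67 = 3 * s * (2 * g 45)"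
    using p(2) a(1) unfolding p(1) by (simp add: algebra_simps)
  then show "g 67 = 2 * g 45" using cs by simp
  let ?Qa = "a 46 * a 57 + a 47 * a 56" and ?Qg = "g 46 * g 57 + g 47 * g 56"
    and ?B = "a 46 * g 57 + a 57 * g 46 + a 47 * g 56 + a 56 * g 47"
  have "(p 46 * p 57 + p 47 * p 56) + (m 46 * m 57 + m 47 * m 56) = 2 * (c * c) * ?Qa + 18 * (s * s) * ?Qg"
    unfolding p(1) m(1) by (simp add: algebra_simps)
  then show "?Qg = 0" unfolding p(3) m(2) a(2) using cs by simp
  have "(p 46 * p 57 + p 47 * p 56) - (m 46 * m 57 + m 47 * m 56) = 6 * (c * s) * ?B"
    unfolding p(1) m(1) by (simp add: algebra_simps)
  then show "?B = 0" unfolding p(3) m(2) using cs by simp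
  let ?Pa = "a 45 * a 67 - a 46 * a 57 + a 47 * a 56" and ?Pg = "g 45 * g 67 - g 46 * g 57 + g 47 * g 56"
    and ?PB = "a 45 * g 67 + a 67 * g 45 - a 46 * g 57 - a 57 * g 46 + a 47 * g 56 + a 56 * g 47"
  have "(p 45 * p 67 - p 46 * p 57 + p 47 * p 56) - (m 45 * m 67 - m 46 * m 57 + m 47 * m 56) = 6 * (c * s) * ?PB"
    unfolding p(1) m(1) by (simp add: algebra_simps)
  then show "?PB = 0" unfolding p(4) m(3) using cs by simp
  have "(p 45 * p 67 - p 46 * p 57 + p 47 * p 56) + (m 45 * m 67 - m 46 * m 57 + m 47 * m 56)
      = 2 * (c * c) * ?Pa + 18 * (s * s) * ?Pg"
    unfolding p(1) m(1) by (simp add: algebra_simps)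
  then have "18 * (s * s) * ?Pg = 36 * (c * c) - 36" unfolding p(4) m(3) a(3) by simp
  also have "\<dots> = 18 * (s * s) * 2" using cs(1) by simp
  finally show "?Pg = 2" using cs(2) by simp
qed

context automorphism
begin

text \<open>Horizontal translation from 0 to b does not change the derivative on vertical vectors,
  so \<open>D_inv 0\<close> inverts \<open>D b\<close> there: one linear map for every base
  point.\<close>

lemma tau_h:
  assumes b: "base b = b" and v: "base v = 0" "base w = 0"
  shows "tau (h b) [v, w] = tau b [D_inv 0 v, D_inv 0 w]"
proof -
  have *: "D b (D_inv 0 u) = u" if "base u = 0" for u
    using D_horizontal_translate[OF b vertical_D_inv[OF that], of 0 0] by (simp add: D_D_inv)
  show ?thesis
    using pres_tau[OF vertical_D_inv[OF v(1)] vertical_D_inv[OF v(2)], of b 0 0] by (simp add: * v)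
qed

text \<open>For fixed \<open>p\<close> and \<open>q\<close>, \<open>tau\<close> runs through a curve \<open>cosh t a + 3 sinh t \<epsilon>\<close> in the space of
  2-forms on the fibre, where \<open>\<epsilon>\<close> does not depend on \<open>p\<close> and \<open>q\<close>. An automorphism acts on these
  2-forms by a single linear map. The image \<open>g\<close> of \<open>\<epsilon>\<close> satisfies the relations obtained by
  separating powers in the quadratic relations between the values of \<open>tau\<close>; they force \<open>g\<close> to be
  a nonzero multiple of \<open>\<epsilon>\<close>, and then orthogonality of \<open>a\<close> and \<open>\<epsilon>\<close> preserves \<open>t = 0\<close>.\<close>

lemma h_0: "h 0 $ 1 = 0"
proof -
  define \<gamma> where "\<gamma> v w = eps [D_inv 0 v, D_inv 0 w]" for v w
  have pencil: "tau (h (point t p q)) [v, w] = cosh t * tau (h (point 0 p q)) [v, w] + 3 * sinh t * \<gamma> v w"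
    if "base v = 0" "base w = 0" for t p q v w
    unfolding \<gamma>_def tau_h[OF base_point that] by (rule tau_point)
  have vert: "base (ax 4) = 0" "base (ax 5) = 0" "base (ax 6) = 0" "base (ax 7) = 0"
    by (simp_all add: Finite_Cartesian_Product.vec_eq_iff forall_7 base_nth axis_nth)
  define pr :: "nat \<Rightarrow> vec7 \<times> vec7" where "pr i = (if i = 45 then (ax 4, ax 5) else if i = 46 then (ax 4, ax 6)
    else if i = 47 then (ax 4, ax 7) else if i = 56 then (ax 5, ax 6) else if i = 57 then (ax 5, ax 7) else (ax 6, ax 7))" for i
  define g where "g i = \<gamma> (fst (pr i)) (snd (pr i))" for i
  define a where "a t p q i = tau (h (point t p q)) [fst (pr i), snd (pr i)]" for t p q i
  have pr: "pr 45 = (ax 4, ax 5)" "pr 46 = (ax 4, ax 6)" "pr 47 = (ax 4, ax 7)" "pr 56 = (ax 5, ax 6)"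
    "pr 57 = (ax 5, ax 7)" "pr 67 = (ax 6, ax 7)" by (simp_all add: pr_def)
  have a: "a t p q i = cosh t * a 0 p q i + 3 * sinh t * g i" for t p q i
  proof -
    have "base (fst (pr i)) = 0 \<and> base (snd (pr i)) = 0" by (simp add: pr_def vert)
    then show ?thesis unfolding a_def g_def by (intro pencil) auto
  qed
  have rel: "a t p q 67 = 2 * a t p q 45" "a t p q 46 * a t p q 57 + a t p q 47 * a t p q 56 = 0"
    "a t p q 45 * a t p q 67 - a t p q 46 * a t p q 57 + a t p q 47 * a t p q 56 = - 18" for t p q
    unfolding a_def pr fst_conv snd_conv by (rule tau_relations)+
  \<comment> \<open>The samples t = 1 and t = -1 supply the two parameters with opposite
    sinh.\<close>
  have cs: "cosh 1 * cosh 1 - sinh 1 * sinh 1 = (1::real)" "sinh 1 \<noteq> (0::real)" "cosh 1 \<noteq> (0::real)"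
    using cosh_sinh_exp_relations(1)[of 1] cosh_real_pos[of 1] by simp_all
  have m: "a (- 1) p q i = cosh 1 * a 0 p q i + 3 * (- sinh 1) * g i" for p q i
    using a[of "- 1" p q i] by simp
  have R: "g 67 = 2 * g 45" "g 46 * g 57 + g 47 * g 56 = 0"
    "a 0 p q 46 * g 57 + a 0 p q 57 * g 46 + a 0 p q 47 * g 56 + a 0 p q 56 * g 47 = 0"
    "a 0 p q 45 * g 67 + a 0 p q 67 * g 45 - a 0 p q 46 * g 57 - a 0 p q 57 * g 46 + a 0 p q 47 * g 56 + a 0 p q 56 * g 47 = 0"
    "g 45 * g 67 - g 46 * g 57 + g 47 * g 56 = 2" for p q
    by (rule pencil_relations[OF cs rel[of 0 p q] a[of 1 p q] rel[of 1 p q] m[of p q] rel(2,3)[of "- 1" p q]])+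
  \<comment> \<open>As the quadratic form vanishes on \<open>g\<close>, the polar relation extends
    from t = 0 to all t.\<close>
  have "a t p q 46 * g 57 + a t p q 57 * g 46 + a t p q 47 * g 56 + a t p q 56 * g 47 =
      cosh t * (a 0 p q 46 * g 57 + a 0 p q 57 * g 46 + a 0 p q 47 * g 56 + a 0 p q 56 * g 47)
      + 6 * sinh t * (g 46 * g 57 + g 47 * g 56)" for t p q
    unfolding a[of t p q] by (simp add: algebra_simps)
  then have B: "a t p q 46 * g 57 + a t p q 57 * g 46 + a t p q 47 * g 56 + a t p q 56 * g 47 = 0" for t p q
    unfolding R(2,3) by simp
  have lin: "exp p * exp q * g 57 + exp (- p) * exp (- q) * g 46 + exp p * exp (- q) * g 56 - exp (- p) * exp q * g 47 = 0" for p q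
  proof -
    \<comment> \<open>By surjectivity of h, every point (0, p, q) is an image. Moving x along its
      fibre to \<open>base x\<close> changes the image only along its fibre, where
      \<open>tau\<close> is constant.\<close>
    obtain x where x: "h x = point 0 p q" using bij by (metis bij_is_surj surjD)
    have "base (x - base x) = 0" by (simp add: linear_diff[OF linear_base] base_base)
    from base_h[OF this, of "base x"] have "base (h (base x)) = point 0 p q" by (simp add: x base_point)
    then have "tau (h (base x)) = tau (point 0 p q)" using tau_base by metis
    then have "a (x$1) (x$2) (x$3) i = tau (point 0 p q) [fst (pr i), snd (pr i)]" for i
      by (simp add: a_def base_eq_point)
    then have "3 * (exp p * exp q * g 57 + exp (- p) * exp (- q) * g 46 + exp p * exp (- q) * g 56 - exp (- p) * exp q * g 47) = 0"
      using B[of "x$1" "x$2" "x$3"] by (simp add: pr tau_frame point_nth algebra_simps)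
    then show ?thesis by simp
  qed
  \<comment> \<open>The four functions exp(+-p +-q) are linearly independent, and four sample points
    already force their coefficients to vanish.\<close>
  have l2: "exp (ln 2) = (2::real)" "exp (- ln 2) = (1/2::real)" by (simp_all add: exp_minus)
  have "g 57 + g 46 + g 56 - g 47 = 0" using lin[of 0 0] by simp
  moreover have "4 * g 57 + g 46 / 4 + g 56 - g 47 = 0" using lin[of "ln 2" "ln 2"] by (simp add: l2)
  moreover have "g 57 + g 46 + 4 * g 56 - g 47 / 4 = 0" using lin[of "ln 2" "- ln 2"] by (simp add: l2)
  moreover have "g 57 / 4 + 4 * g 46 + g 56 - g 47 = 0" using lin[of "- ln 2" "- ln 2"] by (simp add: l2)
  ultimately have g0: "g 46 = 0" "g 47 = 0" "g 56 = 0" "g 57 = 0" by linarith+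
  have "g 45 \<noteq> 0" using R(1,5) g0 by auto
  \<comment> \<open>Now \<open>g\<close> is a multiple of \<open>eps\<close>, so orthogonality to it
    at the origin forces the 45-component, which is 3 sinh of the first coordinate of
    \<open>h 0\<close>, to vanish.\<close>
  moreover have "4 * (a 0 0 0 45 * g 45) = 0"
    using R(4)[of 0 0] R(1) rel(1)[of 0 0 0] g0 by (simp add: algebra_simps)
  ultimately have "a 0 0 0 45 = 0" by simp
  moreover have "point 0 0 0 = 0" by (simp add: Finite_Cartesian_Product.vec_eq_iff point_nth)
  ultimately show ?thesis by (simp add: a_def pr tau_frame)
qed

end

text \<open>The origin lies on the surface t = 0 and \<open>ax 1\<close> lies on t = 1, so no
  automorphism takes one to the other.\<close>

lemma not_homogeneous_phi: "\<not> homogeneous euclidean {chart0} (global_form phi)"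
proof
  assume "homogeneous euclidean {chart0} (global_form phi)"
  then obtain h where h: "diffeomorphism euclidean {chart0} h" "preserves {chart0} (global_form phi) h" "h 0 = ax 1"
    unfolding homogeneous_def by (metis UNIV_I topspace_euclidean)
  have bij: "bij h" and smooth: "smooth_on UNIV h" "smooth_on UNIV (inv_into UNIV h)"
    using h(1) by (simp_all add: diffeomorphism_def smooth_map_def local_chart0)
  have pres: "phi x = pullback (frechet_derivative h (at x)) (phi (h x))" for x
    using h(2) unfolding preserves_chart0 by (rule spec)
  interpret automorphism h
    by (rule automorphism.intro[OF bij smooth pres])
  show False using h_0 h(3) by (simp add: axis_nth)
qed

theorem mainTheorem4:
  shows "\<exists>(X :: vec7 topology) \<A> \<phi> \<tau>.
    smooth_manifold X \<A> \<and> connected_space X \<and>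
    G2_structure \<A> \<phi> \<and> closed_form \<A> \<phi> \<and>
    torsion_form \<A> \<phi> \<tau> \<and> ERP \<A> \<phi> \<tau> \<and> not_identically_zero \<A> \<tau> \<and>
    complete_metric X \<A> \<phi> \<and>
    \<not> homogeneous X \<A> \<phi>"
proof (intro exI conjI)
  show "connected_space (euclidean :: vec7 topology)"
    using connected_UNIV[where 'a = vec7]
    by (metis connectedin_iff_connected connectedin_topspace topspace_euclidean)
qed (rule manifold G2_phi closed_phi torsion_phi ERP_phi tau_nonzero complete_phi not_homogeneous_phi)+

end
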